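(* Let $(R,\mathfrak m)$ be a Noetherian local ring of dimension $d\geq 1$ with infinite residue field, let $s\ge 1$, and let $I_1,\ldots,I_s$ be $\mathfrak m$-primary ideals of $R$; write $\mathbf I=(I_1,\ldots,I_s)$. Let $\mathcal F=\{\mathcal F(\mathbf n)\}_{\mathbf n\in\mathbb Z^s}$ be an $\mathbf I$-admissible filtration of ideals in $R$. Then $\operatorname{reg}(G(\mathcal F))\subseteq\mathbb N^s$.
   Context: Notation: $\mathbb N$ includes $0$; $\mathbf e=(1,\ldots,1)$, $\mathbf 0=(0,\ldots,0)$, and $\mathbf e_i\in\mathbb Z^s$ is the $i$-th standard basis vector. For $\mathbf m,\mathbf n\in\mathbb Z^s$, $\mathbf m\ge\mathbf n$ means $m_i\ge n_i$ for all $i$. For $\mathbf n\in\mathbb Z^s$, $\mathbf n^+=(\max\{0,n_1\},\ldots,\max\{0,n_s\})$ and $\mathbf I^{\mathbf n}=I_1^{n_1}\cdots I_s^{n_s}$, where $I_i^{n_i}=R$ if $n_i\le 0$. For $\mathbf p\in\mathbb N^s$, $|\mathbf p|=p_1+\cdots+p_s$. A $\mathbb Z^s$-graded $\mathbf I$-filtration is a family of ideals $\mathcal F=\{\mathcal F(\mathbf n)\}_{\mathbf n\in\mathbb Z^s}$ of $R$ with $\mathbf I^{\mathbf n}\subseteq\mathcal F(\mathbf n)$, $\mathcal F(\mathbf n)\mathcal F(\mathbf m)\subseteq\mathcal F(\mathbf n+\mathbf m)$, and $\mathcal F(\mathbf m)\subseteq\mathcal F(\mathbf n)$ whenever $\mathbf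 m\ge\mathbf n$. With indeterminates $t_1,\dots,t_s$ and $\mathbf t^{\mathbf n}=t_1^{n_1}\cdots t_s^{n_s}$, put $\mathcal R'(\mathcal F)=\bigoplus_{\mathbf n\in\mathbb Z^s}\mathcal F(\mathbf n)\mathbf t^{\mathbf n}$ and $\mathcal R'(\mathbf I)=\bigoplus_{\mathbf n\in\mathbb Z^s}\mathbf I^{\mathbf n}\mathbf t^{\mathbf n}$. $\mathcal F$ is $\mathbf I$-admissible if $\mathcal F(\mathbf n)=\mathcal F(\mathbf n^+)$ for all $\mathbf n\in\mathbb Z^s$ and $\mathcal R'(\mathcal F)$ is a finite $\mathcal R'(\mathbf I)$-module. Associated multigraded rings: $G(\mathcal F)=\bigoplus_{\mathbf n\in\mathbb N^s}\mathcal F(\mathbf n)/\mathcal F(\mathbf n+\mathbf e)$ and $G(\mathbf I)=\bigoplus_{\mathbf n\in\mathbb N^s}\mathbf I^{\mathbf n}/\mathbf I^{\mathbf n+\mathbf e}$; $G(\mathcal F)$ is regarded as a (finitely generated) graded $G(\mathbf I)$-module. Regularity: let $S=\bigoplus_{\mathbf n\in\mathbb N^s}S_{\mathbf n}$ be a standard Noetherian $\mathbb N^s$-graded ring over a local ring $S_{\mathbf 0}$, $S_{++}=\bigoplus_{\mathbf n\ge\mathbf e}S_{\mathbf n}$, and $M$ a finitely generated $\mathbb Z^s$-graded $S$-module. For $\mathbf m\in\mathbb Z^s$, $M$ is $\mathbf m$-regular if for all $\mathbf n\in\mathbb N^s$: (1) $[H^0_{S_{++}}(M)]_{\mathbf n+\mathbf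 m+\mathbf e_j}=0$ for all $j=1,\ldots,s$; (2) $[H^i_{S_{++}}(M)]_{\mathbf n+\mathbf m-\mathbf p}=0$ for all $i\ge1$ and $\mathbf p\in\mathbb N^s$ with $|\mathbf p|=i-1$. Set $\operatorname{reg}(M)=\{\mathbf m\in\mathbb Z^s\mid M\text{ is }\mathbf m\text{-regular}\}$. Here $\operatorname{reg}(G(\mathcal F))$ is taken with $S=G(\mathbf I)$. *)

theory Defs
  imports
    "HOL-Library.Extended_Nat"
    "HOL-Algebra.Module"
    "HOL-Algebra.QuotRing"
    "HOL-Algebra.Ideal_Product"
    "HOL-Algebra.Ring_Divisibility"
    "HOL-Analysis.Finite_Cartesian_Product"
begin

text \<open>
  Elements of \<open>\<int>\<^sup>s\<close> are vectors of type \<^typ>\<open>int ^ 's\<close>, where \<open>'s\<close> is a (nonempty) finite index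
  type. Order and arithmetic on them are componentwise, so \<open>1\<close> is the vector \<open>(1, \<dots>, 1)\<close>, and
  \<open>axis j 1\<close> is the standard basis vector in direction \<open>j\<close>.
\<close>


section \<open>Local rings, dimension, primary ideals\<close>

definition local_ring :: "('a, 'x) ring_scheme \<Rightarrow> 'a set \<Rightarrow> bool" where
  "local_ring R m \<longleftrightarrow> cring R \<and> maximalideal m R \<and> (\<forall>J. maximalideal J R \<longrightarrow> J = m)"

definition krull_dim :: "('a, 'x) ring_scheme \<Rightarrow> enat" where
  "krull_dim R =
     (SUP Ps \<in> {Ps. Ps \<noteq> [] \<and> (\<forall>P\<in>set Ps. primeideal P R) \<and> sorted_wrt (\<subset>) Ps}.
        enat (length Ps - 1))"

definition ideal_radical :: "('a, 'x) ring_scheme \<Rightarrow> 'a set \<Rightarrow> 'a set" where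
  "ideal_radical R I = {a \<in> carrier R. \<exists>k::nat. a [^]\<^bsub>R\<^esub> k \<in> I}"

definition primary_ideal :: "('a, 'x) ring_scheme \<Rightarrow> 'a set \<Rightarrow> bool" where
  "primary_ideal R I \<longleftrightarrow> ideal I R \<and> I \<noteq> carrier R \<and>
     (\<forall>a\<in>carrier R. \<forall>b\<in>carrier R. a \<otimes>\<^bsub>R\<^esub> b \<in> I \<longrightarrow> a \<in> I \<or> b \<in> ideal_radical R I)"

definition primary_to :: "('a, 'x) ring_scheme \<Rightarrow> 'a set \<Rightarrow> 'a set \<Rightarrow> bool" where
  "primary_to R m I \<longleftrightarrow> primary_ideal R I \<and> ideal_radical R I = m"


section \<open>Multigraded filtrations\<close>

text \<open>Since \<open>nat\<close> truncates and the unit of \<^const>\<open>ideals_set\<close> is the unit ideal, nonpositive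
  exponents contribute the factor \<open>R\<close>.\<close>

definition ideal_power ::
    "('a, 'x) ring_scheme \<Rightarrow> ('s::finite \<Rightarrow> 'a set) \<Rightarrow> int ^ 's \<Rightarrow> 'a set" where
  "ideal_power R I n =
     (\<Otimes>\<^bsub>ideals_set R\<^esub> i \<in> UNIV. I i [^]\<^bsub>ideals_set R\<^esub> nat (n $ i))"

definition filtration ::
    "('a, 'x) ring_scheme \<Rightarrow> ('s::finite \<Rightarrow> 'a set) \<Rightarrow> (int ^ 's \<Rightarrow> 'a set) \<Rightarrow> bool" where
  "filtration R I F \<longleftrightarrow>
     (\<forall>n. ideal (F n) R) \<and>
     (\<forall>n. ideal_power R I n \<subseteq> F n) \<and>
     (\<forall>n m. ideal_prod R (F n) (F m) \<subseteq> F (n + m)) \<and>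
     (\<forall>m n. n \<le> m \<longrightarrow> F m \<subseteq> F n)"

definition pos_part :: "int ^ 's::finite \<Rightarrow> int ^ 's" where
  "pos_part n = (\<chi> i. max 0 (n $ i))"

text \<open>
  The extended Rees algebra \<open>\<Oplus>\<^sub>n F(n) t\<^sup>n\<close>: a finite sum \<open>\<Sum>\<^sub>n f\<^sub>n t\<^sup>n\<close> is represented by its
  coefficient function. The product is used both as the ring multiplication and as scalar
  multiplication; with the latter, \<open>rees R F\<close> is a module over \<open>rees R E\<close> for every filtration
  \<open>E\<close> with \<open>E(n) F(m) \<subseteq> F(n + m)\<close>, in particular for \<open>E = ideal_power R I\<close>.
\<close>

definition laurent_mult ::
    "('a, 'x) ring_scheme \<Rightarrow> (int ^ 's::finite \<Rightarrow> 'a) \<Rightarrow> (int ^ 's \<Rightarrow> 'a) \<Rightarrow> int ^ 's \<Rightarrow> 'a" where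
  "laurent_mult R f g =
     (\<lambda>n. \<Oplus>\<^bsub>R\<^esub> k \<in> {k. f k \<noteq> \<zero>\<^bsub>R\<^esub>}. f k \<otimes>\<^bsub>R\<^esub> g (n - k))"

definition rees ::
    "('a, 'x) ring_scheme \<Rightarrow> (int ^ 's::finite \<Rightarrow> 'a set)
      \<Rightarrow> (int ^ 's \<Rightarrow> 'a, int ^ 's \<Rightarrow> 'a) module" where
  "rees R F =
     \<lparr> carrier = {f. (\<forall>n. f n \<in> F n) \<and> finite {n. f n \<noteq> \<zero>\<^bsub>R\<^esub>}},
       monoid.mult = laurent_mult R,
       one = (\<lambda>n. if n = 0 then \<one>\<^bsub>R\<^esub> else \<zero>\<^bsub>R\<^esub>),
       zero = (\<lambda>n. \<zero>\<^bsub>R\<^esub>),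
       add = (\<lambda>f g n. f n \<oplus>\<^bsub>R\<^esub> g n),
       smult = laurent_mult R \<rparr>"

definition finite_module :: "('a, 'x) ring_scheme \<Rightarrow> ('a, 'b, 'y) module_scheme \<Rightarrow> bool" where
  "finite_module S M \<longleftrightarrow>
     (\<exists>A. finite A \<and> A \<subseteq> carrier M \<and>
        (\<forall>x\<in>carrier M. \<exists>c. (\<forall>a\<in>A. c a \<in> carrier S) \<and> x = (\<Oplus>\<^bsub>M\<^esub> a \<in> A. c a \<odot>\<^bsub>M\<^esub> a)))"

definition admissible_filtration ::
    "('a, 'x) ring_scheme \<Rightarrow> ('s::finite \<Rightarrow> 'a set) \<Rightarrow> (int ^ 's \<Rightarrow> 'a set) \<Rightarrow> bool" where
  "admissible_filtration R I F \<longleftrightarrow>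
     filtration R I F \<and>
     (\<forall>n. F n = F (pos_part n)) \<and>
     finite_module (rees R (ideal_power R I)) (rees R F)"


section \<open>Associated multigraded rings\<close>

text \<open>
  Elements of \<open>G(F) = \<Oplus>\<^sub>n\<^sub>\<ge>\<^sub>0 F(n)/F(n + e)\<close> are extensional functions on \<open>{0..}\<close> whose value at \<open>n\<close>
  is a coset of \<open>F (n + 1)\<close> in \<open>F n\<close>, almost all of them zero. As for \<^const>\<open>rees\<close>, the
  product serves both as the multiplication of the ring \<open>G(F)\<close> and as the action of \<open>G(E)\<close> on
  \<open>G(F)\<close>; it only refers to the ideals \<open>F (n + 1)\<close>, in which the resulting cosets are taken.
\<close>

definition assoc_graded_mult ::
    "('a, 'x) ring_scheme \<Rightarrow> (int ^ 's::finite \<Rightarrow> 'a set)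
      \<Rightarrow> (int ^ 's \<Rightarrow> 'a set) \<Rightarrow> (int ^ 's \<Rightarrow> 'a set) \<Rightarrow> int ^ 's \<Rightarrow> 'a set" where
  "assoc_graded_mult R F f g =
     (\<lambda>n\<in>{0..}. \<Oplus>\<^bsub>R Quot F (n + 1)\<^esub> k \<in> {0..n}. rcoset_mult R (F (n + 1)) (f k) (g (n - k)))"

definition assoc_graded ::
    "('a, 'x) ring_scheme \<Rightarrow> (int ^ 's::finite \<Rightarrow> 'a set)
      \<Rightarrow> (int ^ 's \<Rightarrow> 'a set, int ^ 's \<Rightarrow> 'a set) module" where
  "assoc_graded R F =
     \<lparr> carrier = {f \<in> (\<Pi>\<^sub>E n\<in>{0..}. (\<lambda>a. F (n + 1) +>\<^bsub>R\<^esub> a) ` F n).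
                    finite {n \<in> {0..}. f n \<noteq> F (n + 1)}},
       monoid.mult = assoc_graded_mult R F,
       one = (\<lambda>n\<in>{0..}. if n = 0 then F 1 +>\<^bsub>R\<^esub> \<one>\<^bsub>R\<^esub> else F (n + 1)),
       zero = (\<lambda>n\<in>{0..}. F (n + 1)),
       add = (\<lambda>f g. \<lambda>n\<in>{0..}. f n <+>\<^bsub>R\<^esub> g n),
       smult = assoc_graded_mult R F \<rparr>"

definition assoc_graded_comp ::
    "('a, 'x) ring_scheme \<Rightarrow> (int ^ 's::finite \<Rightarrow> 'a set) \<Rightarrow> int ^ 's \<Rightarrow> (int ^ 's \<Rightarrow> 'a set) set"
where
  "assoc_graded_comp R F n =
     {f \<in> carrier (assoc_graded R F). \<forall>k\<ge>0. k \<noteq> n \<longrightarrow> f k = F (k + 1)}"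


section \<open>Localisation at the powers of an element\<close>

text \<open>\<open>frac S M x m k\<close> is the fraction \<open>m / x\<^sup>k\<close> in \<open>M\<^sub>x\<close>, as an equivalence class of pairs.
  The operations on classes are unions over representatives. The ring multiplication and unit
  which the record type provides have no meaning for a module.\<close>

definition frac ::
    "('b, 'x) ring_scheme \<Rightarrow> ('b, 'c, 'y) module_scheme \<Rightarrow> 'b \<Rightarrow> 'c \<Rightarrow> nat \<Rightarrow> ('c \<times> nat) set" where
  "frac S M x m k =
     {(m', k'). m' \<in> carrier M \<and>
        (\<exists>l. (x [^]\<^bsub>S\<^esub> (l + k')) \<odot>\<^bsub>M\<^esub> m = (x [^]\<^bsub>S\<^esub> (l + k)) \<odot>\<^bsub>M\<^esub> m')}"

definition localise ::
    "('b, 'x) ring_scheme \<Rightarrow> ('b, 'c, 'y) module_scheme \<Rightarrow> 'b \<Rightarrow> ('b, ('c \<times> nat) set) module" where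
  "localise S M x =
     \<lparr> carrier = {frac S M x m k | m k. m \<in> carrier M},
       monoid.mult = undefined, one = undefined,
       zero = frac S M x \<zero>\<^bsub>M\<^esub> 0,
       add = (\<lambda>A B. \<Union>(m, k)\<in>A. \<Union>(m', k')\<in>B.
                frac S M x
                  ((x [^]\<^bsub>S\<^esub> k') \<odot>\<^bsub>M\<^esub> m \<oplus>\<^bsub>M\<^esub> (x [^]\<^bsub>S\<^esub> k) \<odot>\<^bsub>M\<^esub> m') (k + k')),
       smult = (\<lambda>r A. \<Union>(m, k)\<in>A. frac S M x (r \<odot>\<^bsub>M\<^esub> m) k) \<rparr>"

text \<open>Gradings are given by their families of homogeneous components; for homogeneous \<open>x\<close> of
  degree \<open>d\<close>, the fraction \<open>m / x\<^sup>k\<close> has degree \<open>deg m - k d\<close>.\<close>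

definition localise_comp ::
    "('b, 'x) ring_scheme \<Rightarrow> (int ^ 's::finite \<Rightarrow> 'b set)
      \<Rightarrow> ('b, 'c, 'y) module_scheme \<Rightarrow> (int ^ 's \<Rightarrow> 'c set) \<Rightarrow> 'b \<Rightarrow> int ^ 's
      \<Rightarrow> ('c \<times> nat) set set" where
  "localise_comp S gS M gM x n =
     {frac S M x m k | m k d. x \<in> gS d \<and> m \<in> gM (n + int k *s d)}"

text \<open>The canonical map \<open>M\<^sub>x \<rightarrow> M\<^sub>x\<^sub>y\<close>, \<open>m / x\<^sup>k \<mapsto> y\<^sup>k m / (x y)\<^sup>k\<close>.\<close>

definition localise_map ::
    "('b, 'x) ring_scheme \<Rightarrow> ('b, 'c, 'y) module_scheme \<Rightarrow> 'b \<Rightarrow> 'b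
      \<Rightarrow> ('c \<times> nat) set \<Rightarrow> ('c \<times> nat) set" where
  "localise_map S M x y A =
     (\<Union>(m, k)\<in>A. frac S M (x \<otimes>\<^bsub>S\<^esub> y) ((y [^]\<^bsub>S\<^esub> k) \<odot>\<^bsub>M\<^esub> m) k)"


section \<open>Local cohomology\<close>

text \<open>
  Local cohomology with support in a finitely generated ideal is the cohomology of the (extended)
  Cech complex
  \<open>0 \<rightarrow> M \<rightarrow> \<Oplus>\<^sub>i M\<^bsub>x\<^sub>i\<^esub> \<rightarrow> \<Oplus>\<^sub>i\<^sub><\<^sub>j M\<^bsub>x\<^sub>i x\<^sub>j\<^esub> \<rightarrow> \<dots> \<rightarrow> M\<^bsub>x\<^sub>1 \<dots> x\<^sub>r\<^esub> \<rightarrow> 0\<close>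
  on generators \<open>x\<^sub>1, \<dots>, x\<^sub>r\<close> of the ideal. Taking the generators homogeneous makes the complex,
  and hence its cohomology, graded. A cochain of degree \<open>i\<close> assigns to each
  \<open>i\<close>-element set \<open>\<sigma>\<close> of positions an element of the localisation of \<open>M\<close> at \<open>\<Prod>\<^bsub>j\<in>\<sigma>\<^esub> x\<^sub>j\<close>.
\<close>

definition cech_index :: "'b list \<Rightarrow> nat \<Rightarrow> nat set set" where
  "cech_index xs i = {\<sigma>. \<sigma> \<subseteq> {..<length xs} \<and> card \<sigma> = i}"

definition cech_elt :: "('b, 'x) ring_scheme \<Rightarrow> 'b list \<Rightarrow> nat set \<Rightarrow> 'b" where
  "cech_elt S xs \<sigma> = (\<Otimes>\<^bsub>S\<^esub> j \<in> \<sigma>. xs ! j)"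

definition cech_cochains ::
    "('b, 'x) ring_scheme \<Rightarrow> ('b, 'c, 'y) module_scheme \<Rightarrow> 'b list \<Rightarrow> nat
      \<Rightarrow> ('b, nat set \<Rightarrow> ('c \<times> nat) set) module" where
  "cech_cochains S M xs i =
     \<lparr> carrier = (\<Pi>\<^sub>E \<sigma>\<in>cech_index xs i. carrier (localise S M (cech_elt S xs \<sigma>))),
       monoid.mult = undefined, one = undefined,
       zero = (\<lambda>\<sigma>\<in>cech_index xs i. \<zero>\<^bsub>localise S M (cech_elt S xs \<sigma>)\<^esub>),
       add = (\<lambda>b c. \<lambda>\<sigma>\<in>cech_index xs i. b \<sigma> \<oplus>\<^bsub>localise S M (cech_elt S xs \<sigma>)\<^esub> c \<sigma>),
       smult = (\<lambda>r c. \<lambda>\<sigma>\<in>cech_index xs i. r \<odot>\<^bsub>localise S M (cech_elt S xs \<sigma>)\<^esub> c \<sigma>) \<rparr>"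

definition cech_cochains_comp ::
    "('b, 'x) ring_scheme \<Rightarrow> (int ^ 's::finite \<Rightarrow> 'b set)
      \<Rightarrow> ('b, 'c, 'y) module_scheme \<Rightarrow> (int ^ 's \<Rightarrow> 'c set) \<Rightarrow> 'b list \<Rightarrow> nat \<Rightarrow> int ^ 's
      \<Rightarrow> (nat set \<Rightarrow> ('c \<times> nat) set) set" where
  "cech_cochains_comp S gS M gM xs i n =
     (\<Pi>\<^sub>E \<sigma>\<in>cech_index xs i. localise_comp S gS M gM (cech_elt S xs \<sigma>) n)"

definition cech_diff ::
    "('b, 'x) ring_scheme \<Rightarrow> ('b, 'c, 'y) module_scheme \<Rightarrow> 'b list \<Rightarrow> nat
      \<Rightarrow> (nat set \<Rightarrow> ('c \<times> nat) set) \<Rightarrow> nat set \<Rightarrow> ('c \<times> nat) set" where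
  "cech_diff S M xs i c =
     (\<lambda>\<tau>\<in>cech_index xs (Suc i). \<Oplus>\<^bsub>localise S M (cech_elt S xs \<tau>)\<^esub> j \<in> \<tau>.
        let y = localise_map S M (cech_elt S xs (\<tau> - {j})) (xs ! j) (c (\<tau> - {j}))
        in if even (card {l \<in> \<tau>. l < j}) then y
           else \<ominus>\<^bsub>localise S M (cech_elt S xs \<tau>)\<^esub> y)"

definition cech_cocycles ::
    "('b, 'x) ring_scheme \<Rightarrow> ('b, 'c, 'y) module_scheme \<Rightarrow> 'b list \<Rightarrow> nat
      \<Rightarrow> (nat set \<Rightarrow> ('c \<times> nat) set) set" where
  "cech_cocycles S M xs i =
     {c \<in> carrier (cech_cochains S M xs i).
        cech_diff S M xs i c = \<zero>\<^bsub>cech_cochains S M xs (Suc i)\<^esub>}"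

definition cech_coboundaries ::
    "('b, 'x) ring_scheme \<Rightarrow> ('b, 'c, 'y) module_scheme \<Rightarrow> 'b list \<Rightarrow> nat
      \<Rightarrow> (nat set \<Rightarrow> ('c \<times> nat) set) set" where
  "cech_coboundaries S M xs i =
     (case i of 0 \<Rightarrow> {\<zero>\<^bsub>cech_cochains S M xs 0\<^esub>}
      | Suc j \<Rightarrow> cech_diff S M xs j ` carrier (cech_cochains S M xs j))"

definition cech_cohomology ::
    "('b, 'x) ring_scheme \<Rightarrow> ('b, 'c, 'y) module_scheme \<Rightarrow> 'b list \<Rightarrow> nat
      \<Rightarrow> ('b, (nat set \<Rightarrow> ('c \<times> nat) set) set) module" where
  "cech_cohomology S M xs i =
     (let C = cech_cochains S M xs i; B = cech_coboundaries S M xs i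
      in \<lparr> carrier = (\<lambda>z. B +>\<^bsub>C\<^esub> z) ` cech_cocycles S M xs i,
           monoid.mult = undefined, one = undefined,
           zero = B,
           add = set_add C,
           smult = (\<lambda>r A. \<Union>z\<in>A. B +>\<^bsub>C\<^esub> (r \<odot>\<^bsub>C\<^esub> z)) \<rparr>)"

definition cech_cohomology_comp ::
    "('b, 'x) ring_scheme \<Rightarrow> (int ^ 's::finite \<Rightarrow> 'b set)
      \<Rightarrow> ('b, 'c, 'y) module_scheme \<Rightarrow> (int ^ 's \<Rightarrow> 'c set) \<Rightarrow> 'b list \<Rightarrow> nat \<Rightarrow> int ^ 's
      \<Rightarrow> (nat set \<Rightarrow> ('c \<times> nat) set) set set" where
  "cech_cohomology_comp S gS M gM xs i n =
     (\<lambda>z. cech_coboundaries S M xs i +>\<^bsub>cech_cochains S M xs i\<^esub> z) `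
       (cech_cocycles S M xs i \<inter> cech_cochains_comp S gS M gM xs i n)"

text \<open>A choice of homogeneous generators; up to isomorphism of graded modules, the local
  cohomology does not depend on it.\<close>

definition hom_generators ::
    "('b, 'x) ring_scheme \<Rightarrow> (int ^ 's::finite \<Rightarrow> 'b set) \<Rightarrow> 'b set \<Rightarrow> 'b list" where
  "hom_generators S gS J = (SOME xs. set xs \<subseteq> (\<Union>n. gS n) \<and> Idl\<^bsub>S\<^esub> (set xs) = J)"

definition local_cohomology ::
    "('b, 'x) ring_scheme \<Rightarrow> (int ^ 's::finite \<Rightarrow> 'b set) \<Rightarrow> 'b set
      \<Rightarrow> ('b, 'c, 'y) module_scheme \<Rightarrow> nat \<Rightarrow> ('b, (nat set \<Rightarrow> ('c \<times> nat) set) set) module" where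
  "local_cohomology S gS J M i = cech_cohomology S M (hom_generators S gS J) i"

definition local_cohomology_comp ::
    "('b, 'x) ring_scheme \<Rightarrow> (int ^ 's::finite \<Rightarrow> 'b set) \<Rightarrow> 'b set
      \<Rightarrow> ('b, 'c, 'y) module_scheme \<Rightarrow> (int ^ 's \<Rightarrow> 'c set) \<Rightarrow> nat \<Rightarrow> int ^ 's
      \<Rightarrow> (nat set \<Rightarrow> ('c \<times> nat) set) set set" where
  "local_cohomology_comp S gS J M gM i n =
     cech_cohomology_comp S gS M gM (hom_generators S gS J) i n"


section \<open>Regularity\<close>

text \<open>The ideal \<open>S\<^sub>+\<^sub>+ = \<Oplus>\<^sub>n\<^sub>\<ge>\<^sub>e S\<^sub>n\<close>.\<close>

definition irrelevant_ideal ::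
    "('b, 'x) ring_scheme \<Rightarrow> (int ^ 's::finite \<Rightarrow> 'b set) \<Rightarrow> 'b set" where
  "irrelevant_ideal S gS =
     {\<Oplus>\<^bsub>S\<^esub> n \<in> A. f n | A f. finite A \<and> (\<forall>n\<in>A. 1 \<le> n \<and> f n \<in> gS n)}"

definition regular ::
    "('b, 'x) ring_scheme \<Rightarrow> (int ^ 's::finite \<Rightarrow> 'b set)
      \<Rightarrow> ('b, 'c, 'y) module_scheme \<Rightarrow> (int ^ 's \<Rightarrow> 'c set) \<Rightarrow> int ^ 's \<Rightarrow> bool" where
  "regular S gS M gM m \<longleftrightarrow>
     (let J = irrelevant_ideal S gS;
          H = local_cohomology S gS J M;
          H_comp = local_cohomology_comp S gS J M gM
      in \<forall>n\<ge>0.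
           (\<forall>j. H_comp 0 (n + m + axis j 1) = {\<zero>\<^bsub>H 0\<^esub>}) \<and>
           (\<forall>i\<ge>1. \<forall>p\<ge>0. (\<Sum>j\<in>UNIV. p $ j) = int i - 1 \<longrightarrow>
              H_comp i (n + m - p) = {\<zero>\<^bsub>H i\<^esub>}))"

definition reg ::
    "('b, 'x) ring_scheme \<Rightarrow> (int ^ 's::finite \<Rightarrow> 'b set)
      \<Rightarrow> ('b, 'c, 'y) module_scheme \<Rightarrow> (int ^ 's \<Rightarrow> 'c set) \<Rightarrow> (int ^ 's) set" where
  "reg S gS M gM = {m. regular S gS M gM m}"

end

theory Submission
  imports Defs
begin

text \<open>
  Let \<open>u\<close> be a multidegree in which \<open>M = G(F)\<close> is regular and suppose \<open>u\<^sub>j < 0\<close>. Let \<open>K\<close> be the Koszul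
  complex on generators of \<open>S\<close> in degree \<open>e\<^sub>j\<close> and consider its tensor product with the Cech complex
  of \<open>M\<close>. Off Cech degree \<open>0\<close> the Koszul direction is exact, because every generator of \<open>S\<^sub>+\<^sub>+\<close> lies in
  the ideal generated by \<open>S\<close> in degree \<open>e\<^sub>j\<close>; and regularity says precisely that in degree \<open>c - i e\<^sub>j\<close> the
  \<open>i\<close>-th Cech cohomology vanishes when \<open>c \<ge> u + e\<^sub>j\<close>. A diagram chase then shows that \<open>M\<close> vanishes in
  degree \<open>c\<close> if it does in degree \<open>c - e\<^sub>j\<close>. Since \<open>M\<close> vanishes whenever the \<open>j\<close>-th coordinate is
  negative, it vanishes in all degrees \<open>c \<ge> 0\<close> with \<open>c \<ge> u + e\<^sub>j\<close>, that is, \<open>F(c) = F(c + e) = F(c + 2e) = \<dots>\<close>.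
  As \<open>R'(F)\<close> is finite over \<open>R'(I)\<close>, this gives \<open>I\<^sup>c \<subseteq> I\<^sup>c\<^sup>+\<^sup>e \<subseteq> m I\<^sup>c\<close>, so \<open>I\<^sup>c = 0\<close> by Nakayama, and \<open>m\<close> is
  the only prime ideal of \<open>R\<close>, contradicting \<open>d \<ge> 1\<close>.
\<close>

section \<open>Additive maps and Koszul complexes\<close>

text \<open>Koszul degree l is placed in multidegree c - l e_j because the regularity conditions,
  read for i \<ge> 1 with p = (i - 1) e_j and n = c - e_j - u, concern the degree n + u - p = c - i
  e_j: the cohomology that has to vanish then sits on the diagonal i = l of the double complex, and
  the corner (0, 0) holds the component of degree c. Exactness in the Koszul direction comes from an
  explicit contraction: for a nonempty set \<sigma> of generators the product e_\<sigma> can be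
  written \<Sum> w_l y_l with the w_l of degree e_j, and the fractions y_l / e_\<sigma> contract.
  The empty product 1 has no such expression in general; in Cech degree 0 the vanishing in degree c
  - e_j takes the place of exactness. The condition c \<ge> u + e_j survives the descent from c to c
  - e_j as long as c_j > 0, because u_j + 1 \<le> 0; so the descent runs until the j-th coordinate
  is negative. Elements of G(F) are handled through finitely supported representatives in R, which
  reduces the ring and module laws to those of Laurent polynomials.\<close>

abbreviation add_hom :: "('a, 'x) ring_scheme \<Rightarrow> ('b, 'y) ring_scheme \<Rightarrow> ('a \<Rightarrow> 'b) set" where
  "add_hom G H \<equiv> hom (add_monoid G) (add_monoid H)"

lemma add_homI:
  assumes "\<And>a. a \<in> carrier G \<Longrightarrow> f a \<in> carrier H"
    and "\<And>a b. a \<in> carrier G \<Longrightarrow> b \<in> carrier G \<Longrightarrow> f (a \<oplus>\<^bsub>G\<^esub> b) = f a \<oplus>\<^bsub>H\<^esub> f b"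
  shows "f \<in> add_hom G H"
  using assms by (auto simp: hom_def)

lemma add_hom_closed: "f \<in> add_hom G H \<Longrightarrow> a \<in> carrier G \<Longrightarrow> f a \<in> carrier H"
  by (auto simp: hom_def)

lemma add_hom_add:
  "f \<in> add_hom G H \<Longrightarrow> a \<in> carrier G \<Longrightarrow> b \<in> carrier G \<Longrightarrow> f (a \<oplus>\<^bsub>G\<^esub> b) = f a \<oplus>\<^bsub>H\<^esub> f b"
  by (auto simp: hom_def)

lemma add_hom_comp: "f \<in> add_hom G H \<Longrightarrow> g \<in> add_hom H K \<Longrightarrow> (\<lambda>a. g (f a)) \<in> add_hom G K"
  by (auto simp: hom_def Pi_iff)

lemma add_hom_group_hom:
  assumes "abelian_group G" "abelian_group H" "f \<in> add_hom G H"
  shows "group_hom (add_monoid G) (add_monoid H) f"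
  using assms by (simp add: abelian_group.a_group group_hom.intro group_hom_axioms.intro)

lemma add_hom_zero:
  assumes "abelian_group G" "abelian_group H" "f \<in> add_hom G H"
  shows "f \<zero>\<^bsub>G\<^esub> = \<zero>\<^bsub>H\<^esub>"
  using group_hom.hom_one[OF add_hom_group_hom[OF assms]] by simp

lemma add_hom_a_inv:
  assumes "abelian_group G" "abelian_group H" "f \<in> add_hom G H" "a \<in> carrier G"
  shows "f (\<ominus>\<^bsub>G\<^esub> a) = \<ominus>\<^bsub>H\<^esub> f a"
  using group_hom.hom_inv[OF add_hom_group_hom[OF assms(1-3)]] assms(4) by (simp add: a_inv_def)

lemma add_hom_minus:
  assumes "abelian_group G" "abelian_group H" "f \<in> add_hom G H" "a \<in> carrier G" "b \<in> carrier G"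
  shows "f (a \<ominus>\<^bsub>G\<^esub> b) = f a \<ominus>\<^bsub>H\<^esub> f b"
  using assms by (simp add: a_minus_def add_hom_add add_hom_a_inv abelian_group.a_inv_closed)

lemma add_hom_finsum:
  assumes "abelian_group G" "abelian_group H" "f \<in> add_hom G H" "g \<in> A \<rightarrow> carrier G"
  shows "f (finsum G g A) = finsum H (\<lambda>i. f (g i)) A"
proof -
  interpret G: abelian_group G by fact
  interpret H: abelian_group H by fact
  note fz = add_hom_zero[OF assms(1-3)]
  show ?thesis using assms(4)
  proof (induct A rule: infinite_finite_induct)
    case (insert a A)
    then have "f (finsum G g (insert a A)) = f (g a) \<oplus>\<^bsub>H\<^esub> f (finsum G g A)"
      using add_hom_add[OF assms(3)] by simp
    also have "\<dots> = finsum H (\<lambda>i. f (g i)) (insert a A)"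
      using insert add_hom_closed[OF assms(3)] by (subst H.finsum_insert) (auto simp: Pi_iff)
    finally show ?case .
  qed (simp_all add: fz)
qed

text \<open>
  The Koszul complex of \<open>x # xs\<close> is the cone of \<open>x\<close> on that of \<open>xs\<close>. A chain is a family indexed by
  Boolean lists of the length of \<open>xs\<close>, the number of entries \<^const>\<open>True\<close> being the homological degree.
  The homotopy contracts the complex when \<open>\<Sum> x\<^sub>l y\<^sub>l = 1\<close>.
\<close>

fun koszul :: "('b, 'z) ring_scheme \<Rightarrow> ('b \<Rightarrow> 'b) list \<Rightarrow> (bool list \<Rightarrow> 'b) \<Rightarrow> bool list \<Rightarrow> 'b" where
  "koszul G (x # xs) v (False # L) =
     koszul G xs (\<lambda>L. v (False # L)) L \<oplus>\<^bsub>G\<^esub> x (v (True # L))"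
| "koszul G (x # xs) v (True # L) = \<ominus>\<^bsub>G\<^esub> koszul G xs (\<lambda>L. v (True # L)) L"
| "koszul G xs v L = \<zero>\<^bsub>G\<^esub>"

fun koszul_homotopy :: "('b, 'z) ring_scheme \<Rightarrow> ('b \<Rightarrow> 'b) list \<Rightarrow> (bool list \<Rightarrow> 'b) \<Rightarrow> bool list \<Rightarrow> 'b"
where
  "koszul_homotopy G (y # ys) v (False # L) = koszul_homotopy G ys (\<lambda>L. v (False # L)) L"
| "koszul_homotopy G (y # ys) v (True # L) =
     y (v (False # L)) \<ominus>\<^bsub>G\<^esub> koszul_homotopy G ys (\<lambda>L. v (True # L)) L"
| "koszul_homotopy G ys v L = \<zero>\<^bsub>G\<^esub>"

fun sum_comp :: "('b, 'z) ring_scheme \<Rightarrow> ('b \<Rightarrow> 'b) list \<Rightarrow> ('b \<Rightarrow> 'b) list \<Rightarrow> 'b \<Rightarrow> 'b" where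
  "sum_comp G (x # xs) (y # ys) a = x (y a) \<oplus>\<^bsub>G\<^esub> sum_comp G xs ys a"
| "sum_comp G xs ys a = \<zero>\<^bsub>G\<^esub>"

text \<open>One rule for \<open>koszul\<close> and \<open>koszul_homotopy\<close>: each step removes
  the head of the operator list together with the head of the index and restricts the chain to one
  face of the cube of Boolean lists.\<close>

lemma koszul_induct [case_names False True Nil1 Nil2]:
  fixes P :: "'f list \<Rightarrow> (bool list \<Rightarrow> 'b) \<Rightarrow> bool list \<Rightarrow> bool"
  assumes "\<And>x xs v L. P xs (\<lambda>L. v (False # L)) L \<Longrightarrow> P (x # xs) v (False # L)"
    and "\<And>x xs v L. P xs (\<lambda>L. v (True # L)) L \<Longrightarrow> P (x # xs) v (True # L)"
    and "\<And>v L. P [] v L"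
    and "\<And>x xs v. P (x # xs) v []"
  shows "P xs v L"
proof (induct xs arbitrary: v L)
  case (Cons x xs v L)
  note IH = this
  show ?case
  proof (cases L)
    case (Cons b L')
    then show ?thesis using assms(1,2) IH by (cases b) auto
  qed (use assms(4) in auto)
qed (fact assms(3))

context abelian_group
begin

lemma endo_closed: "f \<in> add_hom G G \<Longrightarrow> a \<in> carrier G \<Longrightarrow> f a \<in> carrier G"
  by (rule add_hom_closed)

lemma a_inv_zero: "\<ominus> \<zero> = \<zero>"
  using add.inv_one by (simp add: a_inv_def)

lemma endo_a_inv: "f \<in> add_hom G G \<Longrightarrow> a \<in> carrier G \<Longrightarrow> f (\<ominus> a) = \<ominus> f a"
  by (rule add_hom_a_inv[OF abelian_group_axioms abelian_group_axioms])

lemma a_inv_add_hom: "(\<lambda>a. \<ominus> a) \<in> add_hom G G"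
  by (rule add_homI) (auto simp: minus_add)

lemma koszul_closed:
  assumes "set xs \<subseteq> add_hom G G" "\<And>L. v L \<in> carrier G"
  shows "koszul G xs v L \<in> carrier G"
  using assms by (induct xs v L rule: koszul_induct) (auto simp: endo_closed)

lemma koszul_homotopy_closed:
  assumes "set xs \<subseteq> add_hom G G" "\<And>L. v L \<in> carrier G"
  shows "koszul_homotopy G xs v L \<in> carrier G"
  using assms
  by (induct xs v L rule: koszul_induct) (auto simp: endo_closed)

lemma sum_comp_closed:
  assumes "set xs \<subseteq> add_hom G G" "set ys \<subseteq> add_hom G G" "a \<in> carrier G"
  shows "sum_comp G xs ys a \<in> carrier G"
  using assms by (induct xs ys rule: list_induct2') (auto simp: endo_closed)

text \<open>The formulas use only sums, negatives and the operators, so an additive map intertwining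
  the two operator lists is a chain map. Two groups are allowed because f may be the Cech
  differential, which changes the cochain group.\<close>

lemma koszul_hom:
  assumes "abelian_group H" "f \<in> add_hom G H"
    and "list_all2 (\<lambda>x x'. \<forall>a\<in>carrier G. f (x a) = x' (f a)) xs xs'"
    and "set xs \<subseteq> add_hom G G" "\<And>L. v L \<in> carrier G"
  shows "koszul H xs' (\<lambda>L. f (v L)) L = f (koszul G xs v L)"
  using assms(3-5)
proof (induct xs v L arbitrary: xs' rule: koszul_induct)
  case (False x xs v L)
  then show ?case
    by (cases xs') (auto simp: add_hom_add[OF assms(2)] koszul_closed endo_closed)
next
  case (True x xs v L)
  then show ?case
    by (cases xs') (auto simp: add_hom_a_inv[OF abelian_group_axioms assms(1,2)] koszul_closed)
next
  case (Nil1 v L)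
  then show ?case by (simp add: add_hom_zero[OF abelian_group_axioms assms(1,2)])
next
  case (Nil2 x xs v)
  then show ?case by (cases xs') (simp_all add: add_hom_zero[OF abelian_group_axioms assms(1,2)])
qed

lemma koszul_a_inv:
  assumes "set xs \<subseteq> add_hom G G" "\<And>L. v L \<in> carrier G"
  shows "koszul G xs (\<lambda>L. \<ominus> v L) L = \<ominus> koszul G xs v L"
  by (rule koszul_hom[OF abelian_group_axioms a_inv_add_hom])
    (use assms in \<open>auto simp: list_all2_same intro!: endo_a_inv[symmetric]\<close>)

lemma koszul_homotopy_hom:
  assumes "f \<in> add_hom G G"
    and "\<And>x a. x \<in> set xs \<Longrightarrow> a \<in> carrier G \<Longrightarrow> f (x a) = x (f a)"
    and "set xs \<subseteq> add_hom G G" "\<And>L. v L \<in> carrier G"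
  shows "koszul_homotopy G xs (\<lambda>L. f (v L)) L = f (koszul_homotopy G xs v L)"
  using assms(2-4)
  by (induct xs v L rule: koszul_induct)
    (auto simp: add_hom_minus[OF abelian_group_axioms abelian_group_axioms assms(1)]
      koszul_homotopy_closed endo_closed
      add_hom_zero[OF abelian_group_axioms abelian_group_axioms assms(1)])

lemma minus_add_distrib:
  assumes "a \<in> carrier G" "b \<in> carrier G" "c \<in> carrier G" "d \<in> carrier G"
  shows "(a \<oplus> b) \<ominus> (c \<oplus> d) = (a \<ominus> c) \<oplus> (b \<ominus> d)"
  using assms by (simp add: minus_eq minus_add a_ac)

lemma koszul_minus:
  assumes "set xs \<subseteq> add_hom G G" "\<And>L. v L \<in> carrier G" "\<And>L. w L \<in> carrier G"
  shows "koszul G xs (\<lambda>L. v L \<ominus> w L) L = koszul G xs v L \<ominus> koszul G xs w L"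
  using assms
proof (induct xs v L arbitrary: w rule: koszul_induct)
  case (False x xs v L)
  have "x (v (True # L) \<ominus> w (True # L)) = x (v (True # L)) \<ominus> x (w (True # L))"
    by (rule add_hom_minus[OF abelian_group_axioms abelian_group_axioms]) (use False in auto)
  with False show ?case by (simp add: koszul_closed endo_closed minus_add_distrib)
next
  case (True x xs v L)
  then show ?case
    by (simp add: koszul_closed minus_eq minus_add)
qed (auto simp: minus_eq a_inv_zero)

lemma koszul_homotopy_add:
  assumes "set xs \<subseteq> add_hom G G" "\<And>L. v L \<in> carrier G" "\<And>L. w L \<in> carrier G"
  shows "koszul_homotopy G xs (\<lambda>L. v L \<oplus> w L) L = koszul_homotopy G xs v L \<oplus> koszul_homotopy G xs w L"
  using assms
proof (induct xs v L arbitrary: w rule: koszul_induct)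
  case (True x xs v L)
  have "x (v (False # L) \<oplus> w (False # L)) = x (v (False # L)) \<oplus> x (w (False # L))"
    by (rule add_hom_add) (use True in auto)
  with True show ?case by (simp add: koszul_homotopy_closed minus_add_distrib endo_closed)
qed auto

lemma koszul_add:
  assumes "set xs \<subseteq> add_hom G G" "\<And>L. v L \<in> carrier G" "\<And>L. w L \<in> carrier G"
  shows "koszul G xs (\<lambda>L. v L \<oplus> w L) L = koszul G xs v L \<oplus> koszul G xs w L"
proof -
  have "koszul G xs (\<lambda>L. v L \<oplus> w L) L = koszul G xs (\<lambda>L. v L \<ominus> \<ominus> w L) L"
    using assms by (simp add: minus_eq)
  also have "\<dots> = koszul G xs v L \<ominus> koszul G xs (\<lambda>L. \<ominus> w L) L"
    using assms by (intro koszul_minus) auto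
  finally show ?thesis
    using assms by (simp add: koszul_a_inv minus_eq koszul_closed)
qed

text \<open>In the cone of x the new term x d(vT) occurs twice, as the differential of x vT and as x
  applied to - d(vT); the sign in the \<open>True\<close> component makes the two cancel.\<close>

lemma koszul_koszul:
  assumes "set xs \<subseteq> add_hom G G" "\<And>L. v L \<in> carrier G"
    and "\<And>x y a. x \<in> set xs \<Longrightarrow> y \<in> set xs \<Longrightarrow> a \<in> carrier G \<Longrightarrow> x (y a) = y (x a)"
  shows "koszul G xs (koszul G xs v) L = \<zero>"
  using assms
proof (induct xs v L rule: koszul_induct)
  case (False x xs v L)
  have hx: "x \<in> add_hom G G" and hxs: "set xs \<subseteq> add_hom G G" using False by auto
  define vF where "vF = (\<lambda>L. v (False # L))"
  define vT where "vT = (\<lambda>L. v (True # L))"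
  have v: "\<And>L. vF L \<in> carrier G" "\<And>L. vT L \<in> carrier G" using False by (auto simp: vF_def vT_def)
  have c: "koszul G xs (\<lambda>L. x (vT L)) L = x (koszul G xs vT L)"
    by (rule koszul_hom[OF abelian_group_axioms hx]) (use False v in \<open>auto simp: list_all2_same\<close>)
  have "koszul G xs (\<lambda>L. koszul G xs vF L \<oplus> x (vT L)) L
      = koszul G xs (koszul G xs vF) L \<oplus> x (koszul G xs vT L)"
    unfolding c[symmetric] by (rule koszul_add[OF hxs]) (use v koszul_closed[OF hxs] endo_closed[OF hx] in auto)
  moreover have "koszul G xs (koszul G xs vF) L = \<zero>"
    using False v by (simp add: vF_def)
  ultimately show ?case
    using koszul_closed[OF hxs v(2)] endo_closed[OF hx] endo_a_inv[OF hx]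
    by (simp add: vF_def[symmetric] vT_def[symmetric]) (simp add: vF_def vT_def r_neg)
next
  case (True x xs v L)
  have "koszul G xs (\<lambda>L. \<ominus> koszul G xs (\<lambda>L. v (True # L)) L) L = \<ominus> koszul G xs (koszul G xs (\<lambda>L. v (True # L))) L"
    by (rule koszul_a_inv) (use True koszul_closed in auto)
  with True show ?case by (simp add: a_inv_zero)
qed auto

text \<open>Let d and h be the maps of the tails. On \<open>False\<close> the two copies of x h(vT)
  cancel by sign, on \<open>True\<close> the two copies of y d(vF); what remains is x y v plus the
  identity for the tails. For an index that is too short the recursion stops early and misses terms
  of \<open>sum_comp\<close>, hence the condition on the length.\<close>

lemma koszul_homotopy_koszul:
  assumes "length xs = length ys" "set xs \<subseteq> add_hom G G" "set ys \<subseteq> add_hom G G"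
    and "\<And>L. v L \<in> carrier G"
    and "\<And>x y a. x \<in> set xs \<Longrightarrow> y \<in> set ys \<Longrightarrow> a \<in> carrier G \<Longrightarrow> x (y a) = y (x a)"
    and "length L = length xs"
  shows "koszul G xs (koszul_homotopy G ys v) L \<oplus> koszul_homotopy G ys (koszul G xs v) L
       = sum_comp G xs ys (v L)"
  using assms
proof (induct xs ys arbitrary: L v rule: list_induct2)
  case Nil
  then show ?case by simp
next
  case (Cons x xs y ys)
  note AG = abelian_group_axioms
  have hx: "x \<in> add_hom G G" and hy: "y \<in> add_hom G G" and hxs: "set xs \<subseteq> add_hom G G"
    and hys: "set ys \<subseteq> add_hom G G" using Cons by auto
  obtain b L' where L: "L = b # L'" and len: "length L' = length xs" using Cons by (cases L) auto
  define vF where "vF = (\<lambda>L. v (False # L))"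
  define vT where "vT = (\<lambda>L. v (True # L))"
  have v: "\<And>L. vF L \<in> carrier G" "\<And>L. vT L \<in> carrier G" using Cons by (auto simp: vF_def vT_def)
  have IH: "koszul G xs (koszul_homotopy G ys w) L' \<oplus> koszul_homotopy G ys (koszul G xs w) L'
       = sum_comp G xs ys (w L')" if "\<And>L. w L \<in> carrier G" for w
  proof (rule Cons.hyps(2))
    fix x' y' a assume "x' \<in> set xs" "y' \<in> set ys" "a \<in> carrier G"
    then show "x' (y' a) = y' (x' a)" by (intro Cons.prems(4)) auto
  qed (use that len hxs hys in auto)
  have cxy: "x (y' a) = y' (x a)" if "y' \<in> set ys" "a \<in> carrier G" for y' a
    by (rule Cons.prems(4)) (use that in auto)
  have cyx: "y (x' a) = x' (y a)" if "x' \<in> set xs" "a \<in> carrier G" for x' a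
    by (rule Cons.prems(4)[symmetric]) (use that in auto)
  have cxy0: "x (y a) = y (x a)" if "a \<in> carrier G" for a
    by (rule Cons.prems(4)) (use that in auto)
  note cl = v koszul_closed[OF hxs] koszul_homotopy_closed[OF hys] endo_closed[OF hx]
    endo_closed[OF hy] sum_comp_closed[OF hxs hys]
  show ?case
  proof (cases b)
    case False
    have "koszul_homotopy G ys (\<lambda>L. koszul G xs vF L \<oplus> x (vT L)) L'
        = koszul_homotopy G ys (koszul G xs vF) L' \<oplus> koszul_homotopy G ys (\<lambda>L. x (vT L)) L'"
      by (rule koszul_homotopy_add[OF hys]) (auto simp: cl)
    also have "koszul_homotopy G ys (\<lambda>L. x (vT L)) L' = x (koszul_homotopy G ys vT L')"
      by (rule koszul_homotopy_hom[OF hx cxy hys v(2)])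
    finally have 1: "koszul_homotopy G ys (\<lambda>L. koszul G xs vF L \<oplus> x (vT L)) L'
      = koszul_homotopy G ys (koszul G xs vF) L' \<oplus> x (koszul_homotopy G ys vT L')" .
    have 2: "x (y (vF L') \<ominus> koszul_homotopy G ys vT L') = x (y (vF L')) \<ominus> x (koszul_homotopy G ys vT L')"
      by (rule add_hom_minus[OF AG AG hx]) (auto simp: cl)
    let ?a = "koszul G xs (koszul_homotopy G ys vF) L'" and ?b = "koszul_homotopy G ys (koszul G xs vF) L'"
    let ?c = "x (koszul_homotopy G ys vT L')" and ?d = "x (y (vF L'))"
    have "(?a \<oplus> (?d \<ominus> ?c)) \<oplus> (?b \<oplus> ?c) = ?d \<oplus> (?a \<oplus> ?b) \<oplus> (?c \<oplus> \<ominus> ?c)"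
      by (simp add: cl minus_eq a_ac)
    also have "\<dots> = ?d \<oplus> sum_comp G xs ys (vF L')"
      by (simp add: cl r_neg IH)
    finally have 4: "(?a \<oplus> (?d \<ominus> ?c)) \<oplus> (?b \<oplus> ?c) = ?d \<oplus> sum_comp G xs ys (vF L')" .
    have 5: "koszul G (x # xs) (koszul_homotopy G (y # ys) v) (False # L')
        = ?a \<oplus> x (y (vF L') \<ominus> koszul_homotopy G ys vT L')"
      by (simp add: vF_def vT_def)
    have 6: "koszul_homotopy G (y # ys) (koszul G (x # xs) v) (False # L')
        = koszul_homotopy G ys (\<lambda>L. koszul G xs vF L \<oplus> x (vT L)) L'"
      by (simp add: vF_def vT_def)
    have 7: "v L = vF L'" using False by (simp add: L vF_def)
    show ?thesis unfolding 7 using False 4 5 6 by (simp add: L 1 2)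
  next
    case True
    have "koszul G xs (\<lambda>L. y (vF L) \<ominus> koszul_homotopy G ys vT L) L'
      = koszul G xs (\<lambda>L. y (vF L)) L' \<ominus> koszul G xs (koszul_homotopy G ys vT) L'"
      by (rule koszul_minus[OF hxs]) (auto simp: cl)
    also have "koszul G xs (\<lambda>L. y (vF L)) L' = y (koszul G xs vF L')"
      by (rule koszul_hom[OF AG hy _ hxs v(1)]) (auto simp: list_all2_same intro!: cyx)
    finally have 1: "koszul G xs (\<lambda>L. y (vF L) \<ominus> koszul_homotopy G ys vT L) L'
      = y (koszul G xs vF L') \<ominus> koszul G xs (koszul_homotopy G ys vT) L'" .
    have 2: "koszul_homotopy G ys (\<lambda>L. \<ominus> koszul G xs vT L) L' = \<ominus> koszul_homotopy G ys (koszul G xs vT) L'"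
      by (rule koszul_homotopy_hom[OF a_inv_add_hom _ hys])
        (use hys in \<open>auto simp: cl intro!: endo_a_inv[symmetric]\<close>)
    have 3: "y (koszul G xs vF L' \<oplus> x (vT L')) = y (koszul G xs vF L') \<oplus> x (y (vT L'))"
      by (subst add_hom_add[OF hy]) (auto simp: cl intro!: cxy0[symmetric])
    let ?a = "koszul G xs (koszul_homotopy G ys vT) L'" and ?b = "koszul_homotopy G ys (koszul G xs vT) L'"
    let ?c = "y (koszul G xs vF L')" and ?d = "x (y (vT L'))"
    have "\<ominus> (?c \<ominus> ?a) \<oplus> ((?c \<oplus> ?d) \<ominus> \<ominus> ?b) = ?d \<oplus> (?a \<oplus> ?b) \<oplus> (?c \<oplus> \<ominus> ?c)"
      by (simp add: cl minus_eq minus_add a_ac)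
    also have "\<dots> = ?d \<oplus> sum_comp G xs ys (vT L')"
      by (simp add: cl r_neg IH)
    finally have 4: "\<ominus> (?c \<ominus> ?a) \<oplus> ((?c \<oplus> ?d) \<ominus> \<ominus> ?b) = ?d \<oplus> sum_comp G xs ys (vT L')" .
    have 5: "koszul G (x # xs) (koszul_homotopy G (y # ys) v) (True # L')
        = \<ominus> koszul G xs (\<lambda>L. y (vF L) \<ominus> koszul_homotopy G ys vT L) L'"
      by (simp add: vF_def vT_def)
    have 6: "koszul_homotopy G (y # ys) (koszul G (x # xs) v) (True # L')
        = y (koszul G xs vF L' \<oplus> x (vT L')) \<ominus> koszul_homotopy G ys (\<lambda>L. \<ominus> koszul G xs vT L) L'"
      by (simp add: vF_def vT_def)
    have 7: "v L = vT L'" using True by (simp add: L vT_def)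
    show ?thesis unfolding 7 using True 4 5 6 by (simp add: L 1 2 3)
  qed
qed

text \<open>Chains are functions on all Boolean lists; the actual complex consists of those that
  vanish off the lists of the right length, a condition preserved by the boundary and by the
  homotopy.\<close>

lemma koszul_length:
  assumes "length L \<noteq> length xs" "set xs \<subseteq> add_hom G G" "\<And>L. length L \<noteq> length xs \<Longrightarrow> v L = \<zero>"
  shows "koszul G xs v L = \<zero>"
  using assms
  by (induct xs v L rule: koszul_induct)
    (auto simp: add_hom_zero[OF abelian_group_axioms abelian_group_axioms])

lemma koszul_homotopy_length:
  assumes "length L \<noteq> length xs" "set xs \<subseteq> add_hom G G" "\<And>L. length L \<noteq> length xs \<Longrightarrow> v L = \<zero>"
  shows "koszul_homotopy G xs v L = \<zero>"
  using assms
  by (induct xs v L rule: koszul_induct)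
    (auto simp: add_hom_zero[OF abelian_group_axioms abelian_group_axioms] minus_eq)

end

text \<open>\<open>T i l\<close> has Cech degree \<open>i\<close> and Koszul degree \<open>l\<close>. The lifting step \<open>main\<close> goes by downward
  induction on \<open>i\<close>.\<close>

lemma double_complex_chase:
  fixes T :: "nat \<Rightarrow> nat \<Rightarrow> 'b set"
  assumes d: "\<And>i l v. v \<in> T i l \<Longrightarrow> d i v \<in> T (Suc i) l"
    and b: "\<And>i l v. v \<in> T i (Suc l) \<Longrightarrow> b i v \<in> T i l"
    and sub: "\<And>i l v w. v \<in> T i l \<Longrightarrow> w \<in> T i l \<Longrightarrow> sub i v w \<in> T i l"
    and sub_self: "\<And>i l v. v \<in> T i l \<Longrightarrow> sub i v v = z i"
    and sub_zero: "\<And>i l v. v \<in> T i l \<Longrightarrow> sub i v (z i) = v"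
    and d_sub: "\<And>i l v w. v \<in> T i l \<Longrightarrow> w \<in> T i l \<Longrightarrow> d i (sub i v w) = sub (Suc i) (d i v) (d i w)"
    and b_sub: "\<And>i l v w. v \<in> T i l \<Longrightarrow> w \<in> T i l \<Longrightarrow> b i (sub i v w) = sub i (b i v) (b i w)"
    and dd: "\<And>i l v. v \<in> T i l \<Longrightarrow> d (Suc i) (d i v) = z (Suc (Suc i))"
    and bb: "\<And>i l v. v \<in> T i l \<Longrightarrow> b i (b i v) = z i"
    and db: "\<And>i l v. v \<in> T i l \<Longrightarrow> d i (b i v) = b (Suc i) (d i v)"
    and b_bot: "\<And>i v. v \<in> T i 0 \<Longrightarrow> b i v = z i"
    and b_zero: "\<And>i. b i (z i) = z i"
    and row: "\<And>i l v. 1 \<le> i \<Longrightarrow> v \<in> T i l \<Longrightarrow> b i v = z i \<Longrightarrow> \<exists>w\<in>T i (Suc l). b i w = v"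
    and col: "\<And>i v. v \<in> T (Suc i) (Suc i) \<Longrightarrow> d (Suc i) v = z (Suc (Suc i))
        \<Longrightarrow> \<exists>w\<in>T i (Suc i). d i w = v"
    and col0: "\<And>v. v \<in> T 0 0 \<Longrightarrow> d 0 v = z 1 \<Longrightarrow> v = z 0"
    and start: "T 0 1 = {z 0}"
    and bound: "\<And>i l. N < i \<Longrightarrow> T i l = {z i}"
    and u: "u \<in> T 0 0"
  shows "u = z 0"
proof -
  have main: "\<exists>w \<in> T (Suc i) (Suc i). b (Suc i) w = v \<and> d (Suc i) w = z (Suc (Suc i))"
    if "v \<in> T (Suc i) i" "d (Suc i) v = z (Suc (Suc i))" "b (Suc i) v = z (Suc i)" for i v
    using that
  proof (induct "Suc N - i" arbitrary: i v)
    \<comment> \<open>By truncated subtraction i > N here, so all groups involved are zero and the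
      zero element is a lift.\<close>
    case 0
    then have "N < Suc i" "N < Suc (Suc i)" by auto
    with bound have "T (Suc i) (Suc i) = {z (Suc i)}" "T (Suc i) i = {z (Suc i)}"
      "T (Suc (Suc i)) (Suc i) = {z (Suc (Suc i))}" by auto
    with 0 show ?case using d[of "z (Suc i)" "Suc i" "Suc i"] by auto
  next
    case (Suc n)
    obtain w where w: "w \<in> T (Suc i) (Suc i)" "b (Suc i) w = v" using row Suc by force
    have dw: "d (Suc i) w \<in> T (Suc (Suc i)) (Suc i)" using d w by auto
    \<comment> \<open>The lift w need not be a d-cocycle. Its defect d w is killed by d and by b one
      Cech degree higher, so the induction hypothesis lifts it.\<close>
    have "\<exists>w' \<in> T (Suc (Suc i)) (Suc (Suc i)). b (Suc (Suc i)) w' = d (Suc i) w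
        \<and> d (Suc (Suc i)) w' = z (Suc (Suc (Suc i)))"
    proof (rule Suc.hyps(1))
      show "n = Suc N - Suc i" using Suc by auto
      show "d (Suc (Suc i)) (d (Suc i) w) = z (Suc (Suc (Suc i)))" using dd w by auto
      show "b (Suc (Suc i)) (d (Suc i) w) = z (Suc (Suc i))" using db[OF w(1)] w Suc by simp
    qed (fact dw)
    then obtain w' where w': "w' \<in> T (Suc (Suc i)) (Suc (Suc i))"
      "b (Suc (Suc i)) w' = d (Suc i) w" "d (Suc (Suc i)) w' = z (Suc (Suc (Suc i)))" by blast
    obtain y where y: "y \<in> T (Suc i) (Suc (Suc i))" "d (Suc i) y = w'" using col w' by blast
    have bdy: "b (Suc i) y \<in> T (Suc i) (Suc i)" using b y by auto
    \<comment> \<open>Subtracting b y leaves b w unchanged, as b b = 0, and removes the defect, as d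
      b y = b d y = b w' = d w.\<close>
    let ?w = "sub (Suc i) w (b (Suc i) y)"
    have "b (Suc i) ?w = v"
      using b_sub[OF w(1) bdy] bb[OF y(1)] w sub_zero[OF Suc.prems(1)] by simp
    moreover have "d (Suc i) ?w = z (Suc (Suc i))"
      using d_sub[OF w(1) bdy] db[OF y(1)] y w' sub_self[OF dw] by simp
    ultimately show ?case using sub[OF w(1) bdy] by blast
  qed
  have du: "d 0 u \<in> T (Suc 0) 0" using d u by auto
  have "b (Suc 0) (d 0 u) = z (Suc 0)" using b_bot du by auto
  with main[OF du] dd[OF u] obtain w where w: "w \<in> T (Suc 0) (Suc 0)" "b (Suc 0) w = d 0 u"
    "d (Suc 0) w = z (Suc (Suc 0))" by auto
  \<comment> \<open>The lift w of d u is d y with y in the zero group \<open>T 0 1\<close>; hence d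
    u vanishes, and u with it.\<close>
  obtain y where y: "y \<in> T 0 (Suc 0)" "d 0 y = w" using col w by blast
  then have "y = z 0" using start by auto
  then have "d 0 u = d 0 (b 0 (z 0))" using w y db[OF y(1)] by auto
  then have 1: "d 0 u = d 0 (z 0)" using b_zero by simp
  have "z 0 \<in> T 0 0" using sub[OF u u] sub_self[OF u] by simp
  have "d 0 (z 0) = z 1"
  proof -
    have "d 0 (sub 0 u u) = sub (Suc 0) (d 0 u) (d 0 u)" using d_sub u by blast
    then show ?thesis using sub_self[OF u] sub_self[OF du] by simp
  qed
  with 1 show ?thesis using col0 u by auto
qed

section \<open>Localisation\<close>

text \<open>The map \<open>m / x\<^sup>k \<mapsto> \<phi>\<^sub>k m / x'\<^sup>k\<^sup>+\<^sup>e\<close>, which is well defined under \<open>loc_compat\<close>; it subsumes the canonical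
  maps, multiplication by \<open>y / x\<^sup>e\<close> and the projections onto homogeneous components.\<close>

definition loc_map ::
    "('b, 'x) ring_scheme \<Rightarrow> ('b, 'c, 'y) module_scheme \<Rightarrow> 'b \<Rightarrow> (nat \<Rightarrow> 'c \<Rightarrow> 'c) \<Rightarrow> nat
      \<Rightarrow> ('c \<times> nat) set \<Rightarrow> ('c \<times> nat) set" where
  "loc_map S M x' \<phi> e A = (\<Union>(m, k)\<in>A. frac S M x' (\<phi> k m) (k + e))"

definition loc_compat ::
    "('b, 'x) ring_scheme \<Rightarrow> ('b, 'c, 'y) module_scheme \<Rightarrow> 'b \<Rightarrow> 'b \<Rightarrow> (nat \<Rightarrow> 'c \<Rightarrow> 'c) \<Rightarrow> bool" where
  "loc_compat S M x x' \<phi> \<longleftrightarrow> (\<forall>k. \<phi> k \<in> add_hom M M) \<and>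
     (\<forall>k n. \<forall>m\<in>carrier M.
        \<phi> (k + n) ((x [^]\<^bsub>S\<^esub> n) \<odot>\<^bsub>M\<^esub> m) = (x' [^]\<^bsub>S\<^esub> n) \<odot>\<^bsub>M\<^esub> \<phi> k m)"

text \<open>The operations on fraction classes are unions over representatives; this evaluates such
  a union once all its terms are known to agree.\<close>

lemma UN_const_on:
  assumes "a \<in> A" "\<And>b. b \<in> A \<Longrightarrow> f b = c"
  shows "(\<Union>b\<in>A. f b) = c"
  using assms by auto

context module
begin

lemma pow_smult_pow:
  assumes "x \<in> carrier R" "m \<in> carrier M"
  shows "(x [^] (a::nat)) \<odot>\<^bsub>M\<^esub> ((x [^] (b::nat)) \<odot>\<^bsub>M\<^esub> m) = (x [^] (a + b)) \<odot>\<^bsub>M\<^esub> m"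
  using assms by (simp add: smult_assoc1[symmetric] R.nat_pow_mult)

lemma frac_self: "m \<in> carrier M \<Longrightarrow> (m, k) \<in> frac R M x m k"
  by (auto simp: frac_def)

text \<open>The content is transitivity of the relation on pairs: two witnesses are combined by
  multiplying each relation by the powers that occur in the other.\<close>

lemma frac_eq_iff:
  assumes x: "x \<in> carrier R" and m: "m \<in> carrier M" "m' \<in> carrier M"
  shows "frac R M x m k = frac R M x m' k' \<longleftrightarrow>
    (\<exists>l. (x [^] (l + k')) \<odot>\<^bsub>M\<^esub> m = (x [^] (l + k)) \<odot>\<^bsub>M\<^esub> m')"
proof
  assume "frac R M x m k = frac R M x m' k'"
  with frac_self[OF m(2)] have "(m', k') \<in> frac R M x m k" by auto
  then show "\<exists>l. (x [^] (l + k')) \<odot>\<^bsub>M\<^esub> m = (x [^] (l + k)) \<odot>\<^bsub>M\<^esub> m'"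
    by (auto simp: frac_def)
next
  have sub: "frac R M x m' k' \<subseteq> frac R M x m k"
    if m: "m \<in> carrier M" "m' \<in> carrier M"
      and l: "(x [^] (l + k')) \<odot>\<^bsub>M\<^esub> m = (x [^] (l + k)) \<odot>\<^bsub>M\<^esub> m'" for m m' k k' and l :: nat
  proof (clarsimp simp: frac_def)
    fix a b l' assume a: "a \<in> carrier M" and l': "(x [^] (l' + b)) \<odot>\<^bsub>M\<^esub> m' = (x [^] (l' + k')) \<odot>\<^bsub>M\<^esub> a"
    have "(x [^] (l + l' + k' + b)) \<odot>\<^bsub>M\<^esub> m = (x [^] (l' + b)) \<odot>\<^bsub>M\<^esub> ((x [^] (l + k')) \<odot>\<^bsub>M\<^esub> m)"
      using x m by (simp add: pow_smult_pow ac_simps)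
    also have "\<dots> = (x [^] (l + k)) \<odot>\<^bsub>M\<^esub> ((x [^] (l' + b)) \<odot>\<^bsub>M\<^esub> m')"
      unfolding l using x m by (simp add: pow_smult_pow ac_simps)
    also have "\<dots> = (x [^] (l + l' + k' + k)) \<odot>\<^bsub>M\<^esub> a"
      unfolding l' using x a by (simp add: pow_smult_pow ac_simps)
    finally show "\<exists>l. (x [^] (l + b)) \<odot>\<^bsub>M\<^esub> m = (x [^] (l + k)) \<odot>\<^bsub>M\<^esub> a" by blast
  qed
  assume "\<exists>l. (x [^] (l + k')) \<odot>\<^bsub>M\<^esub> m = (x [^] (l + k)) \<odot>\<^bsub>M\<^esub> m'"
  then obtain l where l: "(x [^] (l + k')) \<odot>\<^bsub>M\<^esub> m = (x [^] (l + k)) \<odot>\<^bsub>M\<^esub> m'" by blast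
  show "frac R M x m k = frac R M x m' k'"
    using sub[OF m l] sub[OF m(2,1) l[symmetric]] by blast
qed

lemma frac_scale:
  assumes "x \<in> carrier R" "m \<in> carrier M"
  shows "frac R M x ((x [^] n) \<odot>\<^bsub>M\<^esub> m) (k + n) = frac R M x m k"
  using assms by (subst frac_eq_iff) (auto simp: pow_smult_pow ac_simps intro!: exI[of _ 0])

lemma localise_carrier:
  "carrier (localise R M x) = {frac R M x m k | m k. m \<in> carrier M}"
  by (simp add: localise_def)

lemma localise_zero: "\<zero>\<^bsub>localise R M x\<^esub> = frac R M x \<zero>\<^bsub>M\<^esub> 0"
  by (simp add: localise_def)

lemma frac_zero: "x \<in> carrier R \<Longrightarrow> frac R M x \<zero>\<^bsub>M\<^esub> k = frac R M x \<zero>\<^bsub>M\<^esub> 0"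
  by (subst frac_eq_iff) auto

text \<open>The sum does not depend on the representatives: if l1 and l2 witness the two
  equivalences, then l1 + l2 witnesses the equivalence of the sums.\<close>

lemma localise_add:
  assumes x: "x \<in> carrier R" and m: "m \<in> carrier M" "m' \<in> carrier M"
  shows "frac R M x m k \<oplus>\<^bsub>localise R M x\<^esub> frac R M x m' k' =
    frac R M x ((x [^] k') \<odot>\<^bsub>M\<^esub> m \<oplus>\<^bsub>M\<^esub> (x [^] k) \<odot>\<^bsub>M\<^esub> m') (k + k')"
proof -
  have eq: "frac R M x ((x [^] j) \<odot>\<^bsub>M\<^esub> a \<oplus>\<^bsub>M\<^esub> (x [^] i) \<odot>\<^bsub>M\<^esub> b) (i + j)
    = frac R M x ((x [^] k') \<odot>\<^bsub>M\<^esub> m \<oplus>\<^bsub>M\<^esub> (x [^] k) \<odot>\<^bsub>M\<^esub> m') (k + k')"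
    if "(a, i) \<in> frac R M x m k" "(b, j) \<in> frac R M x m' k'" for a b i j
  proof -
    from that obtain l1 l2 where l1: "(x [^] (l1 + i)) \<odot>\<^bsub>M\<^esub> m = (x [^] (l1 + k)) \<odot>\<^bsub>M\<^esub> a"
      and l2: "(x [^] (l2 + j)) \<odot>\<^bsub>M\<^esub> m' = (x [^] (l2 + k')) \<odot>\<^bsub>M\<^esub> b"
      and ab: "a \<in> carrier M" "b \<in> carrier M" by (auto simp: frac_def)
    have 1: "(x [^] (l1 + l2 + (i + j) + k')) \<odot>\<^bsub>M\<^esub> m = (x [^] (l1 + l2 + (k + k') + j)) \<odot>\<^bsub>M\<^esub> a"
    proof -
      have "(x [^] (l1 + l2 + (i + j) + k')) \<odot>\<^bsub>M\<^esub> m = (x [^] (l2 + j + k')) \<odot>\<^bsub>M\<^esub> ((x [^] (l1 + i)) \<odot>\<^bsub>M\<^esub> m)"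
        using x m by (simp add: pow_smult_pow ac_simps)
      also have "\<dots> = (x [^] (l1 + l2 + (k + k') + j)) \<odot>\<^bsub>M\<^esub> a"
        unfolding l1 using x ab by (simp add: pow_smult_pow ac_simps)
      finally show ?thesis .
    qed
    have 2: "(x [^] (l1 + l2 + (i + j) + k)) \<odot>\<^bsub>M\<^esub> m' = (x [^] (l1 + l2 + (k + k') + i)) \<odot>\<^bsub>M\<^esub> b"
    proof -
      have "(x [^] (l1 + l2 + (i + j) + k)) \<odot>\<^bsub>M\<^esub> m' = (x [^] (l1 + i + k)) \<odot>\<^bsub>M\<^esub> ((x [^] (l2 + j)) \<odot>\<^bsub>M\<^esub> m')"
        using x m by (simp add: pow_smult_pow ac_simps)
      also have "\<dots> = (x [^] (l1 + l2 + (k + k') + i)) \<odot>\<^bsub>M\<^esub> b"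
        unfolding l2 using x ab by (simp add: pow_smult_pow ac_simps)
      finally show ?thesis .
    qed
    show ?thesis
    proof (subst frac_eq_iff[OF x], goal_cases)
      case 3
      have "(x [^] (l1 + l2 + (k + k'))) \<odot>\<^bsub>M\<^esub> ((x [^] j) \<odot>\<^bsub>M\<^esub> a \<oplus>\<^bsub>M\<^esub> (x [^] i) \<odot>\<^bsub>M\<^esub> b)
        = (x [^] (l1 + l2 + (k + k') + j)) \<odot>\<^bsub>M\<^esub> a \<oplus>\<^bsub>M\<^esub> (x [^] (l1 + l2 + (k + k') + i)) \<odot>\<^bsub>M\<^esub> b"
        using x ab by (simp add: smult_r_distr pow_smult_pow)
      also have "\<dots> = (x [^] (l1 + l2 + (i + j))) \<odot>\<^bsub>M\<^esub> ((x [^] k') \<odot>\<^bsub>M\<^esub> m \<oplus>\<^bsub>M\<^esub> (x [^] k) \<odot>\<^bsub>M\<^esub> m')"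
        unfolding 1[symmetric] 2[symmetric] using x m by (simp add: smult_r_distr pow_smult_pow)
      finally show ?case by blast
    qed (use x m ab in auto)
  qed
  have "frac R M x m k \<oplus>\<^bsub>localise R M x\<^esub> frac R M x m' k'
    = (\<Union>p\<in>frac R M x m k. \<Union>q\<in>frac R M x m' k'.
        frac R M x ((x [^] snd q) \<odot>\<^bsub>M\<^esub> fst p \<oplus>\<^bsub>M\<^esub> (x [^] snd p) \<odot>\<^bsub>M\<^esub> fst q) (snd p + snd q))"
    by (simp add: localise_def case_prod_unfold)
  also have "\<dots> = frac R M x ((x [^] k') \<odot>\<^bsub>M\<^esub> m \<oplus>\<^bsub>M\<^esub> (x [^] k) \<odot>\<^bsub>M\<^esub> m') (k + k')"
  proof (rule UN_const_on[OF frac_self[OF m(1), of k x]], rule UN_const_on[OF frac_self[OF m(2), of k' x]])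
    fix p q assume "p \<in> frac R M x m k" "q \<in> frac R M x m' k'"
    then show "frac R M x ((x [^] snd q) \<odot>\<^bsub>M\<^esub> fst p \<oplus>\<^bsub>M\<^esub> (x [^] snd p) \<odot>\<^bsub>M\<^esub> fst q) (snd p + snd q)
      = frac R M x ((x [^] k') \<odot>\<^bsub>M\<^esub> m \<oplus>\<^bsub>M\<^esub> (x [^] k) \<odot>\<^bsub>M\<^esub> m') (k + k')"
      by (cases p, cases q) (use eq in auto)
  qed
  finally show ?thesis .
qed

lemma localise_cases:
  assumes "A \<in> carrier (localise R M x)"
  obtains m k where "A = frac R M x m k" "m \<in> carrier M"
  using assms by (auto simp: localise_carrier)

lemma frac_closed: "m \<in> carrier M \<Longrightarrow> frac R M x m k \<in> carrier (localise R M x)"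
  by (auto simp: localise_carrier)

lemma localise_abelian_group:
  assumes x: "x \<in> carrier R"
  shows "abelian_group (localise R M x)"
proof (rule abelian_groupI)
  let ?L = "localise R M x"
  fix a b assume "a \<in> carrier ?L" "b \<in> carrier ?L"
  then obtain m1 k1 m2 k2 where
    a: "a = frac R M x m1 k1" "m1 \<in> carrier M" and
    b: "b = frac R M x m2 k2" "m2 \<in> carrier M" by (elim localise_cases)
  show "a \<oplus>\<^bsub>?L\<^esub> b \<in> carrier ?L"
    unfolding a(1) b(1) localise_add[OF x a(2) b(2)] by (rule frac_closed) (use a b x in auto)
  show "a \<oplus>\<^bsub>?L\<^esub> b = b \<oplus>\<^bsub>?L\<^esub> a"
    unfolding a(1) b(1) localise_add[OF x a(2) b(2)] localise_add[OF x b(2) a(2)]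
    using a b x by (simp add: M.a_comm add.commute)
next
  let ?L = "localise R M x"
  fix a b c assume "a \<in> carrier ?L" "b \<in> carrier ?L" "c \<in> carrier ?L"
  then obtain m1 k1 m2 k2 m3 k3 where
    a: "a = frac R M x m1 k1" "m1 \<in> carrier M" and
    b: "b = frac R M x m2 k2" "m2 \<in> carrier M" and
    c: "c = frac R M x m3 k3" "m3 \<in> carrier M" by (elim localise_cases)
  show "a \<oplus>\<^bsub>?L\<^esub> b \<oplus>\<^bsub>?L\<^esub> c = a \<oplus>\<^bsub>?L\<^esub> (b \<oplus>\<^bsub>?L\<^esub> c)"
    unfolding a(1) b(1) c(1)
    using a(2) b(2) c(2) x
    by (simp add: localise_add smult_r_distr pow_smult_pow M.a_assoc add.commute add.left_commute)
next
  let ?L = "localise R M x"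
  show "\<zero>\<^bsub>?L\<^esub> \<in> carrier ?L" unfolding localise_zero by (rule frac_closed) auto
  fix a assume "a \<in> carrier ?L"
  then obtain m k where a: "a = frac R M x m k" "m \<in> carrier M" by (elim localise_cases)
  show "\<zero>\<^bsub>?L\<^esub> \<oplus>\<^bsub>?L\<^esub> a = a" using a x by (simp add: localise_zero localise_add)
  have "frac R M x (\<ominus>\<^bsub>M\<^esub> m) k \<oplus>\<^bsub>?L\<^esub> a = \<zero>\<^bsub>?L\<^esub>"
    unfolding a(1) localise_zero using a x
    by (simp add: localise_add smult_r_minus M.l_neg frac_zero[of x "k + k"])
  moreover have "frac R M x (\<ominus>\<^bsub>M\<^esub> m) k \<in> carrier ?L" using a by (intro frac_closed) auto
  ultimately show "\<exists>b\<in>carrier ?L. b \<oplus>\<^bsub>?L\<^esub> a = \<zero>\<^bsub>?L\<^esub>" by blast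
qed

text \<open>The index of \<phi> records the exponent of the denominator, and
  \<open>loc_compat\<close> lets it grow along with the numerator. Two representatives are therefore
  compared at the common index k + l + k', where their scaled numerators coincide.\<close>

lemma loc_map_frac:
  assumes x: "x \<in> carrier R" "x' \<in> carrier R" and c: "loc_compat R M x x' \<phi>" and m: "m \<in> carrier M"
  shows "loc_map R M x' \<phi> e (frac R M x m k) = frac R M x' (\<phi> k m) (k + e)"
proof -
  have \<phi>: "\<phi> k m \<in> carrier M" if "m \<in> carrier M" for k m
    using c that by (auto simp: loc_compat_def intro: add_hom_closed)
  have eq: "frac R M x' (\<phi> k' m') (k' + e) = frac R M x' (\<phi> k m) (k + e)"
    if mem: "(m', k') \<in> frac R M x m k" for m' k'
  proof -
    from mem obtain l where m': "m' \<in> carrier M"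
      and l: "(x [^] (l + k')) \<odot>\<^bsub>M\<^esub> m = (x [^] (l + k)) \<odot>\<^bsub>M\<^esub> m'" by (auto simp: frac_def)
    have "(x' [^] (l + k')) \<odot>\<^bsub>M\<^esub> \<phi> k m = \<phi> (k + (l + k')) ((x [^] (l + k')) \<odot>\<^bsub>M\<^esub> m)"
      using c m by (simp add: loc_compat_def)
    also have "\<dots> = \<phi> (k' + (l + k)) ((x [^] (l + k)) \<odot>\<^bsub>M\<^esub> m')"
      unfolding l by (simp add: add.commute add.left_commute)
    also have "\<dots> = (x' [^] (l + k)) \<odot>\<^bsub>M\<^esub> \<phi> k' m'"
      using c m' by (simp add: loc_compat_def)
    finally have *: "(x' [^] (l + k')) \<odot>\<^bsub>M\<^esub> \<phi> k m = (x' [^] (l + k)) \<odot>\<^bsub>M\<^esub> \<phi> k' m'" .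
    have "(x' [^] (l + (k + e))) \<odot>\<^bsub>M\<^esub> \<phi> k' m' = (x' [^] e) \<odot>\<^bsub>M\<^esub> ((x' [^] (l + k)) \<odot>\<^bsub>M\<^esub> \<phi> k' m')"
      using x \<phi> m' by (simp add: pow_smult_pow ac_simps)
    also have "\<dots> = (x' [^] (l + (k' + e))) \<odot>\<^bsub>M\<^esub> \<phi> k m"
      unfolding *[symmetric] using x \<phi> m by (simp add: pow_smult_pow ac_simps)
    finally show ?thesis
      using x \<phi> m m' by (subst frac_eq_iff) auto
  qed
  show ?thesis unfolding loc_map_def
    by (rule UN_const_on[OF frac_self[OF m, of k x]]) (use eq in auto)
qed

lemma loc_map_closed:
  assumes x: "x \<in> carrier R" "x' \<in> carrier R" and c: "loc_compat R M x x' \<phi>"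
    and "A \<in> carrier (localise R M x)"
  shows "loc_map R M x' \<phi> e A \<in> carrier (localise R M x')"
proof -
  obtain m k where A: "A = frac R M x m k" and m: "m \<in> carrier M"
    using assms by (auto simp: localise_carrier)
  have "\<phi> k m \<in> carrier M" using c m by (auto simp: loc_compat_def intro: add_hom_closed)
  then show ?thesis unfolding A loc_map_frac[OF x c m] by (auto simp: localise_carrier)
qed

lemma loc_map_add_hom:
  assumes x: "x \<in> carrier R" "x' \<in> carrier R" and c: "loc_compat R M x x' \<phi>"
  shows "loc_map R M x' \<phi> e \<in> add_hom (localise R M x) (localise R M x')"
proof (rule add_homI)
  fix A B assume A: "A \<in> carrier (localise R M x)" and B: "B \<in> carrier (localise R M x)"
  have \<phi>: "\<phi> k m \<in> carrier M" if "m \<in> carrier M" for k m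
    using c that by (auto simp: loc_compat_def intro: add_hom_closed)
  show "loc_map R M x' \<phi> e A \<in> carrier (localise R M x')"
    by (rule loc_map_closed[OF x c A])
  obtain m k where A: "A = frac R M x m k" and m: "m \<in> carrier M"
    using A by (auto simp: localise_carrier)
  obtain m' k' where B: "B = frac R M x m' k'" and m': "m' \<in> carrier M"
    using B by (auto simp: localise_carrier)
  have "\<phi> (k + k') ((x [^] k') \<odot>\<^bsub>M\<^esub> m \<oplus>\<^bsub>M\<^esub> (x [^] k) \<odot>\<^bsub>M\<^esub> m')
      = \<phi> (k + k') ((x [^] k') \<odot>\<^bsub>M\<^esub> m) \<oplus>\<^bsub>M\<^esub> \<phi> (k' + k) ((x [^] k) \<odot>\<^bsub>M\<^esub> m')"
    using c m m' x by (subst add_hom_add[of "\<phi> (k + k')" M M]) (auto simp: loc_compat_def ac_simps)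
  also have "\<dots> = (x' [^] k') \<odot>\<^bsub>M\<^esub> \<phi> k m \<oplus>\<^bsub>M\<^esub> (x' [^] k) \<odot>\<^bsub>M\<^esub> \<phi> k' m'"
    using c m m' by (simp add: loc_compat_def)
  finally have 1: "\<phi> (k + k') ((x [^] k') \<odot>\<^bsub>M\<^esub> m \<oplus>\<^bsub>M\<^esub> (x [^] k) \<odot>\<^bsub>M\<^esub> m') =
    (x' [^] k') \<odot>\<^bsub>M\<^esub> \<phi> k m \<oplus>\<^bsub>M\<^esub> (x' [^] k) \<odot>\<^bsub>M\<^esub> \<phi> k' m'" (is "_ = ?s") .
  have "loc_map R M x' \<phi> e (A \<oplus>\<^bsub>localise R M x\<^esub> B) = frac R M x' ?s (k + k' + e)"
    unfolding A B localise_add[OF x(1) m m'] 1[symmetric]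
    by (rule loc_map_frac[OF x c]) (use m m' x in auto)
  \<comment> \<open>Adding fractions over x'^(k + e) and x'^(k' + e) gives the exponent k + k' + 2
    e, so the left-hand side is expanded by x'^e.\<close>
  also have "\<dots> = frac R M x' ((x' [^] e) \<odot>\<^bsub>M\<^esub> ?s) (k + k' + e + e)"
    using x \<phi> m m' by (subst frac_scale) auto
  also have "\<dots> = loc_map R M x' \<phi> e A \<oplus>\<^bsub>localise R M x'\<^esub> loc_map R M x' \<phi> e B"
    unfolding A B loc_map_frac[OF x c m] loc_map_frac[OF x c m'] localise_add[OF x(2) \<phi>[OF m] \<phi>[OF m']]
    using x \<phi> m m' by (simp add: smult_r_distr pow_smult_pow ac_simps)
  finally show "loc_map R M x' \<phi> e (A \<oplus>\<^bsub>localise R M x\<^esub> B)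
    = loc_map R M x' \<phi> e A \<oplus>\<^bsub>localise R M x'\<^esub> loc_map R M x' \<phi> e B" .
qed

lemma smult_add_hom: "r \<in> carrier R \<Longrightarrow> (\<lambda>m. r \<odot>\<^bsub>M\<^esub> m) \<in> add_hom M M"
  by (rule add_homI) (auto simp: smult_r_distr)

lemma smult_commute:
  assumes "r \<in> carrier R" "s \<in> carrier R" "m \<in> carrier M"
  shows "r \<odot>\<^bsub>M\<^esub> (s \<odot>\<^bsub>M\<^esub> m) = s \<odot>\<^bsub>M\<^esub> (r \<odot>\<^bsub>M\<^esub> m)"
  using assms by (simp add: smult_assoc1[symmetric] R.m_comm)

lemma loc_compat_smult:
  assumes "x \<in> carrier R" "r \<in> carrier R"
  shows "loc_compat R M x x (\<lambda>k m. r \<odot>\<^bsub>M\<^esub> m)"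
  unfolding loc_compat_def using assms smult_add_hom smult_commute by auto

lemma loc_compat_pow:
  assumes "x \<in> carrier R" "y \<in> carrier R"
  shows "loc_compat R M x (x \<otimes> y) (\<lambda>k m. (y [^] k) \<odot>\<^bsub>M\<^esub> m)"
  unfolding loc_compat_def
  using assms smult_add_hom
  by (auto simp: smult_assoc1[symmetric] R.nat_pow_mult[symmetric] R.nat_pow_distrib R.m_ac)

lemma localise_map_eq: "localise_map R M x y = loc_map R M (x \<otimes> y) (\<lambda>k m. (y [^] k) \<odot>\<^bsub>M\<^esub> m) 0"
  by (auto simp: localise_map_def loc_map_def fun_eq_iff)

end

section \<open>Cech complexes\<close>

text \<open>The terms (j, k) and (k, j) cancel. Interchanging the two sums would show only that
  twice the sum is zero; the induction instead splits off the terms that contain the new index a,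
  and these cancel against one another.\<close>

lemma (in abelian_group) finsum_antisymmetric:
  assumes "finite A" "\<And>j k. j \<in> A \<Longrightarrow> k \<in> A \<Longrightarrow> j \<noteq> k \<Longrightarrow> g j k \<in> carrier G"
    and "\<And>j k. j \<in> A \<Longrightarrow> k \<in> A \<Longrightarrow> j \<noteq> k \<Longrightarrow> g j k = \<ominus> g k j"
  shows "(\<Oplus>j\<in>A. \<Oplus>k\<in>A - {j}. g j k) = \<zero>"
  using assms
proof (induct A)
  case empty
  show ?case by simp
next
  case (insert a A)
  have g: "g j k \<in> carrier G" if "j \<in> insert a A" "k \<in> insert a A" "j \<noteq> k" for j k
    using that by (rule insert.prems(1))
  let ?S = "\<lambda>j. \<Oplus>k\<in>A - {j}. g j k"
  have Sc: "?S \<in> A \<rightarrow> carrier G"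
    by (rule Pi_I, rule finsum_closed, rule Pi_I, rule g) auto
  have gc1: "(\<lambda>j. g j a) \<in> A \<rightarrow> carrier G"
    by (rule Pi_I, rule g) (use insert.hyps(2) in auto)
  have gc2: "g a \<in> A \<rightarrow> carrier G"
    by (rule Pi_I, rule g) (use insert.hyps(2) in auto)
  note gc = gc1 gc2
  have inner: "(\<Oplus>k\<in>insert a A - {j}. g j k) = g j a \<oplus> ?S j" if "j \<in> A" for j
  proof -
    have eq: "insert a A - {j} = insert a (A - {j})" using that insert.hyps(2) by auto
    have "g j a \<in> carrier G" by (rule g) (use that insert.hyps(2) in auto)
    moreover have "g j \<in> A - {j} \<rightarrow> carrier G" by (rule Pi_I, rule g) (use that in auto)
    ultimately show ?thesis unfolding eq using insert.hyps(1,2) by (intro finsum_insert) auto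
  qed
  have S0: "(\<Oplus>j\<in>A. ?S j) = \<zero>"
  proof (rule insert.hyps(3))
    fix j k assume "j \<in> A" "k \<in> A" "j \<noteq> k"
    then have jk: "j \<in> insert a A" "k \<in> insert a A" "j \<noteq> k" by auto
    show "g j k \<in> carrier G" by (rule g[OF jk])
    show "g j k = \<ominus> g k j" by (rule insert.prems(2)[OF jk])
  qed
  have gS: "(\<lambda>j. g j a \<oplus> ?S j) \<in> A \<rightarrow> carrier G"
    using gc1 Sc by (simp add: Pi_iff)
  have "(\<Oplus>j\<in>A. \<Oplus>k\<in>insert a A - {j}. g j k) = (\<Oplus>j\<in>A. g j a \<oplus> ?S j)"
    by (rule finsum_cong'[OF refl gS inner])
  also have "\<dots> = (\<Oplus>j\<in>A. g j a)"
    using finsum_addf[OF gc(1) Sc] S0 finsum_closed[OF gc(1)] by simp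
  finally have rest: "(\<Oplus>j\<in>A. \<Oplus>k\<in>insert a A - {j}. g j k) = (\<Oplus>j\<in>A. g j a)" .
  have aA: "insert a A - {a} = A" using insert.hyps(1,2) by auto
  have "(\<Oplus>j\<in>insert a A. \<Oplus>k\<in>insert a A - {j}. g j k)
     = (\<Oplus>k\<in>insert a A - {a}. g a k) \<oplus> (\<Oplus>j\<in>A. \<Oplus>k\<in>insert a A - {j}. g j k)"
  proof (rule finsum_insert[OF insert.hyps(1,2)])
    show "(\<lambda>j. \<Oplus>k\<in>insert a A - {j}. g j k) \<in> A \<rightarrow> carrier G"
    proof (rule Pi_I)
      fix j assume "j \<in> A"
      then show "(\<Oplus>k\<in>insert a A - {j}. g j k) \<in> carrier G"
        using funcset_mem[OF gS] by (simp only: inner)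
    qed
    show "(\<Oplus>k\<in>insert a A - {a}. g a k) \<in> carrier G"
      unfolding aA by (rule finsum_closed[OF gc(2)])
  qed
  also have "\<dots> = (\<Oplus>k\<in>A. g a k) \<oplus> (\<Oplus>k\<in>A. g k a)"
    unfolding rest aA ..
  also have "\<dots> = (\<Oplus>k\<in>A. g a k \<oplus> g k a)"
    by (rule finsum_addf[OF gc(2,1), symmetric])
  also have "\<dots> = (\<Oplus>k\<in>A. \<zero>)"
  proof (rule finsum_cong'[OF refl])
    fix k assume k: "k \<in> A"
    then have jk: "a \<in> insert a A" "k \<in> insert a A" "a \<noteq> k" using insert.hyps(2) by auto
    have "g k a \<in> carrier G" by (rule g) (use jk in auto)
    then show "g a k \<oplus> g k a = \<zero>"
      unfolding insert.prems(2)[OF jk] by (rule l_neg)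
  qed simp
  finally show ?case by simp
qed

text \<open>The Cech sign as an additive map, so that each term of \<open>cech_diff\<close> is a
  composite of additive maps.\<close>

definition alternate :: "('z, 'w) ring_scheme \<Rightarrow> nat set \<Rightarrow> nat \<Rightarrow> 'z \<Rightarrow> 'z" where
  "alternate G \<tau> j y = (if even (card {l \<in> \<tau>. l < j}) then y else \<ominus>\<^bsub>G\<^esub> y)"

definition cochain_map :: "'b list \<Rightarrow> nat \<Rightarrow> (nat set \<Rightarrow> 'z \<Rightarrow> 'z) \<Rightarrow> (nat set \<Rightarrow> 'z) \<Rightarrow> nat set \<Rightarrow> 'z" where
  "cochain_map xs i \<Phi> c = (\<lambda>\<sigma>\<in>cech_index xs i. \<Phi> \<sigma> (c \<sigma>))"

text \<open>Deleting j moves k by one place exactly when j < k. So just one of the two orders of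
  deleting j and k picks up an extra sign, which makes the terms of d d antisymmetric.\<close>

lemma even_card_less_remove:
  assumes "finite \<tau>" "j \<in> \<tau>" "j \<noteq> (k::nat)"
  shows "even (card {l \<in> \<tau> - {j}. l < k}) \<longleftrightarrow> (even (card {l \<in> \<tau>. l < k}) \<longleftrightarrow> k < j)"
proof (cases "j < k")
  case True
  then have "{l \<in> \<tau>. l < k} = insert j {l \<in> \<tau> - {j}. l < k}" using assms by auto
  then have "card {l \<in> \<tau>. l < k} = Suc (card {l \<in> \<tau> - {j}. l < k})" using assms(1) by simp
  then show ?thesis using True by simp
next
  case False
  then have "{l \<in> \<tau> - {j}. l < k} = {l \<in> \<tau>. l < k}" by auto
  then show ?thesis using False assms by simp
qed

context module
begin

lemma cech_elt_closed:
  assumes "set xs \<subseteq> carrier R" "\<sigma> \<subseteq> {..<length xs}"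
  shows "cech_elt R xs \<sigma> \<in> carrier R"
  unfolding cech_elt_def using assms by (intro R.finprod_closed) (auto dest!: nth_mem)

lemma cech_elt_empty: "cech_elt R xs {} = \<one>"
  by (simp add: cech_elt_def)

lemma cech_elt_remove:
  assumes "set xs \<subseteq> carrier R" "\<tau> \<subseteq> {..<length xs}" "j \<in> \<tau>"
  shows "cech_elt R xs (\<tau> - {j}) \<otimes> xs ! j = cech_elt R xs \<tau>"
proof -
  have fin: "finite (\<tau> - {j})" using assms(2) finite_subset by auto
  have nth: "xs ! i \<in> carrier R" if "i \<in> \<tau>" for i
    using that assms(1,2) by (auto dest!: nth_mem)
  have "cech_elt R xs (insert j (\<tau> - {j})) = xs ! j \<otimes> cech_elt R xs (\<tau> - {j})"
    unfolding cech_elt_def using fin nth assms(3) by (intro R.finprod_insert) auto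
  moreover have "insert j (\<tau> - {j}) = \<tau>" using assms(3) by auto
  ultimately show ?thesis
    using nth assms cech_elt_closed[OF assms(1), of "\<tau> - {j}"] by (simp add: R.m_comm subset_iff)
qed

lemma localise_map_add_hom:
  assumes "set xs \<subseteq> carrier R" "\<tau> \<subseteq> {..<length xs}" "j \<in> \<tau>"
  shows "localise_map R M (cech_elt R xs (\<tau> - {j})) (xs ! j)
    \<in> add_hom (localise R M (cech_elt R xs (\<tau> - {j}))) (localise R M (cech_elt R xs \<tau>))"
proof -
  have x: "xs ! j \<in> carrier R" using assms by (auto dest!: nth_mem)
  have e: "cech_elt R xs (\<tau> - {j}) \<in> carrier R" using assms by (intro cech_elt_closed) auto
  show ?thesis
    unfolding localise_map_eq cech_elt_remove[OF assms, symmetric]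
    by (rule loc_map_add_hom[OF e _ loc_compat_pow]) (use e x in auto)
qed

lemma localise_map_frac:
  assumes "set xs \<subseteq> carrier R" "\<tau> \<subseteq> {..<length xs}" "j \<in> \<tau>" "m \<in> carrier M"
  shows "localise_map R M (cech_elt R xs (\<tau> - {j})) (xs ! j) (frac R M (cech_elt R xs (\<tau> - {j})) m k)
    = frac R M (cech_elt R xs \<tau>) ((xs ! j [^] k) \<odot>\<^bsub>M\<^esub> m) k"
proof -
  have x: "xs ! j \<in> carrier R" using assms by (auto dest!: nth_mem)
  have e: "cech_elt R xs (\<tau> - {j}) \<in> carrier R" using assms by (intro cech_elt_closed) auto
  show ?thesis
    unfolding localise_map_eq cech_elt_remove[OF assms(1-3), symmetric]
    by (subst loc_map_frac[OF e _ loc_compat_pow]) (use e x assms in auto)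
qed

lemma cech_index_subset: "\<sigma> \<in> cech_index xs i \<Longrightarrow> \<sigma> \<subseteq> {..<length xs}"
  by (simp add: cech_index_def)

lemma cech_index_remove: "\<tau> \<in> cech_index xs (Suc i) \<Longrightarrow> j \<in> \<tau> \<Longrightarrow> \<tau> - {j} \<in> cech_index xs i"
  by (auto simp: cech_index_def)

lemma cech_localise_abelian_group:
  assumes "set xs \<subseteq> carrier R" "\<sigma> \<in> cech_index xs i"
  shows "abelian_group (localise R M (cech_elt R xs \<sigma>))"
  by (rule localise_abelian_group[OF cech_elt_closed[OF assms(1) cech_index_subset[OF assms(2)]]])

lemma cech_cochains_abelian_group:
  assumes xs: "set xs \<subseteq> carrier R"
  shows "abelian_group (cech_cochains R M xs i)"
proof (rule abelian_groupI)
  let ?C = "cech_cochains R M xs i" and ?L = "\<lambda>\<sigma>. localise R M (cech_elt R xs \<sigma>)"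
  note L = cech_localise_abelian_group[OF xs]
  note LM = L[THEN abelian_group.axioms(1)]
  fix a b assume a: "a \<in> carrier ?C" and b: "b \<in> carrier ?C"
  then show "a \<oplus>\<^bsub>?C\<^esub> b \<in> carrier ?C"
    by (auto simp: cech_cochains_def PiE_iff intro!: abelian_monoid.a_closed[OF LM])
  show "a \<oplus>\<^bsub>?C\<^esub> b = b \<oplus>\<^bsub>?C\<^esub> a"
    unfolding cech_cochains_def ring.simps by (rule restrict_ext, rule abelian_monoid.a_comm[OF LM])
      (use a b in \<open>auto simp: cech_cochains_def PiE_iff\<close>)
next
  let ?C = "cech_cochains R M xs i" and ?L = "\<lambda>\<sigma>. localise R M (cech_elt R xs \<sigma>)"
  note L = cech_localise_abelian_group[OF xs]
  note LM = L[THEN abelian_group.axioms(1)]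
  fix a b c assume "a \<in> carrier ?C" "b \<in> carrier ?C" "c \<in> carrier ?C"
  then show "a \<oplus>\<^bsub>?C\<^esub> b \<oplus>\<^bsub>?C\<^esub> c = a \<oplus>\<^bsub>?C\<^esub> (b \<oplus>\<^bsub>?C\<^esub> c)"
    by (simp add: cech_cochains_def PiE_iff) (rule restrict_ext, simp add: abelian_monoid.a_assoc[OF LM])
next
  let ?C = "cech_cochains R M xs i" and ?L = "\<lambda>\<sigma>. localise R M (cech_elt R xs \<sigma>)"
  note L = cech_localise_abelian_group[OF xs]
  note LM = L[THEN abelian_group.axioms(1)]
  show "\<zero>\<^bsub>?C\<^esub> \<in> carrier ?C"
    by (auto simp: cech_cochains_def intro!: abelian_monoid.zero_closed[OF LM])
  fix a assume a: "a \<in> carrier ?C"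
  show "\<zero>\<^bsub>?C\<^esub> \<oplus>\<^bsub>?C\<^esub> a = a"
  proof
    fix \<sigma> show "(\<zero>\<^bsub>?C\<^esub> \<oplus>\<^bsub>?C\<^esub> a) \<sigma> = a \<sigma>"
      using a abelian_monoid.l_zero[OF LM, of \<sigma> i "a \<sigma>"]
      by (cases "\<sigma> \<in> cech_index xs i") (auto simp: cech_cochains_def PiE_iff extensional_def)
  qed
  let ?b = "\<lambda>\<sigma>\<in>cech_index xs i. \<ominus>\<^bsub>?L \<sigma>\<^esub> a \<sigma>"
  have "?b \<in> carrier ?C"
    using a by (auto simp: cech_cochains_def PiE_iff intro!: abelian_group.a_inv_closed[OF L])
  moreover have "?b \<oplus>\<^bsub>?C\<^esub> a = \<zero>\<^bsub>?C\<^esub>"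
    using a by (simp add: cech_cochains_def PiE_iff) (rule restrict_ext, simp add: abelian_group.l_neg[OF L])
  ultimately show "\<exists>b\<in>carrier ?C. b \<oplus>\<^bsub>?C\<^esub> a = \<zero>\<^bsub>?C\<^esub>" by blast
qed

lemma cochain_eval_add_hom:
  "\<sigma> \<in> cech_index xs i \<Longrightarrow> (\<lambda>c. c \<sigma>) \<in> add_hom (cech_cochains R M xs i) (localise R M (cech_elt R xs \<sigma>))"
  by (rule add_homI) (auto simp: cech_cochains_def)

lemma cochain_eqI:
  assumes "c \<in> carrier (cech_cochains R M xs i)" "c' \<in> carrier (cech_cochains R M xs i)"
    and "\<And>\<sigma>. \<sigma> \<in> cech_index xs i \<Longrightarrow> c \<sigma> = c' \<sigma>"
  shows "c = c'"
  by (rule PiE_ext[OF assms(1,2)[unfolded cech_cochains_def, simplified] assms(3)])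

lemma cochain_zero_apply:
  "\<sigma> \<in> cech_index xs i \<Longrightarrow> \<zero>\<^bsub>cech_cochains R M xs i\<^esub> \<sigma> = \<zero>\<^bsub>localise R M (cech_elt R xs \<sigma>)\<^esub>"
  by (simp add: cech_cochains_def)

lemma alternate_add_hom:
  assumes "abelian_group G" shows "alternate G \<tau> j \<in> add_hom G G"
proof -
  interpret abelian_group G by fact
  show ?thesis by (rule add_homI) (auto simp: alternate_def minus_add)
qed

lemma cech_diff_apply:
  "\<tau> \<in> cech_index xs (Suc i) \<Longrightarrow> cech_diff R M xs i c \<tau> =
    (\<Oplus>\<^bsub>localise R M (cech_elt R xs \<tau>)\<^esub> j \<in> \<tau>. alternate (localise R M (cech_elt R xs \<tau>)) \<tau> j
       (localise_map R M (cech_elt R xs (\<tau> - {j})) (xs ! j) (c (\<tau> - {j}))))"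
  by (simp add: cech_diff_def alternate_def Let_def)

lemma cech_diff_term_add_hom:
  assumes xs: "set xs \<subseteq> carrier R" and \<tau>: "\<tau> \<in> cech_index xs (Suc i)" "j \<in> \<tau>"
  shows "(\<lambda>c. alternate (localise R M (cech_elt R xs \<tau>)) \<tau> j
       (localise_map R M (cech_elt R xs (\<tau> - {j})) (xs ! j) (c (\<tau> - {j}))))
     \<in> add_hom (cech_cochains R M xs i) (localise R M (cech_elt R xs \<tau>))"
  by (rule add_hom_comp[OF add_hom_comp[OF cochain_eval_add_hom[OF cech_index_remove[OF \<tau>]]
        localise_map_add_hom[OF xs cech_index_subset[OF \<tau>(1)] \<tau>(2)]]
        alternate_add_hom[OF cech_localise_abelian_group[OF xs \<tau>(1)]]])

lemma cech_diff_add_hom: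
  assumes xs: "set xs \<subseteq> carrier R"
  shows "cech_diff R M xs i \<in> add_hom (cech_cochains R M xs i) (cech_cochains R M xs (Suc i))"
proof (rule add_homI)
  note t = cech_diff_term_add_hom[OF xs]
  note L = cech_localise_abelian_group[OF xs]
  note LM = L[THEN abelian_group.axioms(1)]
  interpret C: abelian_group "cech_cochains R M xs i" by (rule cech_cochains_abelian_group[OF xs])
  interpret C': abelian_group "cech_cochains R M xs (Suc i)" by (rule cech_cochains_abelian_group[OF xs])
  have cl: "cech_diff R M xs i c \<in> carrier (cech_cochains R M xs (Suc i))"
    if "c \<in> carrier (cech_cochains R M xs i)" for c
  proof -
    have "cech_diff R M xs i c \<tau> \<in> carrier (localise R M (cech_elt R xs \<tau>))"
      if \<tau>: "\<tau> \<in> cech_index xs (Suc i)" for \<tau>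
      unfolding cech_diff_apply[OF \<tau>]
      by (rule abelian_monoid.finsum_closed[OF LM[OF \<tau>]])
        (use add_hom_closed[OF t[OF \<tau>]] \<open>c \<in> _\<close> in auto)
    moreover have "cech_diff R M xs i c \<in> extensional (cech_index xs (Suc i))"
      by (simp add: cech_diff_def)
    ultimately show ?thesis by (auto simp: cech_cochains_def PiE_iff)
  qed
  fix a b assume a: "a \<in> carrier (cech_cochains R M xs i)" and b: "b \<in> carrier (cech_cochains R M xs i)"
  show "cech_diff R M xs i a \<in> carrier (cech_cochains R M xs (Suc i))" using cl a by auto
  show "cech_diff R M xs i (a \<oplus>\<^bsub>cech_cochains R M xs i\<^esub> b)
     = cech_diff R M xs i a \<oplus>\<^bsub>cech_cochains R M xs (Suc i)\<^esub> cech_diff R M xs i b"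
  proof (rule cochain_eqI)
    fix \<tau> assume \<tau>: "\<tau> \<in> cech_index xs (Suc i)"
    interpret L: abelian_group "localise R M (cech_elt R xs \<tau>)" by (rule L[OF \<tau>])
    let ?T = "\<lambda>c j. alternate (localise R M (cech_elt R xs \<tau>)) \<tau> j
       (localise_map R M (cech_elt R xs (\<tau> - {j})) (xs ! j) (c (\<tau> - {j})))"
    have T: "?T c \<in> \<tau> \<rightarrow> carrier (localise R M (cech_elt R xs \<tau>))"
      if "c \<in> carrier (cech_cochains R M xs i)" for c
      by (rule Pi_I) (rule add_hom_closed[OF t[OF \<tau>] that])
    have "(\<Oplus>\<^bsub>localise R M (cech_elt R xs \<tau>)\<^esub>j\<in>\<tau>. ?T (a \<oplus>\<^bsub>cech_cochains R M xs i\<^esub> b) j)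
      = (\<Oplus>\<^bsub>localise R M (cech_elt R xs \<tau>)\<^esub>j\<in>\<tau>. ?T a j \<oplus>\<^bsub>localise R M (cech_elt R xs \<tau>)\<^esub> ?T b j)"
    proof (rule L.finsum_cong'[OF refl])
      show "(\<lambda>j. ?T a j \<oplus>\<^bsub>localise R M (cech_elt R xs \<tau>)\<^esub> ?T b j) \<in> \<tau> \<rightarrow> carrier (localise R M (cech_elt R xs \<tau>))"
        using funcset_mem[OF T[OF a]] funcset_mem[OF T[OF b]] by (intro Pi_I L.a_closed)
    qed (rule add_hom_add[OF t[OF \<tau>] a b])
    also have "\<dots> = finsum (localise R M (cech_elt R xs \<tau>)) (?T a) \<tau>
        \<oplus>\<^bsub>localise R M (cech_elt R xs \<tau>)\<^esub> finsum (localise R M (cech_elt R xs \<tau>)) (?T b) \<tau>"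
      by (rule L.finsum_addf[OF T[OF a] T[OF b]])
    finally show "cech_diff R M xs i (a \<oplus>\<^bsub>cech_cochains R M xs i\<^esub> b) \<tau>
     = (cech_diff R M xs i a \<oplus>\<^bsub>cech_cochains R M xs (Suc i)\<^esub> cech_diff R M xs i b) \<tau>"
      unfolding add_hom_add[OF cochain_eval_add_hom[OF \<tau>] cl[OF a] cl[OF b]]
      unfolding cech_diff_apply[OF \<tau>] .
  qed (use a b cl in auto)
qed

lemma cech_diff_closed:
  assumes "set xs \<subseteq> carrier R" "c \<in> carrier (cech_cochains R M xs i)"
  shows "cech_diff R M xs i c \<in> carrier (cech_cochains R M xs (Suc i))"
  by (rule add_hom_closed[OF cech_diff_add_hom[OF assms(1)] assms(2)])

text \<open>For A = m / e^n both sides are x_j^n x_k^n m over the n-th power of the product over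
  \<tau>.\<close>

lemma localise_map_localise_map:
  assumes xs: "set xs \<subseteq> carrier R" and \<tau>: "\<tau> \<subseteq> {..<length xs}" "j \<in> \<tau>" "k \<in> \<tau>" "j \<noteq> k"
    and A: "A \<in> carrier (localise R M (cech_elt R xs (\<tau> - {j} - {k})))"
  shows "localise_map R M (cech_elt R xs (\<tau> - {j})) (xs ! j)
       (localise_map R M (cech_elt R xs (\<tau> - {j} - {k})) (xs ! k) A)
     = localise_map R M (cech_elt R xs (\<tau> - {k})) (xs ! k)
       (localise_map R M (cech_elt R xs (\<tau> - {k} - {j})) (xs ! j) A)"
proof -
  obtain m n where m: "m \<in> carrier M" and A: "A = frac R M (cech_elt R xs (\<tau> - {j} - {k})) m n"
    using A by (elim localise_cases)
  have c: "xs ! j \<in> carrier R" "xs ! k \<in> carrier R" using xs \<tau> by (auto dest!: nth_mem)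
  have *: "localise_map R M (cech_elt R xs (\<tau> - {j})) (xs ! j)
       (localise_map R M (cech_elt R xs (\<tau> - {j} - {k})) (xs ! k) (frac R M (cech_elt R xs (\<tau> - {j} - {k})) m n))
     = frac R M (cech_elt R xs \<tau>) ((xs ! j [^] n) \<odot>\<^bsub>M\<^esub> ((xs ! k [^] n) \<odot>\<^bsub>M\<^esub> m)) n"
    if "j \<in> \<tau>" "k \<in> \<tau>" "j \<noteq> k" "xs ! j \<in> carrier R" "xs ! k \<in> carrier R" for j k
  proof -
    have "localise_map R M (cech_elt R xs (\<tau> - {j} - {k})) (xs ! k) (frac R M (cech_elt R xs (\<tau> - {j} - {k})) m n)
      = frac R M (cech_elt R xs (\<tau> - {j})) ((xs ! k [^] n) \<odot>\<^bsub>M\<^esub> m) n"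
      by (rule localise_map_frac[OF xs]) (use that \<tau>(1) m in auto)
    then show ?thesis
      by (simp only:) (rule localise_map_frac[OF xs], use that \<tau>(1) m in auto)
  qed
  have "\<tau> - {j} - {k} = \<tau> - {k} - {j}" by auto
  then show ?thesis
    using *[of j k] *[of k j] \<tau> c m unfolding A by (simp add: smult_commute)
qed

text \<open>At \<tau> the composite is a sum over ordered pairs of distinct j, k in \<tau>; the
  values h are symmetric in j and k, the signs antisymmetric.\<close>

lemma cech_diff_cech_diff:
  assumes xs: "set xs \<subseteq> carrier R" and c: "c \<in> carrier (cech_cochains R M xs i)"
  shows "cech_diff R M xs (Suc i) (cech_diff R M xs i c) = \<zero>\<^bsub>cech_cochains R M xs (Suc (Suc i))\<^esub>"
proof (rule cochain_eqI)
  interpret C: abelian_group "cech_cochains R M xs (Suc (Suc i))" by (rule cech_cochains_abelian_group[OF xs])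
  show "\<zero>\<^bsub>cech_cochains R M xs (Suc (Suc i))\<^esub> \<in> carrier (cech_cochains R M xs (Suc (Suc i)))" by simp
  show "cech_diff R M xs (Suc i) (cech_diff R M xs i c) \<in> carrier (cech_cochains R M xs (Suc (Suc i)))"
    using c by (intro cech_diff_closed xs)
  fix \<tau> assume \<tau>: "\<tau> \<in> cech_index xs (Suc (Suc i))"
  let ?L = "\<lambda>\<sigma>. localise R M (cech_elt R xs \<sigma>)"
  let ?r = "\<lambda>\<tau> j. localise_map R M (cech_elt R xs (\<tau> - {j})) (xs ! j)"
  interpret L: abelian_group "?L \<tau>" by (rule cech_localise_abelian_group[OF xs \<tau>])
  note s\<tau> = cech_index_subset[OF \<tau>]
  have fin: "finite \<tau>" using s\<tau> finite_subset by blast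
  define h where "h j k = ?r \<tau> j (?r (\<tau> - {j}) k (c (\<tau> - {j} - {k})))" for j k
  define g where "g j k = alternate (?L \<tau>) \<tau> j (alternate (?L \<tau>) (\<tau> - {j}) k (h j k))" for j k
  have c': "c (\<tau> - {j} - {k}) \<in> carrier (?L (\<tau> - {j} - {k}))" if "j \<in> \<tau>" "k \<in> \<tau> - {j}" for j k
    by (rule add_hom_closed[OF cochain_eval_add_hom c]) (use \<tau> that in \<open>auto intro!: cech_index_remove\<close>)
  have rc: "?r (\<tau> - {j}) k (c (\<tau> - {j} - {k})) \<in> carrier (?L (\<tau> - {j}))" if "j \<in> \<tau>" "k \<in> \<tau> - {j}" for j k
    by (rule add_hom_closed[OF localise_map_add_hom[OF xs] c']) (use that s\<tau> in auto)
  have hc: "h j k \<in> carrier (?L \<tau>)" if "j \<in> \<tau>" "k \<in> \<tau> - {j}" for j k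
    unfolding h_def by (rule add_hom_closed[OF localise_map_add_hom[OF xs] rc]) (use that s\<tau> in auto)
  have gc: "g j k \<in> carrier (?L \<tau>)" if "j \<in> \<tau>" "k \<in> \<tau> - {j}" for j k
    using hc[OF that] by (auto simp: g_def alternate_def)
  have inner: "alternate (?L \<tau>) \<tau> j (?r \<tau> j (cech_diff R M xs i c (\<tau> - {j})))
      = (\<Oplus>\<^bsub>?L \<tau>\<^esub> k\<in>\<tau> - {j}. g j k)" if j: "j \<in> \<tau>" for j
  proof -
    note \<tau>' = cech_index_remove[OF \<tau> j]
    note G' = cech_localise_abelian_group[OF xs \<tau>']
    note r = localise_map_add_hom[OF xs s\<tau> j]
    have ac: "alternate (?L (\<tau> - {j})) (\<tau> - {j}) k (?r (\<tau> - {j}) k (c (\<tau> - {j} - {k}))) \<in> carrier (?L (\<tau> - {j}))"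
      if "k \<in> \<tau> - {j}" for k
      by (rule add_hom_closed[OF alternate_add_hom[OF G'] rc[OF j that]])
    have "alternate (?L \<tau>) \<tau> j (?r \<tau> j (cech_diff R M xs i c (\<tau> - {j})))
      = (\<Oplus>\<^bsub>?L \<tau>\<^esub> k\<in>\<tau> - {j}. alternate (?L \<tau>) \<tau> j (?r \<tau> j
          (alternate (?L (\<tau> - {j})) (\<tau> - {j}) k (?r (\<tau> - {j}) k (c (\<tau> - {j} - {k}))))))"
      unfolding cech_diff_apply[OF \<tau>']
      by (rule add_hom_finsum[OF G' L.abelian_group_axioms add_hom_comp[OF r alternate_add_hom[OF L.abelian_group_axioms]]])
        (use ac in auto)
    also have "\<dots> = (\<Oplus>\<^bsub>?L \<tau>\<^esub> k\<in>\<tau> - {j}. g j k)"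
    proof (intro L.finsum_cong' refl)
      fix k assume k: "k \<in> \<tau> - {j}"
      show "alternate (?L \<tau>) \<tau> j (?r \<tau> j
          (alternate (?L (\<tau> - {j})) (\<tau> - {j}) k (?r (\<tau> - {j}) k (c (\<tau> - {j} - {k}))))) = g j k"
        using add_hom_a_inv[OF G' L.abelian_group_axioms r rc[OF j k]]
        by (simp add: g_def h_def alternate_def)
    qed (use gc j in auto)
    finally show ?thesis .
  qed
  have "cech_diff R M xs (Suc i) (cech_diff R M xs i c) \<tau> = (\<Oplus>\<^bsub>?L \<tau>\<^esub> j\<in>\<tau>. \<Oplus>\<^bsub>?L \<tau>\<^esub> k\<in>\<tau> - {j}. g j k)"
    unfolding cech_diff_apply[OF \<tau>]
    by (intro L.finsum_cong' refl) (auto simp: inner intro!: L.finsum_closed gc)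
  also have "\<dots> = \<zero>\<^bsub>?L \<tau>\<^esub>"
  proof (rule L.finsum_antisymmetric[OF fin])
    fix j k assume jk: "j \<in> \<tau>" "k \<in> \<tau>" "j \<noteq> k"
    show "g j k \<in> carrier (?L \<tau>)" using gc jk by auto
    have eq: "h j k = h k j"
      unfolding h_def
      by (subst localise_map_localise_map[OF xs s\<tau> jk])
        (use c'[of j k] jk in \<open>auto simp: Diff_insert2[symmetric] insert_commute\<close>)
    have hc': "h k j \<in> carrier (?L \<tau>)" using hc jk by auto
    \<comment> \<open>With h symmetric, only the two pairs of signs have to be compared, which
      \<open>even_card_less_remove\<close> does.\<close>
    then show "g j k = \<ominus>\<^bsub>?L \<tau>\<^esub> g k j"
      using jk even_card_less_remove[OF fin, of j k] even_card_less_remove[OF fin, of k j]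
      by (cases "j < k") (auto simp: g_def alternate_def eq L.minus_minus)
  qed
  finally show "cech_diff R M xs (Suc i) (cech_diff R M xs i c) \<tau> = \<zero>\<^bsub>cech_cochains R M xs (Suc (Suc i))\<^esub> \<tau>"
    using \<tau> by (simp add: cochain_zero_apply)
qed

lemma cochain_map_add_hom:
  assumes "\<And>\<sigma>. \<sigma> \<in> cech_index xs i \<Longrightarrow>
      \<Phi> \<sigma> \<in> add_hom (localise R M (cech_elt R xs \<sigma>)) (localise R M (cech_elt R xs \<sigma>))"
  shows "cochain_map xs i \<Phi> \<in> add_hom (cech_cochains R M xs i) (cech_cochains R M xs i)"
proof (rule add_homI)
  fix a b assume "a \<in> carrier (cech_cochains R M xs i)" "b \<in> carrier (cech_cochains R M xs i)"
  then show "cochain_map xs i \<Phi> (a \<oplus>\<^bsub>cech_cochains R M xs i\<^esub> b)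
      = cochain_map xs i \<Phi> a \<oplus>\<^bsub>cech_cochains R M xs i\<^esub> cochain_map xs i \<Phi> b"
    by (simp add: cochain_map_def cech_cochains_def PiE_iff)
      (rule restrict_ext, simp add: add_hom_add[OF assms])
qed (use add_hom_closed[OF assms] in \<open>auto simp: cochain_map_def cech_cochains_def PiE_iff\<close>)

text \<open>Naturality of the differential, applied to multiplication by a ring element and to the
  projections onto a degree. The latter depend on the degree of e_\<sigma>, hence a family of maps
  indexed by \<sigma>.\<close>

lemma cech_diff_cochain_map:
  assumes xs: "set xs \<subseteq> carrier R"
    and hom: "\<And>i \<sigma>. \<sigma> \<in> cech_index xs i \<Longrightarrow>
      \<Phi> \<sigma> \<in> add_hom (localise R M (cech_elt R xs \<sigma>)) (localise R M (cech_elt R xs \<sigma>))"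
    and comm: "\<And>\<tau> j A. \<tau> \<in> cech_index xs (Suc i) \<Longrightarrow> j \<in> \<tau> \<Longrightarrow> A \<in> carrier (localise R M (cech_elt R xs (\<tau> - {j}))) \<Longrightarrow>
      \<Phi> \<tau> (localise_map R M (cech_elt R xs (\<tau> - {j})) (xs ! j) A)
      = localise_map R M (cech_elt R xs (\<tau> - {j})) (xs ! j) (\<Phi> (\<tau> - {j}) A)"
    and c: "c \<in> carrier (cech_cochains R M xs i)"
  shows "cech_diff R M xs i (cochain_map xs i \<Phi> c) = cochain_map xs (Suc i) \<Phi> (cech_diff R M xs i c)"
proof (rule cochain_eqI)
  show "cech_diff R M xs i (cochain_map xs i \<Phi> c) \<in> carrier (cech_cochains R M xs (Suc i))"
    by (intro cech_diff_closed xs add_hom_closed[OF cochain_map_add_hom[OF hom] c])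
  show "cochain_map xs (Suc i) \<Phi> (cech_diff R M xs i c) \<in> carrier (cech_cochains R M xs (Suc i))"
    by (intro add_hom_closed[OF cochain_map_add_hom[OF hom]] cech_diff_closed xs c)
  fix \<tau> assume \<tau>: "\<tau> \<in> cech_index xs (Suc i)"
  let ?L = "\<lambda>\<sigma>. localise R M (cech_elt R xs \<sigma>)"
  let ?r = "\<lambda>\<tau> j. localise_map R M (cech_elt R xs (\<tau> - {j})) (xs ! j)"
  interpret L: abelian_group "?L \<tau>" by (rule cech_localise_abelian_group[OF xs \<tau>])
  note cl = add_hom_closed[OF cech_diff_term_add_hom[OF xs \<tau>] c]
  have cc: "c (\<tau> - {j}) \<in> carrier (?L (\<tau> - {j}))" if "j \<in> \<tau>" for j
    by (rule add_hom_closed[OF cochain_eval_add_hom[OF cech_index_remove[OF \<tau> that]] c])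
  have rc: "?r \<tau> j (c (\<tau> - {j})) \<in> carrier (?L \<tau>)" if "j \<in> \<tau>" for j
    by (rule add_hom_closed[OF localise_map_add_hom[OF xs cech_index_subset[OF \<tau>] that] cc[OF that]])
  have "cochain_map xs (Suc i) \<Phi> (cech_diff R M xs i c) \<tau> = \<Phi> \<tau> (cech_diff R M xs i c \<tau>)"
    using \<tau> by (simp add: cochain_map_def)
  also have "\<dots> = (\<Oplus>\<^bsub>?L \<tau>\<^esub> j \<in> \<tau>. \<Phi> \<tau> (alternate (?L \<tau>) \<tau> j (?r \<tau> j (c (\<tau> - {j})))))"
    unfolding cech_diff_apply[OF \<tau>]
    by (rule add_hom_finsum[OF L.abelian_group_axioms L.abelian_group_axioms hom[OF \<tau>]]) (use cl in auto)
  also have "\<dots> = (\<Oplus>\<^bsub>?L \<tau>\<^esub> j \<in> \<tau>. alternate (?L \<tau>) \<tau> j (?r \<tau> j (cochain_map xs i \<Phi> c (\<tau> - {j}))))"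
  proof (intro L.finsum_cong' refl)
    fix j assume j: "j \<in> \<tau>"
    have "\<Phi> \<tau> (?r \<tau> j (c (\<tau> - {j}))) = ?r \<tau> j (cochain_map xs i \<Phi> c (\<tau> - {j}))"
      using comm[OF \<tau> j cc[OF j]] cech_index_remove[OF \<tau> j] by (simp add: cochain_map_def)
    then show "\<Phi> \<tau> (alternate (?L \<tau>) \<tau> j (?r \<tau> j (c (\<tau> - {j}))))
      = alternate (?L \<tau>) \<tau> j (?r \<tau> j (cochain_map xs i \<Phi> c (\<tau> - {j})))"
      using add_hom_a_inv[OF L.abelian_group_axioms L.abelian_group_axioms hom[OF \<tau>] rc[OF j]]
      by (simp add: alternate_def)
  next
    show "(\<lambda>j. alternate (?L \<tau>) \<tau> j (?r \<tau> j (cochain_map xs i \<Phi> c (\<tau> - {j})))) \<in> \<tau> \<rightarrow> carrier (?L \<tau>)"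
      using add_hom_closed[OF cech_diff_term_add_hom[OF xs \<tau>] add_hom_closed[OF cochain_map_add_hom[OF hom] c]]
      by auto
  qed
  also have "\<dots> = cech_diff R M xs i (cochain_map xs i \<Phi> c) \<tau>"
    using \<tau> by (simp add: cech_diff_apply)
  finally show "cech_diff R M xs i (cochain_map xs i \<Phi> c) \<tau> = cochain_map xs (Suc i) \<Phi> (cech_diff R M xs i c) \<tau>" ..
qed

end

section \<open>Graded modules and their Cech complexes\<close>

fun dot :: "('a, 'x) ring_scheme \<Rightarrow> 'a list \<Rightarrow> 'a list \<Rightarrow> 'a" where
  "dot R (w # ws) (y # ys) = w \<otimes>\<^bsub>R\<^esub> y \<oplus>\<^bsub>R\<^esub> dot R ws ys"
| "dot R ws ys = \<zero>\<^bsub>R\<^esub>"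

lemma (in semiring) dot_closed:
  "set ws \<subseteq> carrier R \<Longrightarrow> set ys \<subseteq> carrier R \<Longrightarrow> dot R ws ys \<in> carrier R"
  by (induct ws ys rule: list_induct2') auto

lemma (in semiring) dot_mult:
  "length ws = length ys \<Longrightarrow> set ws \<subseteq> carrier R \<Longrightarrow> set ys \<subseteq> carrier R \<Longrightarrow> r \<in> carrier R \<Longrightarrow>
    dot R ws ys \<otimes> r = dot R ws (map (\<lambda>y. y \<otimes> r) ys)"
  by (induct ws ys rule: list_induct2) (auto simp: l_distr m_assoc dot_closed)

context abelian_group
begin

text \<open>A and B prescribe where values may lie according to the number of entries
  \<open>True\<close>, which the boundary lowers by one. They are arbitrary because the induction
  passes to their shifts, and because a constantly zero B shows that a boundary vanishes.\<close>

lemma koszul_graded: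
  assumes "\<And>k. \<zero> \<in> B k" "\<And>k a b. a \<in> B k \<Longrightarrow> b \<in> B k \<Longrightarrow> a \<oplus> b \<in> B k"
    "\<And>k a. a \<in> B k \<Longrightarrow> \<ominus> a \<in> B k"
    and "\<And>x k a. x \<in> set xs \<Longrightarrow> a \<in> A (Suc k) \<Longrightarrow> x a \<in> B k"
    and "\<And>L. v L \<in> A (count_list L True)"
  shows "koszul G xs v L \<in> B (count_list L True)"
  using assms
proof (induct xs v L arbitrary: A B rule: koszul_induct)
  case (False x xs v L)
  have "koszul G xs (\<lambda>L. v (False # L)) L \<in> B (count_list L True)"
  proof (rule False.hyps[of B A])
    show "v (False # L) \<in> A (count_list L True)" for L using False.prems(5)[of "False # L"] by simp
  qed (use False.prems in auto)
  moreover have "x (v (True # L)) \<in> B (count_list L True)"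
    using False.prems(5)[of "True # L"] by (intro False.prems(4)) auto
  ultimately show ?case using False.prems(2) by simp
next
  case (True x xs v L)
  have "koszul G xs (\<lambda>L. v (True # L)) L \<in> (B \<circ> Suc) (count_list L True)"
  proof (rule True.hyps[of "B \<circ> Suc" "A \<circ> Suc"])
    show "v (True # L) \<in> (A \<circ> Suc) (count_list L True)" for L using True.prems(5)[of "True # L"] by simp
  qed (use True.prems in auto)
  then show ?case using True.prems(3) by simp
qed auto

lemma koszul_homotopy_graded:
  assumes "\<And>k. \<zero> \<in> B k" "\<And>k a b. a \<in> B k \<Longrightarrow> b \<in> B k \<Longrightarrow> a \<ominus> b \<in> B k"
    and "\<And>x k a. x \<in> set xs \<Longrightarrow> a \<in> A k \<Longrightarrow> x a \<in> B (Suc k)"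
    and "\<And>L. v L \<in> A (count_list L True)"
  shows "koszul_homotopy G xs v L \<in> B (count_list L True)"
  using assms
proof (induct xs v L arbitrary: A B rule: koszul_induct)
  case (False x xs v L)
  have "koszul_homotopy G xs (\<lambda>L. v (False # L)) L \<in> B (count_list L True)"
  proof (rule False.hyps[of B A])
    show "v (False # L) \<in> A (count_list L True)" for L using False.prems(4)[of "False # L"] by simp
  qed (use False.prems in auto)
  then show ?case by simp
next
  case (True x xs v L)
  have "koszul_homotopy G xs (\<lambda>L. v (True # L)) L \<in> (B \<circ> Suc) (count_list L True)"
  proof (rule True.hyps[of "B \<circ> Suc" "A \<circ> Suc"])
    show "v (True # L) \<in> (A \<circ> Suc) (count_list L True)" for L using True.prems(4)[of "True # L"] by simp
  qed (use True.prems in auto)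
  moreover have "x (v (False # L)) \<in> B (Suc (count_list L True))"
    using True.prems(4)[of "False # L"] by (intro True.prems(3)) auto
  ultimately show ?case using True.prems(2) by simp
qed auto

end

text \<open>The decomposition of M is carried by projections compatible with multiplication by
  homogeneous elements; they pass to fractions by acting on numerators. By
  \<open>gR_disjoint\<close> a nonzero homogeneous element has one degree only, which fixes the
  degree of its fractions.\<close>

locale graded_module = module +
  fixes gR :: "int ^ 's::finite \<Rightarrow> 'a set" and gM :: "int ^ 's \<Rightarrow> 'c set"
    and proj :: "int ^ 's \<Rightarrow> 'c \<Rightarrow> 'c"
  assumes gR_carrier: "gR n \<subseteq> carrier R"
    and one_gR: "\<one> \<in> gR 0"
    and zero_gR: "\<zero> \<in> gR n"
    and mult_gR: "a \<in> gR n \<Longrightarrow> b \<in> gR k \<Longrightarrow> a \<otimes> b \<in> gR (n + k)"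
    and gR_disjoint: "a \<in> gR n \<Longrightarrow> a \<in> gR k \<Longrightarrow> n \<noteq> k \<Longrightarrow> a = \<zero>"
    and gM_carrier: "gM n \<subseteq> carrier M"
    and proj_add_hom: "proj n \<in> add_hom M M"
    and proj_mem: "m \<in> carrier M \<Longrightarrow> proj n m \<in> gM n"
    and proj_id: "m \<in> gM n \<Longrightarrow> proj n m = m"
    and proj_smult: "a \<in> gR k \<Longrightarrow> m \<in> carrier M \<Longrightarrow> proj (n + k) (a \<odot>\<^bsub>M\<^esub> m) = a \<odot>\<^bsub>M\<^esub> proj n m"
begin

lemma gRD: "a \<in> gR n \<Longrightarrow> a \<in> carrier R" using gR_carrier by blast
lemma gMD: "m \<in> gM n \<Longrightarrow> m \<in> carrier M" using gM_carrier by blast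

lemma smult_gM:
  assumes "a \<in> gR k" "m \<in> gM n" shows "a \<odot>\<^bsub>M\<^esub> m \<in> gM (n + k)"
proof -
  have "a \<odot>\<^bsub>M\<^esub> m = proj (n + k) (a \<odot>\<^bsub>M\<^esub> m)"
    using assms proj_smult[of a k m n] proj_id[of m n] gMD by simp
  moreover have "a \<odot>\<^bsub>M\<^esub> m \<in> carrier M" using assms gRD gMD by auto
  ultimately show ?thesis using proj_mem[of "a \<odot>\<^bsub>M\<^esub> m" "n + k"] by simp
qed

lemma zero_gM: "\<zero>\<^bsub>M\<^esub> \<in> gM n"
proof -
  have "proj n \<zero>\<^bsub>M\<^esub> = \<zero>\<^bsub>M\<^esub>"
    by (rule add_hom_zero[OF M.abelian_group_axioms M.abelian_group_axioms proj_add_hom])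
  then show ?thesis using proj_mem[of "\<zero>\<^bsub>M\<^esub>" n] by simp
qed

lemma pow_gR:
  assumes "a \<in> gR d" shows "a [^] (k::nat) \<in> gR (int k *s d)"
proof (induct k)
  case 0
  have "int 0 *s d = 0" by (simp add: vec_eq_iff)
  then show ?case using one_gR by simp
next
  case (Suc k)
  have "int (Suc k) *s d = int k *s d + d" by (simp add: vec_eq_iff algebra_simps)
  then show ?case using mult_gR[OF Suc assms] by simp
qed

text \<open>\<open>localise_comp\<close> admits every degree d of x. A nonzero x has just one; for x
  = 0 the localisation is zero and the choice is immaterial.\<close>

lemma localise_comp_eq:
  assumes "x \<in> gR d"
  shows "localise_comp R gR M gM x n = {frac R M x m k | m k. m \<in> gM (n + int k *s d)}"
proof (cases "x = \<zero>")
  case True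
  have x: "x \<in> carrier R" using assms gRD by blast
  \<comment> \<open>Over x = 0 the witness l = 1 makes both powers of x zero, so all fractions
    agree.\<close>
  have eq: "frac R M x m k = frac R M x \<zero>\<^bsub>M\<^esub> 0" if "m \<in> gM j" for m k j
    using gMD[OF that] x
    by (subst frac_eq_iff) (auto simp: True R.nat_pow_zero intro!: exI[of _ 1])
  have "localise_comp R gR M gM x n = {frac R M x \<zero>\<^bsub>M\<^esub> 0}"
  proof (rule subset_antisym; rule subsetI)
    fix A assume "A \<in> localise_comp R gR M gM x n"
    then obtain m k d' where "A = frac R M x m k" "m \<in> gM (n + int k *s d')"
      unfolding localise_comp_def by blast
    then show "A \<in> {frac R M x \<zero>\<^bsub>M\<^esub> 0}" using eq by simp
  next
    fix A assume "A \<in> {frac R M x \<zero>\<^bsub>M\<^esub> 0}"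
    then show "A \<in> localise_comp R gR M gM x n"
      unfolding localise_comp_def using assms zero_gM[of "n + int 0 *s d"] by blast
  qed
  moreover have "{frac R M x m k | m k. m \<in> gM (n + int k *s d)} = {frac R M x \<zero>\<^bsub>M\<^esub> 0}"
  proof (rule subset_antisym; rule subsetI)
    fix A assume "A \<in> {frac R M x m k | m k. m \<in> gM (n + int k *s d)}"
    then obtain m k where "A = frac R M x m k" "m \<in> gM (n + int k *s d)" by blast
    then show "A \<in> {frac R M x \<zero>\<^bsub>M\<^esub> 0}" using eq by simp
  next
    fix A assume "A \<in> {frac R M x \<zero>\<^bsub>M\<^esub> 0}"
    then show "A \<in> {frac R M x m k | m k. m \<in> gM (n + int k *s d)}"
      using zero_gM[of "n + int 0 *s d"] by blast
  qed
  ultimately show ?thesis by simp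
next
  case False
  then have "x \<in> gR d' \<Longrightarrow> d' = d" for d' using gR_disjoint assms by blast
  then show ?thesis unfolding localise_comp_def using assms by blast
qed

lemma localise_comp_loc_map:
  assumes x: "x \<in> gR d" "x' \<in> gR d'" and c: "loc_compat R M x x' \<phi>"
    and \<phi>: "\<And>k m. m \<in> gM (n + int k *s d) \<Longrightarrow> \<phi> k m \<in> gM (n' + int (k + e) *s d')"
    and A: "A \<in> localise_comp R gR M gM x n"
  shows "loc_map R M x' \<phi> e A \<in> localise_comp R gR M gM x' n'"
proof -
  obtain m k where m: "m \<in> gM (n + int k *s d)" and A: "A = frac R M x m k"
    using A unfolding localise_comp_eq[OF x(1)] by blast
  have "loc_map R M x' \<phi> e A = frac R M x' (\<phi> k m) (k + e)"
    unfolding A by (rule loc_map_frac[OF _ _ c]) (use x m gRD gMD in auto)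
  then show ?thesis unfolding localise_comp_eq[OF x(2)] using \<phi>[OF m] by blast
qed

definition loc_proj :: "'a \<Rightarrow> int ^ 's \<Rightarrow> int ^ 's \<Rightarrow> ('c \<times> nat) set \<Rightarrow> ('c \<times> nat) set" where
  "loc_proj x d n = loc_map R M x (\<lambda>k. proj (n + int k *s d)) 0"

lemma loc_compat_proj:
  assumes "x \<in> gR d"
  shows "loc_compat R M x x (\<lambda>k. proj (n + int k *s d))"
  unfolding loc_compat_def
proof (intro conjI allI ballI)
  show "proj (n + int k *s d) \<in> add_hom M M" for k by (rule proj_add_hom)
  fix k j m assume m: "m \<in> carrier M"
  have "n + int (k + j) *s d = (n + int k *s d) + int j *s d" by (simp add: vec_eq_iff algebra_simps)
  then show "proj (n + int (k + j) *s d) (x [^] j \<odot>\<^bsub>M\<^esub> m) = x [^] j \<odot>\<^bsub>M\<^esub> proj (n + int k *s d) m"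
    by (simp only: proj_smult[OF pow_gR[OF assms] m])
qed

lemma loc_proj_frac:
  assumes "x \<in> gR d" "m \<in> carrier M"
  shows "loc_proj x d n (frac R M x m k) = frac R M x (proj (n + int k *s d) m) k"
  unfolding loc_proj_def
  using loc_map_frac[OF _ _ loc_compat_proj[OF assms(1)] assms(2), of n 0 k] gRD[OF assms(1)] by simp

lemma loc_proj_add_hom:
  assumes "x \<in> gR d"
  shows "loc_proj x d n \<in> add_hom (localise R M x) (localise R M x)"
  unfolding loc_proj_def
  by (rule loc_map_add_hom[OF _ _ loc_compat_proj[OF assms]]) (use gRD[OF assms] in auto)

lemma loc_proj_mem:
  assumes "x \<in> gR d" "A \<in> carrier (localise R M x)"
  shows "loc_proj x d n A \<in> localise_comp R gR M gM x n"
proof -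
  obtain m k where m: "m \<in> carrier M" "A = frac R M x m k" using assms(2) by (elim localise_cases)
  show ?thesis unfolding m(2) loc_proj_frac[OF assms(1) m(1)] localise_comp_eq[OF assms(1)]
    using proj_mem[OF m(1)] by blast
qed

lemma loc_proj_id:
  assumes "x \<in> gR d" "A \<in> localise_comp R gR M gM x n"
  shows "loc_proj x d n A = A"
proof -
  obtain m k where m: "m \<in> gM (n + int k *s d)" "A = frac R M x m k"
    using assms(2) unfolding localise_comp_eq[OF assms(1)] by blast
  show ?thesis unfolding m(2) using loc_proj_frac[OF assms(1) gMD[OF m(1)]] proj_id[OF m(1)] by simp
qed

lemma localise_comp_carrier:
  assumes "x \<in> gR d" "A \<in> localise_comp R gR M gM x n"
  shows "A \<in> carrier (localise R M x)"
  using assms(2) gMD unfolding localise_comp_eq[OF assms(1)] localise_carrier by blast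

end

section \<open>The multigraded Cech complex\<close>

locale graded_cech = graded_module R M gR gM proj
  for R :: "('a, 'b) ring_scheme" (structure) and M :: "('a, 'c, 'd) module_scheme" (structure)
    and gR :: "int ^ 's::finite \<Rightarrow> 'a set" and gM proj +
  fixes xs :: "'a list" and dg :: "nat \<Rightarrow> int ^ 's"
  assumes dg: "i < length xs \<Longrightarrow> xs ! i \<in> gR (dg i)"
begin

lemma xs: "set xs \<subseteq> carrier R"
  by (auto simp: in_set_conv_nth intro!: gRD[OF dg])

abbreviation C where "C i \<equiv> cech_cochains R M xs i"
abbreviation e where "e \<sigma> \<equiv> cech_elt R xs \<sigma>"
abbreviation Loc where "Loc \<sigma> \<equiv> localise R M (e \<sigma>)"
abbreviation Ch where "Ch i n \<equiv> cech_cochains_comp R gR M gM xs i n"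
abbreviation "D \<sigma> \<equiv> (\<Sum>i\<in>\<sigma>. dg i)"

lemma cech_elt_gR:
  assumes "\<sigma> \<subseteq> {..<length xs}"
  shows "e \<sigma> \<in> gR (D \<sigma>)"
proof -
  have "finite \<sigma>" using assms finite_subset by blast
  then show ?thesis using assms
  proof (induct \<sigma>)
    case empty
    then show ?case using one_gR by (simp add: cech_elt_empty)
  next
    case (insert i \<sigma>)
    have "e (insert i \<sigma>) = e \<sigma> \<otimes> xs ! i"
      using cech_elt_remove[OF xs insert.prems, of i] insert.hyps(2) by simp
    moreover have "D (insert i \<sigma>) = D \<sigma> + dg i" using insert.hyps by (simp add: add.commute)
    moreover have "e \<sigma> \<otimes> xs ! i \<in> gR (D \<sigma> + dg i)"
      by (rule mult_gR) (use insert dg in auto)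
    ultimately show ?case by simp
  qed
qed

lemma cech_elt_index_gR: "\<sigma> \<in> cech_index xs i \<Longrightarrow> e \<sigma> \<in> gR (D \<sigma>)"
  by (rule cech_elt_gR[OF cech_index_subset])

lemma C_group: "abelian_group (C i)" by (rule cech_cochains_abelian_group[OF xs])

definition cproj :: "nat \<Rightarrow> int ^ 's \<Rightarrow> (nat set \<Rightarrow> ('c \<times> nat) set) \<Rightarrow> nat set \<Rightarrow> ('c \<times> nat) set" where
  "cproj i n = cochain_map xs i (\<lambda>\<sigma>. loc_proj (e \<sigma>) (D \<sigma>) n)"

lemma cproj_add_hom: "cproj i n \<in> add_hom (C i) (C i)"
  unfolding cproj_def by (rule cochain_map_add_hom[OF loc_proj_add_hom[OF cech_elt_index_gR]])

lemma Ch_carrier: "Ch i n \<subseteq> carrier (C i)"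
  unfolding cech_cochains_comp_def cech_cochains_def
  by (auto simp: PiE_iff intro: localise_comp_carrier[OF cech_elt_index_gR])

lemma cproj_mem: "c \<in> carrier (C i) \<Longrightarrow> cproj i n c \<in> Ch i n"
  unfolding cech_cochains_comp_def cech_cochains_def cproj_def cochain_map_def
  using loc_proj_mem[OF cech_elt_index_gR] by (auto simp: PiE_iff)

lemma cproj_id: "c \<in> Ch i n \<Longrightarrow> cproj i n c = c"
  unfolding cech_cochains_comp_def cproj_def cochain_map_def
  using loc_proj_id[OF cech_elt_index_gR] by (auto simp: PiE_iff extensional_def fun_eq_iff)

lemma Ch_zero: "\<zero>\<^bsub>C i\<^esub> \<in> Ch i n"
  using cproj_mem[OF abelian_monoid.zero_closed[OF abelian_group.axioms(1)[OF C_group]], of i n]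
    add_hom_zero[OF C_group C_group cproj_add_hom] by simp

lemma Ch_add: "a \<in> Ch i n \<Longrightarrow> b \<in> Ch i n \<Longrightarrow> a \<oplus>\<^bsub>C i\<^esub> b \<in> Ch i n"
proof -
  interpret G: abelian_group "C i" by (rule C_group)
  assume a: "a \<in> Ch i n" and b: "b \<in> Ch i n"
  then have ab: "a \<in> carrier (C i)" "b \<in> carrier (C i)" using Ch_carrier by auto
  have "cproj i n (a \<oplus>\<^bsub>C i\<^esub> b) = a \<oplus>\<^bsub>C i\<^esub> b"
    using add_hom_add[OF cproj_add_hom ab] cproj_id a b by simp
  then show ?thesis using cproj_mem[of "a \<oplus>\<^bsub>C i\<^esub> b" i n] ab by simp
qed

lemma Ch_a_inv: "a \<in> Ch i n \<Longrightarrow> \<ominus>\<^bsub>C i\<^esub> a \<in> Ch i n"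
proof -
  interpret G: abelian_group "C i" by (rule C_group)
  assume a: "a \<in> Ch i n"
  then have ac: "a \<in> carrier (C i)" using Ch_carrier by auto
  have "cproj i n (\<ominus>\<^bsub>C i\<^esub> a) = \<ominus>\<^bsub>C i\<^esub> a"
    using add_hom_a_inv[OF C_group C_group cproj_add_hom ac] cproj_id a by simp
  then show ?thesis using cproj_mem[of "\<ominus>\<^bsub>C i\<^esub> a" i n] ac by simp
qed

lemma Ch_minus: "a \<in> Ch i n \<Longrightarrow> b \<in> Ch i n \<Longrightarrow> a \<ominus>\<^bsub>C i\<^esub> b \<in> Ch i n"
  unfolding a_minus_def by (intro Ch_add Ch_a_inv)

text \<open>The projection of m / e^k depends on the degree of the denominator. Passing from \<tau>
  - {j} to \<tau> raises that degree by k \<open>dg j\<close>, which is the degree of the factor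
  x_j^k gained by the numerator.\<close>

lemma cech_diff_cproj:
  assumes c: "c \<in> carrier (C i)"
  shows "cech_diff R M xs i (cproj i n c) = cproj (Suc i) n (cech_diff R M xs i c)"
  unfolding cproj_def
proof (rule cech_diff_cochain_map[OF xs loc_proj_add_hom[OF cech_elt_index_gR] _ c])
  fix \<tau> j A assume \<tau>: "\<tau> \<in> cech_index xs (Suc i)" "j \<in> \<tau>" and A: "A \<in> carrier (Loc (\<tau> - {j}))"
  note s = cech_index_subset[OF \<tau>(1)]
  have fin: "finite \<tau>" using s finite_subset by blast
  obtain m k where m: "m \<in> carrier M" and A: "A = frac R M (e (\<tau> - {j})) m k" using A by (elim localise_cases)
  have xj: "xs ! j \<in> gR (dg j)" using s \<tau> dg by auto
  have "D \<tau> = D (\<tau> - {j}) + dg j" using fin \<tau>(2) by (simp add: sum.remove[of \<tau> j] add.commute)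
  then have deg: "n + int k *s D \<tau> = (n + int k *s D (\<tau> - {j})) + int k *s dg j"
    by (simp add: vec_eq_iff algebra_simps)
  note e1 = cech_elt_gR[OF s] and e2 = cech_elt_index_gR[OF cech_index_remove[OF \<tau>]]
  have pm: "(xs ! j [^] k) \<odot>\<^bsub>M\<^esub> m \<in> carrier M" using m gRD[OF xj] by auto
  have "loc_proj (e \<tau>) (D \<tau>) n (localise_map R M (e (\<tau> - {j})) (xs ! j) A)
    = frac R M (e \<tau>) (proj (n + int k *s D \<tau>) ((xs ! j [^] k) \<odot>\<^bsub>M\<^esub> m)) k"
    unfolding A localise_map_frac[OF xs s \<tau>(2) m] by (rule loc_proj_frac[OF e1 pm])
  also have "proj (n + int k *s D \<tau>) ((xs ! j [^] k) \<odot>\<^bsub>M\<^esub> m)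
      = (xs ! j [^] k) \<odot>\<^bsub>M\<^esub> proj (n + int k *s D (\<tau> - {j})) m"
    unfolding deg by (rule proj_smult[OF pow_gR[OF xj] m])
  also have "frac R M (e \<tau>) \<dots> k = localise_map R M (e (\<tau> - {j})) (xs ! j) (loc_proj (e (\<tau> - {j})) (D (\<tau> - {j})) n A)"
    unfolding A loc_proj_frac[OF e2 m]
    by (rule localise_map_frac[OF xs s \<tau>(2), symmetric]) (rule gMD[OF proj_mem[OF m]])
  finally show "loc_proj (e \<tau>) (D \<tau>) n (localise_map R M (e (\<tau> - {j})) (xs ! j) A) =
    localise_map R M (e (\<tau> - {j})) (xs ! j) (loc_proj (e (\<tau> - {j})) (D (\<tau> - {j})) n A)" .
qed

lemma cech_diff_Ch:
  assumes "c \<in> Ch i n" shows "cech_diff R M xs i c \<in> Ch (Suc i) n"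
proof -
  have c: "c \<in> carrier (C i)" using assms Ch_carrier by auto
  have "cproj (Suc i) n (cech_diff R M xs i c) = cech_diff R M xs i c"
    using cech_diff_cproj[OF c, of n] unfolding cproj_id[OF assms] by simp
  then show ?thesis using cproj_mem[OF cech_diff_closed[OF xs c], of n] by simp
qed

text \<open>Multiplication by v \<sigma> / e_\<sigma>^q in the component \<sigma>. With q = 0 and v
  constant it is the action of a ring element; with q = 1 it supplies the operators of the Koszul
  homotopy, where v varies with \<sigma>.\<close>

definition act :: "nat \<Rightarrow> nat \<Rightarrow> (nat set \<Rightarrow> 'a) \<Rightarrow> (nat set \<Rightarrow> ('c \<times> nat) set) \<Rightarrow> nat set \<Rightarrow> ('c \<times> nat) set" where
  "act i q v = cochain_map xs i (\<lambda>\<sigma>. loc_map R M (e \<sigma>) (\<lambda>k m. v \<sigma> \<odot>\<^bsub>M\<^esub> m) q)"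

lemma e_closed: "\<sigma> \<in> cech_index xs i \<Longrightarrow> e \<sigma> \<in> carrier R"
  by (rule cech_elt_closed[OF xs cech_index_subset])

lemma act_add_hom:
  assumes "\<And>\<sigma>. \<sigma> \<in> cech_index xs i \<Longrightarrow> v \<sigma> \<in> carrier R"
  shows "act i q v \<in> add_hom (C i) (C i)"
  unfolding act_def
  by (rule cochain_map_add_hom[OF loc_map_add_hom[OF e_closed e_closed loc_compat_smult[OF e_closed assms]]])

lemma act_frac:
  assumes "\<sigma> \<in> cech_index xs i" "v \<sigma> \<in> carrier R" "c \<sigma> = frac R M (e \<sigma>) m k" "m \<in> carrier M"
  shows "act i q v c \<sigma> = frac R M (e \<sigma>) (v \<sigma> \<odot>\<^bsub>M\<^esub> m) (k + q)"
  using loc_map_frac[OF e_closed[OF assms(1)] e_closed[OF assms(1)] loc_compat_smult[OF e_closed[OF assms(1)] assms(2)] assms(4)]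
  by (simp add: act_def cochain_map_def assms)

lemma cochain_cases:
  assumes "c \<in> carrier (C i)" "\<sigma> \<in> cech_index xs i"
  obtains m k where "c \<sigma> = frac R M (e \<sigma>) m k" "m \<in> carrier M"
  using add_hom_closed[OF cochain_eval_add_hom[OF assms(2)] assms(1)] by (elim localise_cases)

lemma act_commute:
  assumes v: "\<And>\<sigma>. \<sigma> \<in> cech_index xs i \<Longrightarrow> v \<sigma> \<in> carrier R"
    and w: "\<And>\<sigma>. \<sigma> \<in> cech_index xs i \<Longrightarrow> w \<sigma> \<in> carrier R"
    and c: "c \<in> carrier (C i)"
  shows "act i q v (act i r w c) = act i r w (act i q v c)"
proof (rule cochain_eqI)
  note hv = add_hom_closed[OF act_add_hom[OF v]] and hw = add_hom_closed[OF act_add_hom[OF w]]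
  show "act i q v (act i r w c) \<in> carrier (C i)" by (rule hv[OF _ hw[OF _ c]])
  show "act i r w (act i q v c) \<in> carrier (C i)" by (rule hw[OF _ hv[OF _ c]])
  fix \<sigma> assume \<sigma>: "\<sigma> \<in> cech_index xs i"
  obtain m k where m: "c \<sigma> = frac R M (e \<sigma>) m k" "m \<in> carrier M" by (rule cochain_cases[OF c \<sigma>])
  have "act i q v (act i r w c) \<sigma> = frac R M (e \<sigma>) (v \<sigma> \<odot>\<^bsub>M\<^esub> (w \<sigma> \<odot>\<^bsub>M\<^esub> m)) (k + r + q)"
    by (rule act_frac[of \<sigma> i v "act i r w c", OF \<sigma> v[OF \<sigma>] act_frac[of \<sigma> i w c, OF \<sigma> w[OF \<sigma>] m]]) (use m w[OF \<sigma>] in auto)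
  also have "\<dots> = frac R M (e \<sigma>) (w \<sigma> \<odot>\<^bsub>M\<^esub> (v \<sigma> \<odot>\<^bsub>M\<^esub> m)) (k + q + r)"
    using smult_commute[OF v[OF \<sigma>] w[OF \<sigma>] m(2)] by (simp add: ac_simps)
  also have "\<dots> = act i r w (act i q v c) \<sigma>"
    by (rule act_frac[of \<sigma> i w "act i q v c", OF \<sigma> w[OF \<sigma>] act_frac[of \<sigma> i v c, OF \<sigma> v[OF \<sigma>] m], symmetric]) (use m v[OF \<sigma>] in auto)
  finally show "act i q v (act i r w c) \<sigma> = act i r w (act i q v c) \<sigma>" .
qed

text \<open>Here p is the degree of v \<sigma> / e_\<sigma>^q, which has to be the same for all
  \<sigma>.\<close>

lemma act_Ch:
  assumes v: "\<And>\<sigma>. \<sigma> \<in> cech_index xs i \<Longrightarrow> v \<sigma> \<in> gR (p + int q *s D \<sigma>)"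
    and c: "c \<in> Ch i n"
  shows "act i q v c \<in> Ch i (n + p)"
proof -
  have "act i q v c \<sigma> \<in> localise_comp R gR M gM (e \<sigma>) (n + p)" if \<sigma>: "\<sigma> \<in> cech_index xs i" for \<sigma>
  proof -
    have "loc_map R M (e \<sigma>) (\<lambda>k m. v \<sigma> \<odot>\<^bsub>M\<^esub> m) q (c \<sigma>) \<in> localise_comp R gR M gM (e \<sigma>) (n + p)"
    proof (rule localise_comp_loc_map[OF cech_elt_index_gR[OF \<sigma>] cech_elt_index_gR[OF \<sigma>]
          loc_compat_smult[OF e_closed[OF \<sigma>] gRD[OF v[OF \<sigma>]]]])
      fix k m assume "m \<in> gM (n + int k *s D \<sigma>)"
      then have "v \<sigma> \<odot>\<^bsub>M\<^esub> m \<in> gM (n + int k *s D \<sigma> + (p + int q *s D \<sigma>))" by (rule smult_gM[OF v[OF \<sigma>]])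
      moreover have "n + int k *s D \<sigma> + (p + int q *s D \<sigma>) = n + p + int (k + q) *s D \<sigma>"
        by (simp add: vec_eq_iff algebra_simps)
      ultimately show "v \<sigma> \<odot>\<^bsub>M\<^esub> m \<in> gM (n + p + int (k + q) *s D \<sigma>)" by simp
    qed (use c \<sigma> in \<open>auto simp: cech_cochains_comp_def\<close>)
    then show ?thesis using \<sigma> by (simp add: act_def cochain_map_def)
  qed
  then show ?thesis by (auto simp: cech_cochains_comp_def act_def cochain_map_def)
qed

lemma cech_diff_act:
  assumes w: "w \<in> carrier R" and c: "c \<in> carrier (C i)"
  shows "cech_diff R M xs i (act i 0 (\<lambda>\<sigma>. w) c) = act (Suc i) 0 (\<lambda>\<sigma>. w) (cech_diff R M xs i c)"
  unfolding act_def
proof (rule cech_diff_cochain_map[OF xs _ _ c])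
  show "loc_map R M (e \<sigma>) (\<lambda>k m. w \<odot>\<^bsub>M\<^esub> m) 0 \<in> add_hom (Loc \<sigma>) (Loc \<sigma>)" if "\<sigma> \<in> cech_index xs j" for j \<sigma>
    by (rule loc_map_add_hom[OF e_closed[OF that] e_closed[OF that] loc_compat_smult[OF e_closed[OF that] w]])
  fix \<tau> j A assume \<tau>: "\<tau> \<in> cech_index xs (Suc i)" "j \<in> \<tau>" and A: "A \<in> carrier (Loc (\<tau> - {j}))"
  note s = cech_index_subset[OF \<tau>(1)]
  obtain m k where m: "m \<in> carrier M" and A: "A = frac R M (e (\<tau> - {j})) m k" using A by (elim localise_cases)
  have xj: "xs ! j \<in> carrier R" using s \<tau> dg gRD by blast
  note e1 = e_closed[OF \<tau>(1)] and e2 = e_closed[OF cech_index_remove[OF \<tau>]]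
  have pm: "(xs ! j [^] k) \<odot>\<^bsub>M\<^esub> m \<in> carrier M" using m xj by auto
  have wm: "w \<odot>\<^bsub>M\<^esub> m \<in> carrier M" using m w by auto
  have "loc_map R M (e \<tau>) (\<lambda>k m. w \<odot>\<^bsub>M\<^esub> m) 0 (localise_map R M (e (\<tau> - {j})) (xs ! j) A)
    = frac R M (e \<tau>) (w \<odot>\<^bsub>M\<^esub> ((xs ! j [^] k) \<odot>\<^bsub>M\<^esub> m)) k"
    unfolding A localise_map_frac[OF xs s \<tau>(2) m]
    using loc_map_frac[OF e1 e1 loc_compat_smult[OF e1 w] pm, of 0] by simp
  also have "\<dots> = frac R M (e \<tau>) ((xs ! j [^] k) \<odot>\<^bsub>M\<^esub> (w \<odot>\<^bsub>M\<^esub> m)) k"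
    using smult_commute[OF w _ m, of "xs ! j [^] k"] xj by simp
  also have "\<dots> = localise_map R M (e (\<tau> - {j})) (xs ! j) (frac R M (e (\<tau> - {j})) (w \<odot>\<^bsub>M\<^esub> m) k)"
    by (rule localise_map_frac[OF xs s \<tau>(2) wm, symmetric])
  also have "frac R M (e (\<tau> - {j})) (w \<odot>\<^bsub>M\<^esub> m) k = loc_map R M (e (\<tau> - {j})) (\<lambda>k m. w \<odot>\<^bsub>M\<^esub> m) 0 A"
    unfolding A using loc_map_frac[OF e2 e2 loc_compat_smult[OF e2 w] m, of 0] by simp
  finally show "loc_map R M (e \<tau>) (\<lambda>k m. w \<odot>\<^bsub>M\<^esub> m) 0 (localise_map R M (e (\<tau> - {j})) (xs ! j) A)
    = localise_map R M (e (\<tau> - {j})) (xs ! j) (loc_map R M (e (\<tau> - {j})) (\<lambda>k m. w \<odot>\<^bsub>M\<^esub> m) 0 A)" .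
qed

text \<open>On fractions the composites add up to multiplication by (\<Sum> w_l v_l) / e_\<sigma>,
  which is the identity as soon as the numerator equals e_\<sigma>.\<close>

lemma sum_comp_act:
  assumes "length ws = length vs" "set ws \<subseteq> carrier R" "c \<in> carrier (C i)"
    and "\<And>v \<sigma>. v \<in> set vs \<Longrightarrow> \<sigma> \<in> cech_index xs i \<Longrightarrow> v \<sigma> \<in> carrier R"
    and \<sigma>: "\<sigma> \<in> cech_index xs i" and m: "c \<sigma> = frac R M (e \<sigma>) m k" "m \<in> carrier M"
  shows "sum_comp (C i) (map (\<lambda>w. act i 0 (\<lambda>\<sigma>. w)) ws) (map (act i 1) vs) c \<sigma>
    = frac R M (e \<sigma>) (dot R ws (map (\<lambda>v. v \<sigma>) vs) \<odot>\<^bsub>M\<^esub> m) (k + 1)"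
  using assms(1,2,4)
proof (induct ws vs rule: list_induct2)
  case Nil
  then show ?case
    using \<sigma> m frac_zero[OF e_closed[OF \<sigma>], of "Suc k"]
    by (simp add: cochain_zero_apply localise_zero)
next
  case (Cons w ws v vs)
  interpret G: abelian_group "C i" by (rule C_group)
  have w: "w \<in> carrier R" and v: "v \<sigma> \<in> carrier R" if "\<sigma> \<in> cech_index xs i" for \<sigma>
    using Cons.prems that by auto
  note v\<sigma> = v[OF \<sigma>]
  let ?xs = "map (\<lambda>w. act i 0 (\<lambda>\<sigma>. w)) ws" and ?ys = "map (act i 1) vs"
  let ?d = "dot R ws (map (\<lambda>v. v \<sigma>) vs)"
  have hx: "set ?xs \<subseteq> add_hom (C i) (C i)" using Cons.prems by (auto intro!: act_add_hom)
  have hy: "set ?ys \<subseteq> add_hom (C i) (C i)" using Cons.prems(2) by (auto intro!: act_add_hom)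
  have ac: "act i 0 (\<lambda>\<sigma>. w) (act i 1 v c) \<in> carrier (C i)"
    by (rule add_hom_closed[OF act_add_hom add_hom_closed[OF act_add_hom assms(3)]]) (use w v in auto)
  have sc: "sum_comp (C i) ?xs ?ys c \<in> carrier (C i)" by (rule G.sum_comp_closed[OF hx hy assms(3)])
  have d: "?d \<in> carrier R" using Cons.prems \<sigma> by (intro R.dot_closed) auto
  have IH: "sum_comp (C i) ?xs ?ys c \<sigma> = frac R M (e \<sigma>) (?d \<odot>\<^bsub>M\<^esub> m) (k + 1)"
    by (rule Cons.hyps(2)) (use Cons.prems in auto)
  have A: "act i 0 (\<lambda>\<sigma>. w) (act i 1 v c) \<sigma> = frac R M (e \<sigma>) (w \<odot>\<^bsub>M\<^esub> (v \<sigma> \<odot>\<^bsub>M\<^esub> m)) (k + 1)"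
    using act_frac[of \<sigma> i "\<lambda>\<sigma>. w" "act i 1 v c", OF \<sigma> w[OF \<sigma>] act_frac[of \<sigma> i v c, OF \<sigma> v\<sigma> m]] m v\<sigma> by simp
  note e\<sigma> = e_closed[OF \<sigma>]
  have "sum_comp (C i) (map (\<lambda>w. act i 0 (\<lambda>\<sigma>. w)) (w # ws)) (map (act i 1) (v # vs)) c \<sigma>
     = act i 0 (\<lambda>\<sigma>. w) (act i 1 v c) \<sigma> \<oplus>\<^bsub>Loc \<sigma>\<^esub> sum_comp (C i) ?xs ?ys c \<sigma>"
    using add_hom_add[OF cochain_eval_add_hom[OF \<sigma>] ac sc] by simp
  \<comment> \<open>Both summands have the exponent k + 1, so the addition formula produces a factor
    e_\<sigma>^(k + 1), which is cancelled afterwards.\<close>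
  also have "\<dots> = frac R M (e \<sigma>) ((e \<sigma> [^] (k + 1)) \<odot>\<^bsub>M\<^esub> (w \<odot>\<^bsub>M\<^esub> (v \<sigma> \<odot>\<^bsub>M\<^esub> m) \<oplus>\<^bsub>M\<^esub> ?d \<odot>\<^bsub>M\<^esub> m)) (k + 1 + (k + 1))"
    unfolding A IH using localise_add[OF e\<sigma>, of "w \<odot>\<^bsub>M\<^esub> (v \<sigma> \<odot>\<^bsub>M\<^esub> m)" "?d \<odot>\<^bsub>M\<^esub> m" "k + 1" "k + 1"]
      w[OF \<sigma>] v\<sigma> m d e\<sigma> by (simp add: smult_r_distr del: R.nat_pow_Suc)
  also have "\<dots> = frac R M (e \<sigma>) (w \<odot>\<^bsub>M\<^esub> (v \<sigma> \<odot>\<^bsub>M\<^esub> m) \<oplus>\<^bsub>M\<^esub> ?d \<odot>\<^bsub>M\<^esub> m) (k + 1)"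
    by (rule frac_scale[OF e\<sigma>]) (use w[OF \<sigma>] v\<sigma> m d in auto)
  also have "w \<odot>\<^bsub>M\<^esub> (v \<sigma> \<odot>\<^bsub>M\<^esub> m) \<oplus>\<^bsub>M\<^esub> ?d \<odot>\<^bsub>M\<^esub> m = dot R (w # ws) (map (\<lambda>v. v \<sigma>) (v # vs)) \<odot>\<^bsub>M\<^esub> m"
    using w[OF \<sigma>] v\<sigma> m d by (simp add: smult_l_distr smult_assoc1)
  finally show ?case .
qed

end

section \<open>The Koszul-Cech double complex\<close>

context graded_cech
begin

text \<open>One factor xs ! i of the product suffices: the coefficients in its expression through ws
  are multiplied by the remaining factors. A factor exists because \<sigma> is nonempty.\<close>

lemma cech_elt_dot:
  assumes dec: "\<And>i. i < length xs \<Longrightarrow>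
      \<exists>ys. length ys = length ws \<and> set ys \<subseteq> gR (dg i - \<delta>) \<and> dot R ws ys = xs ! i"
    and ws: "set ws \<subseteq> carrier R" and \<sigma>: "\<sigma> \<subseteq> {..<length xs}" "\<sigma> \<noteq> {}"
  shows "\<exists>ys. length ys = length ws \<and> set ys \<subseteq> gR (D \<sigma> - \<delta>) \<and> dot R ws ys = e \<sigma>"
proof -
  obtain i where i: "i \<in> \<sigma>" using \<sigma> by auto
  then obtain ys where ys: "length ys = length ws" "set ys \<subseteq> gR (dg i - \<delta>)" "dot R ws ys = xs ! i"
    using dec[of i] \<sigma> by auto
  have fin: "finite \<sigma>" using \<sigma> finite_subset by blast
  have e': "e (\<sigma> - {i}) \<in> gR (D (\<sigma> - {i}))" by (rule cech_elt_gR) (use \<sigma> in auto)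
  have xi: "xs ! i \<in> carrier R" using dg i \<sigma> gRD by blast
  let ?zs = "map (\<lambda>y. y \<otimes> e (\<sigma> - {i})) ys"
  have ysc: "set ys \<subseteq> carrier R" using ys(2) gRD by blast
  have "dot R ws ?zs = dot R ws ys \<otimes> e (\<sigma> - {i})"
    by (rule R.dot_mult[symmetric]) (use ys ws ysc gRD[OF e'] in auto)
  also have "\<dots> = e \<sigma>"
    using cech_elt_remove[OF xs \<sigma>(1) i] ys(3) R.m_comm[OF xi gRD[OF e']] by simp
  finally have "dot R ws ?zs = e \<sigma>" .
  moreover have "set ?zs \<subseteq> gR (D \<sigma> - \<delta>)"
  proof -
    have eq: "D \<sigma> - \<delta> = (dg i - \<delta>) + D (\<sigma> - {i})" using fin i by (simp add: sum.remove[of \<sigma> i])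
    show ?thesis unfolding eq set_map using mult_gR[OF _ e'] ys(2) by blast
  qed
  ultimately show ?thesis using ys(1) by (intro exI[of _ ?zs]) auto
qed

text \<open>The list ws provides the Koszul operators. By \<open>dec\<close> every Cech generator is
  a combination of ws with coefficients of the complementary degree, which gives the exact rows;
  \<open>coh\<close> is the diagonal part of the column cohomology that the chase requires.\<close>

theorem graded_vanishing:
  assumes ws: "set ws \<subseteq> gR \<delta>"
    and dec: "\<And>i. i < length xs \<Longrightarrow>
      \<exists>ys. length ys = length ws \<and> set ys \<subseteq> gR (dg i - \<delta>) \<and> dot R ws ys = xs ! i"
    and coh: "\<And>i b. b \<in> cech_cocycles R M xs i \<Longrightarrow> b \<in> Ch i (c - int i *s \<delta>)
      \<Longrightarrow> b \<in> cech_coboundaries R M xs i"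
    and start: "gM (c - \<delta>) = {\<zero>\<^bsub>M\<^esub>}"
  shows "gM c = {\<zero>\<^bsub>M\<^esub>}"
proof -
  have wsc: "set ws \<subseteq> carrier R" using ws gRD by blast
  let ?r = "length ws"
  have "\<exists>Y. \<forall>\<sigma>. \<sigma> \<subseteq> {..<length xs} \<longrightarrow> \<sigma> \<noteq> {} \<longrightarrow>
      length (Y \<sigma>) = ?r \<and> set (Y \<sigma>) \<subseteq> gR (D \<sigma> - \<delta>) \<and> dot R ws (Y \<sigma>) = e \<sigma>"
    using cech_elt_dot[OF dec wsc] by (intro choice) blast
  then obtain Y where Y: "\<And>\<sigma>. \<sigma> \<subseteq> {..<length xs} \<Longrightarrow> \<sigma> \<noteq> {} \<Longrightarrow>
      length (Y \<sigma>) = ?r \<and> set (Y \<sigma>) \<subseteq> gR (D \<sigma> - \<delta>) \<and> dot R ws (Y \<sigma>) = e \<sigma>" by blast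
  \<comment> \<open>Transposes Y: the l-th entry collects the l-th coefficients for all \<sigma>, so
    that \<open>act\<close> turns it into a single operator on cochains.\<close>
  define vs where "vs = map (\<lambda>l \<sigma>. Y \<sigma> ! l) [0..<?r]"
  have lvs: "length vs = ?r" by (simp add: vs_def)
  have Y': "length (Y \<sigma>) = ?r \<and> set (Y \<sigma>) \<subseteq> gR (D \<sigma> - \<delta>) \<and> dot R ws (Y \<sigma>) = e \<sigma>"
    if "\<sigma> \<in> cech_index xs (Suc i)" for \<sigma> i
    by (rule Y) (use that in \<open>auto simp: cech_index_def\<close>)
  have vsY: "map (\<lambda>v. v \<sigma>) vs = Y \<sigma>" if "\<sigma> \<in> cech_index xs (Suc i)" for \<sigma> i
  proof -
    have "map (\<lambda>v. v \<sigma>) vs = map (\<lambda>l. Y \<sigma> ! l) [0..<length (Y \<sigma>)]"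
      using Y'[OF that] by (simp add: vs_def comp_def)
    then show ?thesis by (simp only: map_nth)
  qed
  \<comment> \<open>Written so that \<open>act_Ch\<close> reads off the degree - \<delta> of v
    \<sigma> / e_\<sigma>.\<close>
  have vgR: "v \<sigma> \<in> gR (- \<delta> + int 1 *s D \<sigma>)" if "v \<in> set vs" "\<sigma> \<in> cech_index xs (Suc i)" for v \<sigma> i
  proof -
    have "v \<sigma> \<in> set (map (\<lambda>v. v \<sigma>) vs)" using that(1) by auto
    then have "v \<sigma> \<in> gR (D \<sigma> - \<delta>)" unfolding vsY[OF that(2)] using Y'[OF that(2)] by blast
    moreover have "D \<sigma> - \<delta> = - \<delta> + int 1 *s D \<sigma>" by (simp add: vec_eq_iff)
    ultimately show ?thesis by (simp only:)
  qed
  have vc: "v \<sigma> \<in> carrier R" if "v \<in> set vs" "\<sigma> \<in> cech_index xs (Suc i)" for v \<sigma> i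
    by (rule gRD[OF vgR[OF that]])
  \<comment> \<open>X are the Koszul operators, of degree \<delta>; Z are the homotopy operators, of
    degree - \<delta>.\<close>
  define X where "X i = map (\<lambda>w. act i 0 (\<lambda>\<sigma>. w)) ws" for i
  define Z where "Z i = map (act i 1) vs" for i
  have lX: "length (X i) = ?r" and lZ: "length (Z i) = ?r" for i by (simp_all add: X_def Z_def lvs)
  have hX: "set (X i) \<subseteq> add_hom (C i) (C i)" for i
    unfolding X_def using wsc by (auto intro!: act_add_hom)
  \<comment> \<open>Restricted to positive Cech degree, since Y is constrained at nonempty \<sigma>
    only.\<close>
  have hZ: "set (Z (Suc i)) \<subseteq> add_hom (C (Suc i)) (C (Suc i))" for i
    unfolding Z_def using vc by (auto intro!: act_add_hom)
  have XX: "x (y a) = y (x a)" if "x \<in> set (X i)" "y \<in> set (X i)" "a \<in> carrier (C i)" for i x y a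
  proof -
    note xy = that(1,2)
    obtain w w' where w: "w \<in> set ws" "x = act i 0 (\<lambda>\<sigma>. w)" "w' \<in> set ws" "y = act i 0 (\<lambda>\<sigma>. w')"
      using xy by (auto simp: X_def)
    show ?thesis unfolding w(2,4) by (rule act_commute[OF _ _ that(3)]) (use w wsc in auto)
  qed
  have XZ: "x (y a) = y (x a)" if "x \<in> set (X (Suc i))" "y \<in> set (Z (Suc i))" "a \<in> carrier (C (Suc i))" for i x y a
  proof -
    note xy = that(1,2)
    obtain w v where w: "w \<in> set ws" "x = act (Suc i) 0 (\<lambda>\<sigma>. w)" "v \<in> set vs" "y = act (Suc i) 1 v"
      using xy by (auto simp: X_def Z_def)
    show ?thesis unfolding w(2,4)
      by (rule act_commute[OF _ _ that(3)]) (use w(1) wsc in blast, rule vc[OF w(3)])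
  qed
  have Xdeg: "x a \<in> Ch i (n + \<delta>)" if "x \<in> set (X i)" "a \<in> Ch i n" for x a i n
  proof -
    note x = that(1)
    obtain w where w: "w \<in> set ws" "x = act i 0 (\<lambda>\<sigma>. w)" using x by (auto simp: X_def)
    have "w \<in> gR (\<delta> + int 0 *s D \<sigma>)" for \<sigma>
    proof -
      have "\<delta> + int 0 *s D \<sigma> = \<delta>" by (simp add: vec_eq_iff)
      then show ?thesis using w ws by auto
    qed
    then show ?thesis unfolding w(2) by (rule act_Ch[OF _ that(2)])
  qed
  have Zdeg: "y a \<in> Ch (Suc i) (n + - \<delta>)" if "y \<in> set (Z (Suc i))" "a \<in> Ch (Suc i) n" for y a i n
  proof -
    note y = that(1)
    obtain v where v: "v \<in> set vs" "y = act (Suc i) 1 v" using y by (auto simp: Z_def)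
    show ?thesis unfolding v(2) by (rule act_Ch[OF vgR[OF v(1)] that(2)])
  qed
  \<comment> \<open>In each component the sum of w_l v_l / e_\<sigma> is e_\<sigma> / e_\<sigma> =
    1.\<close>
  have sc: "sum_comp (C (Suc i)) (X (Suc i)) (Z (Suc i)) a = a" if a: "a \<in> carrier (C (Suc i))" for a i
  proof (rule cochain_eqI[OF _ a])
    show "sum_comp (C (Suc i)) (X (Suc i)) (Z (Suc i)) a \<in> carrier (C (Suc i))"
      by (rule abelian_group.sum_comp_closed[OF C_group hX hZ a])
    fix \<sigma> assume \<sigma>: "\<sigma> \<in> cech_index xs (Suc i)"
    obtain m k where m: "a \<sigma> = frac R M (e \<sigma>) m k" "m \<in> carrier M" by (rule cochain_cases[OF a \<sigma>])
    have "sum_comp (C (Suc i)) (X (Suc i)) (Z (Suc i)) a \<sigma>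
       = frac R M (e \<sigma>) (dot R ws (map (\<lambda>v. v \<sigma>) vs) \<odot>\<^bsub>M\<^esub> m) (k + 1)"
      unfolding X_def Z_def by (rule sum_comp_act[where c = a and \<sigma> = \<sigma>, OF lvs[symmetric] wsc a _ \<sigma> m]) (rule vc)
    also have "\<dots> = frac R M (e \<sigma>) ((e \<sigma> [^] (1::nat)) \<odot>\<^bsub>M\<^esub> m) (k + 1)"
      unfolding vsY[OF \<sigma>] using Y'[OF \<sigma>] e_closed[OF \<sigma>] by simp
    also have "\<dots> = a \<sigma>" unfolding m(1) by (rule frac_scale[OF e_closed[OF \<sigma>] m(2)])
    finally show "sum_comp (C (Suc i)) (X (Suc i)) (Z (Suc i)) a \<sigma> = a \<sigma>" .
  qed
  \<comment> \<open>The values permitted at an index with k entries \<open>True\<close>: a chain of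
    Koszul degree l is supported on k = l and is zero elsewhere.\<close>
  define A where "A i l k = (if k = l then Ch i (c - int l *s \<delta>) else {\<zero>\<^bsub>C i\<^esub>})" for i l k :: nat
  define T where "T i l = {v. \<forall>L. v L \<in> A i l (count_list L True) \<and> (length L \<noteq> ?r \<longrightarrow> v L = \<zero>\<^bsub>C i\<^esub>)}" for i l
  have A0: "\<zero>\<^bsub>C i\<^esub> \<in> A i l k" for i l k using Ch_zero by (auto simp: A_def)
  have AC: "a \<in> carrier (C i)" if "a \<in> A i l k" for a i l k
    using that Ch_carrier[of i "c - int l *s \<delta>"] Ch_zero[of i "c - int l *s \<delta>"]
    by (auto simp: A_def split: if_splits)
  have TC: "v L \<in> carrier (C i)" if "v \<in> T i l" for v L i l
    using that AC unfolding T_def by blast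
  have TA: "v L \<in> A i l (count_list L True)" and T0: "length L \<noteq> ?r \<Longrightarrow> v L = \<zero>\<^bsub>C i\<^esub>"
    if "v \<in> T i l" for v L i l using that unfolding T_def by blast+
  have TI: "v \<in> T i l" if "\<And>L. v L \<in> A i l (count_list L True)" "\<And>L. length L \<noteq> ?r \<Longrightarrow> v L = \<zero>\<^bsub>C i\<^esub>"
    for v i l using that unfolding T_def by blast
  have Aadd: "a \<oplus>\<^bsub>C i\<^esub> b \<in> A i l k" and Ainv: "\<ominus>\<^bsub>C i\<^esub> a \<in> A i l k" and Aminus: "a \<ominus>\<^bsub>C i\<^esub> b \<in> A i l k"
    if "a \<in> A i l k" "b \<in> A i l k" for a b i l k
  proof -
    interpret G: abelian_group "C i" by (rule C_group)
    show "a \<oplus>\<^bsub>C i\<^esub> b \<in> A i l k" "\<ominus>\<^bsub>C i\<^esub> a \<in> A i l k" "a \<ominus>\<^bsub>C i\<^esub> b \<in> A i l k"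
      using that Ch_add Ch_a_inv Ch_minus by (auto simp: A_def G.a_inv_zero G.minus_eq split: if_splits)
  qed
  have deg1: "c - int (Suc l) *s \<delta> + \<delta> = c - int l *s \<delta>" for l by (simp add: vec_eq_iff algebra_simps)
  have deg2: "c - int l *s \<delta> + - \<delta> = c - int (Suc l) *s \<delta>" for l by (simp add: vec_eq_iff algebra_simps)
  have Xzero: "x \<zero>\<^bsub>C i\<^esub> = \<zero>\<^bsub>C i\<^esub>" if "x \<in> set (X i)" for x i
    by (rule add_hom_zero[OF C_group C_group]) (use that hX in blast)
  have Zzero: "x \<zero>\<^bsub>C (Suc i)\<^esub> = \<zero>\<^bsub>C (Suc i)\<^esub>" if "x \<in> set (Z (Suc i))" for x i
    by (rule add_hom_zero[OF C_group C_group]) (use that hZ in blast)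
  have XA: "x a \<in> A i l k" if "x \<in> set (X i)" "a \<in> A i (Suc l) (Suc k)" for x a i l k
    using that Xdeg[OF that(1), of a "c - int (Suc l) *s \<delta>"] Xzero[OF that(1)]
    unfolding deg1 by (auto simp: A_def split: if_splits)
  have XA0: "x a \<in> {\<zero>\<^bsub>C i\<^esub>}" if "x \<in> set (X i)" "a \<in> A i 0 (Suc k)" for x a i k
    using that Xzero[OF that(1)] by (auto simp: A_def)
  have ZA: "x a \<in> A (Suc i) (Suc l) (Suc k)" if "x \<in> set (Z (Suc i))" "a \<in> A (Suc i) l k" for x a i l k
    using that Zdeg[OF that(1), of a "c - int l *s \<delta>"] Zzero[OF that(1)]
    unfolding deg2 by (auto simp: A_def split: if_splits)
  let ?d = "\<lambda>i v L. cech_diff R M xs i (v L)"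
  let ?b = "\<lambda>i. koszul (C i) (X i)"
  let ?sub = "\<lambda>i v w L. v L \<ominus>\<^bsub>C i\<^esub> w L"
  let ?z = "\<lambda>i (L::bool list). \<zero>\<^bsub>C i\<^esub>"
  have d0: "cech_diff R M xs i \<zero>\<^bsub>C i\<^esub> = \<zero>\<^bsub>C (Suc i)\<^esub>" for i
    by (rule add_hom_zero[OF C_group C_group cech_diff_add_hom[OF xs]])
  have dA: "cech_diff R M xs i a \<in> A (Suc i) l k" if "a \<in> A i l k" for a i l k
    using that cech_diff_Ch[of a i "c - int l *s \<delta>"] d0 by (auto simp: A_def split: if_splits)
  have vanish: "u = ?z 0" if u: "u \<in> T 0 0" for u
  \<comment> \<open>There are no Cech cochains beyond the number of generators, hence the bound
    \<open>length xs\<close>.\<close>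
  proof (rule double_complex_chase[where T = T and d = ?d and b = ?b and sub = ?sub and z = ?z and N = "length xs"])
    show "u \<in> T 0 0" by fact
  next
    fix i l v assume v: "v \<in> T i l"
    show "?d i v \<in> T (Suc i) l"
    proof (rule TI)
      show "cech_diff R M xs i (v L) \<in> A (Suc i) l (count_list L True)" for L by (rule dA[OF TA[OF v]])
      show "cech_diff R M xs i (v L) = \<zero>\<^bsub>C (Suc i)\<^esub>" if "length L \<noteq> ?r" for L
        unfolding T0[OF v that] by (rule d0)
    qed
    show "?d (Suc i) (?d i v) = ?z (Suc (Suc i))"
      using cech_diff_cech_diff[OF xs TC[OF v]] by auto
    show "?b i (?b i v) = ?z i"
      by (rule ext, rule abelian_group.koszul_koszul[OF C_group hX]) (use TC[OF v] XX in blast)+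
    show "?d i (?b i v) = ?b (Suc i) (?d i v)"
    proof (rule ext, rule abelian_group.koszul_hom[OF C_group C_group cech_diff_add_hom[OF xs] _ hX, symmetric])
      show "list_all2 (\<lambda>x x'. \<forall>a\<in>carrier (C i). cech_diff R M xs i (x a) = x' (cech_diff R M xs i a)) (X i) (X (Suc i))"
        unfolding X_def list_all2_map1 list_all2_map2 list_all2_same using cech_diff_act wsc by blast
    qed (rule TC[OF v])
    show "?sub i v v = ?z i"
      using TC[OF v] abelian_group.r_neg[OF C_group] by (auto simp: a_minus_def)
    show "?sub i v (?z i) = v"
    proof
      interpret G: abelian_group "C i" by (rule C_group)
      fix L show "v L \<ominus>\<^bsub>C i\<^esub> \<zero>\<^bsub>C i\<^esub> = v L" using TC[OF v] by (simp add: G.minus_eq G.a_inv_zero)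
    qed
    fix w assume w: "w \<in> T i l"
    show "?sub i v w \<in> T i l"
    proof (rule TI)
      interpret G: abelian_group "C i" by (rule C_group)
      show "v L \<ominus>\<^bsub>C i\<^esub> w L \<in> A i l (count_list L True)" for L by (rule Aminus[OF TA[OF v] TA[OF w]])
      show "v L \<ominus>\<^bsub>C i\<^esub> w L = \<zero>\<^bsub>C i\<^esub>" if "length L \<noteq> ?r" for L
        using T0[OF v that] T0[OF w that] by (simp add: G.minus_eq G.a_inv_zero)
    qed
    show "?d i (?sub i v w) = ?sub (Suc i) (?d i v) (?d i w)"
      using add_hom_minus[OF C_group C_group cech_diff_add_hom[OF xs] TC[OF v] TC[OF w]] by auto
    show "?b i (?sub i v w) = ?sub i (?b i v) (?b i w)"
      by (rule ext, rule abelian_group.koszul_minus[OF C_group hX TC[OF v] TC[OF w]])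
  next
    fix i l v assume v: "v \<in> T i (Suc l)"
    show "?b i v \<in> T i l"
    proof (rule TI)
      show "?b i v L \<in> A i l (count_list L True)" for L
        by (rule abelian_group.koszul_graded[OF C_group, where A = "A i (Suc l)"])
          (use A0 Aadd Ainv XA TA[OF v] in blast)+
      show "?b i v L = \<zero>\<^bsub>C i\<^esub>" if "length L \<noteq> ?r" for L
        by (rule abelian_group.koszul_length[OF C_group _ hX]) (use that lX T0[OF v] in auto)
    qed
  next
    fix i v assume v: "v \<in> T i 0"
    interpret G: abelian_group "C i" by (rule C_group)
    show "?b i v = ?z i"
    proof
      fix L
      have "?b i v L \<in> (\<lambda>k. {\<zero>\<^bsub>C i\<^esub>}) (count_list L True)"
        by (rule G.koszul_graded[where A = "A i 0"]) (use XA0 TA[OF v] G.a_inv_zero in auto)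
      then show "?b i v L = \<zero>\<^bsub>C i\<^esub>" by simp
    qed
  next
    fix i
    interpret G: abelian_group "C i" by (rule C_group)
    show "?b i (?z i) = ?z i"
    proof
      fix L
      have "?b i (?z i) L \<in> (\<lambda>k. {\<zero>\<^bsub>C i\<^esub>}) (count_list L True)"
        by (rule G.koszul_graded[where A = "\<lambda>k. {\<zero>\<^bsub>C i\<^esub>}"]) (use Xzero G.a_inv_zero in auto)
      then show "?b i (?z i) L = \<zero>\<^bsub>C i\<^esub>" by simp
    qed
  next
    fix i l v assume i: "1 \<le> i" and v: "v \<in> T i l" and bv: "?b i v = ?z i"
    obtain j where j: "i = Suc j" using i by (cases i) auto
    interpret G: abelian_group "C i" by (rule C_group)
    \<comment> \<open>As b v = 0, the homotopy identity reduces to b h v = (\<Sum> x_l y_l) v =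
      v.\<close>
    let ?w = "koszul_homotopy (C i) (Z i) v"
    have hZi: "set (Z i) \<subseteq> add_hom (C i) (C i)" unfolding j by (rule hZ)
    have w: "?w \<in> T i (Suc l)"
    proof (rule TI)
      show "?w L \<in> A i (Suc l) (count_list L True)" for L
        by (rule G.koszul_homotopy_graded[where A = "A i l"])
          (use A0 Aminus TA[OF v] ZA[of _ j] in \<open>auto simp: j\<close>)
      show "?w L = \<zero>\<^bsub>C i\<^esub>" if "length L \<noteq> ?r" for L
        by (rule G.koszul_homotopy_length[OF _ hZi]) (use that lZ T0[OF v] in auto)
    qed
    have z: "koszul_homotopy (C i) (Z i) (?z i) L = \<zero>\<^bsub>C i\<^esub>" for L
    proof -
      have "koszul_homotopy (C i) (Z i) (?z i) L \<in> (\<lambda>k. {\<zero>\<^bsub>C i\<^esub>}) (count_list L True)"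
        by (rule G.koszul_homotopy_graded[where A = "\<lambda>k. {\<zero>\<^bsub>C i\<^esub>}"])
          (use Zzero[of _ j] in \<open>auto simp: j[symmetric] G.minus_eq G.a_inv_zero\<close>)
      then show ?thesis by simp
    qed
    have "?b i ?w = v"
    proof
      fix L
      show "?b i ?w L = v L"
      proof (cases "length L = ?r")
        case True
        have cl: "?b i ?w L \<in> carrier (C i)" by (rule G.koszul_closed[OF hX TC[OF w]])
        have "?b i ?w L \<oplus>\<^bsub>C i\<^esub> koszul_homotopy (C i) (Z i) (?b i v) L = sum_comp (C i) (X i) (Z i) (v L)"
        proof (rule G.koszul_homotopy_koszul[OF _ hX hZi TC[OF v]])
          show "x (y a) = y (x a)" if "x \<in> set (X i)" "y \<in> set (Z i)" "a \<in> carrier (C i)" for x y a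
            using XZ[of x j y a] that by (simp add: j)
        qed (use True lX lZ in auto)
        then show ?thesis unfolding bv z using sc[of "v L" j] TC[OF v] cl by (simp add: j[symmetric])
      next
        case False
        then show ?thesis using T0[OF v] G.koszul_length[of L "X i" ?w] lX hX T0[OF w] by simp
      qed
    qed
    then show "\<exists>w\<in>T i (Suc l). ?b i w = v" using w by blast
  next
    fix i v assume v: "v \<in> T (Suc i) (Suc i)" and dv: "?d (Suc i) v = ?z (Suc (Suc i))"
    \<comment> \<open>Primitives are chosen separately for every index L, and as zero off the
      support of the chains.\<close>
    have "\<exists>w. w \<in> A i (Suc i) (count_list L True) \<and> cech_diff R M xs i w = v L
        \<and> (length L \<noteq> ?r \<longrightarrow> w = \<zero>\<^bsub>C i\<^esub>)" for L
    proof (cases "count_list L True = Suc i \<and> length L = ?r")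
      case True
      then have vL: "v L \<in> Ch (Suc i) (c - int (Suc i) *s \<delta>)" using TA[OF v, of L] by (simp add: A_def)
      have "v L \<in> cech_cocycles R M xs (Suc i)"
        using TC[OF v] fun_cong[OF dv, of L] by (simp add: cech_cocycles_def)
      then have "v L \<in> cech_coboundaries R M xs (Suc i)" using coh vL by blast
      then obtain w where w: "w \<in> carrier (C i)" "v L = cech_diff R M xs i w"
        by (auto simp: cech_coboundaries_def)
      \<comment> \<open>The primitive w lies merely in the whole cochain group; its component in the
        degree of v L is still a primitive, because v L is homogeneous and the projection commutes
        with the differential.\<close>
      have "cech_diff R M xs i (cproj i (c - int (Suc i) *s \<delta>) w) = v L"
        unfolding cech_diff_cproj[OF w(1)] w(2)[symmetric] by (rule cproj_id[OF vL])
      then show ?thesis using cproj_mem[OF w(1)] True by (auto simp: A_def)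
    next
      case False
      then have "v L = \<zero>\<^bsub>C (Suc i)\<^esub>" using TA[OF v, of L] T0[OF v, of L] by (auto simp: A_def)
      then show ?thesis by (intro exI[of _ "\<zero>\<^bsub>C i\<^esub>"]) (simp add: A0 d0)
    qed
    then obtain w where w: "\<And>L. w L \<in> A i (Suc i) (count_list L True)"
      "\<And>L. cech_diff R M xs i (w L) = v L" "\<And>L. length L \<noteq> ?r \<Longrightarrow> w L = \<zero>\<^bsub>C i\<^esub>" by metis
    show "\<exists>w\<in>T i (Suc i). ?d i w = v"
      using TI[of w, OF w(1,3)] w(2) by blast
  next
    fix v assume v: "v \<in> T 0 0" and dv: "?d 0 v = ?z 1"
    show "v = ?z 0"
    proof
      fix L show "v L = \<zero>\<^bsub>C 0\<^esub>"
      proof (cases "count_list L True = 0")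
        case True
        then have vL: "v L \<in> Ch 0 (c - int 0 *s \<delta>)" using TA[OF v, of L] by (simp add: A_def)
        have "v L \<in> cech_cocycles R M xs 0"
          using TC[OF v] fun_cong[OF dv, of L] by (simp add: cech_cocycles_def)
        \<comment> \<open>In Cech degree 0 the only coboundary is zero, so the cocycle itself
          vanishes.\<close>
        then show ?thesis using coh[OF _ vL] by (simp add: cech_coboundaries_def)
      qed (use TA[OF v, of L] in \<open>auto simp: A_def\<close>)
    qed
  next
    have idx: "cech_index xs 0 = {{}}" by (auto simp: cech_index_def dest: finite_subset)
    have one: "\<one> \<in> gR 0" by (rule one_gR)
    \<comment> \<open>The only index in Cech degree 0 is {}, with empty product 1. Every fraction of
      degree c - \<delta> over 1 has its numerator in \<open>gM (c - \<delta>)\<close>, which is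
      zero.\<close>
    have "localise_comp R gR M gM \<one> (c - \<delta>) = {frac R M \<one> \<zero>\<^bsub>M\<^esub> 0}"
    proof -
      have "c - \<delta> + int k *s 0 = c - \<delta>" for k by (simp add: vec_eq_iff)
      then have "localise_comp R gR M gM \<one> (c - \<delta>) = {frac R M \<one> \<zero>\<^bsub>M\<^esub> k | k. True}"
        unfolding localise_comp_eq[OF one] using start by simp
      also have "\<dots> = {frac R M \<one> \<zero>\<^bsub>M\<^esub> 0}" 
      proof (rule subset_antisym; rule subsetI)
        fix B assume "B \<in> {frac R M \<one> \<zero>\<^bsub>M\<^esub> k | k. True}"
        then obtain k where "B = frac R M \<one> \<zero>\<^bsub>M\<^esub> k" by blast
        then have "B = frac R M \<one> \<zero>\<^bsub>M\<^esub> 0" by (rule trans[OF _ frac_zero[OF R.one_closed]])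
        then show "B \<in> {frac R M \<one> \<zero>\<^bsub>M\<^esub> 0}" by blast
      qed blast
      finally show ?thesis .
    qed
    note comp = this
    have C0: "\<zero>\<^bsub>C 0\<^esub> = (\<lambda>\<sigma>\<in>{{}}. frac R M \<one> \<zero>\<^bsub>M\<^esub> 0)"
      by (simp add: cech_cochains_def idx cech_elt_empty localise_zero cong: restrict_cong)
    have "Ch 0 (c - \<delta>) = (\<Pi>\<^sub>E \<sigma>\<in>{{}}. {\<zero>\<^bsub>C 0\<^esub> \<sigma>})"
      unfolding cech_cochains_comp_def idx by (rule PiE_cong) (simp add: cech_elt_empty comp C0)
    also have "\<dots> = {\<zero>\<^bsub>C 0\<^esub>}" by (rule PiE_singleton) (simp add: C0 extensional_def)
    finally have "Ch 0 (c - \<delta>) = {\<zero>\<^bsub>C 0\<^esub>}" .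
    moreover have "c - int 1 *s \<delta> = c - \<delta>" by (simp add: vec_eq_iff)
    ultimately have "A 0 1 k = {\<zero>\<^bsub>C 0\<^esub>}" for k by (simp add: A_def)
    then show "T 0 1 = {?z 0}" unfolding T_def by blast
  next
    fix i l assume i: "length xs < i"
    have "card \<sigma> \<noteq> i" if "\<sigma> \<subseteq> {..<length xs}" for \<sigma>
      using i card_mono[OF finite_lessThan that] by simp
    then have "cech_index xs i = {}" by (auto simp: cech_index_def)
    then have Ci: "carrier (C i) = {\<zero>\<^bsub>C i\<^esub>}" by (simp add: cech_cochains_def restrict_def)
    have "v = ?z i" if "v \<in> T i l" for v
      by (rule ext) (use TC[OF that] Ci in blast)
    moreover have "?z i \<in> T i l" by (rule TI) (use A0 in auto)
    ultimately show "T i l = {?z i}" by blast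
  qed
  have "m = \<zero>\<^bsub>M\<^esub>" if m: "m \<in> gM c" for m
  proof -
    have idx: "cech_index xs 0 = {{}}" by (auto simp: cech_index_def dest: finite_subset)
    define u0 where "u0 = (\<lambda>\<sigma>\<in>cech_index xs 0. frac R M (e \<sigma>) m 0)"
    have "frac R M (e {}) m 0 \<in> localise_comp R gR M gM (e {}) c"
    proof -
      have "c + int 0 *s 0 = c" by (simp add: vec_eq_iff)
      with m have m': "m \<in> gM (c + int 0 *s 0)" by (simp only:)
      show ?thesis unfolding cech_elt_empty localise_comp_eq[OF one_gR] using m' by blast
    qed
    then have u0: "u0 \<in> Ch 0 c" by (auto simp: u0_def cech_cochains_comp_def idx)
    \<comment> \<open>The element m, read as m / 1, is placed at the list consisting of
      \<open>False\<close> only, the one index of Koszul degree 0.\<close>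
    let ?u = "\<lambda>L. if length L = ?r \<and> count_list L True = 0 then u0 else \<zero>\<^bsub>C 0\<^esub>"
    have c0: "c - int 0 *s \<delta> = c" by (simp add: vec_eq_iff)
    have "?u \<in> T 0 0"
      by (rule TI) (use u0 c0 Ch_zero in \<open>auto simp: A_def\<close>)
    then have "?u = ?z 0" by (rule vanish)
    then have "?u (replicate ?r False) = \<zero>\<^bsub>C 0\<^esub>" by (rule fun_cong)
    moreover have "count_list (replicate n False) True = 0" for n by (induct n) auto
    ultimately have "u0 = \<zero>\<^bsub>C 0\<^esub>" by simp
    then have "u0 {} = \<zero>\<^bsub>C 0\<^esub> {}" by simp
    then have "frac R M \<one> m 0 = frac R M \<one> \<zero>\<^bsub>M\<^esub> 0"
      by (simp add: u0_def idx cech_cochains_def cech_elt_empty localise_zero)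
    then show ?thesis using gMD[OF m] by (subst (asm) frac_eq_iff) auto
  qed
  then show ?thesis using zero_gM by blast
qed

end

section \<open>Laurent products and associated graded groups\<close>

lemma (in abelian_monoid) finsum_swap:
  assumes "finite A" "finite B" "\<And>a b. a \<in> A \<Longrightarrow> b \<in> B \<Longrightarrow> f a b \<in> carrier G"
  shows "(\<Oplus>a\<in>A. \<Oplus>b\<in>B. f a b) = (\<Oplus>b\<in>B. \<Oplus>a\<in>A. f a b)"
  using assms(1,3)
proof (induct A)
  case empty
  show ?case by simp
next
  case (insert x A)
  have f: "f a b \<in> carrier G" if "a \<in> insert x A" "b \<in> B" for a b using insert.prems that by blast
  have c1: "(\<lambda>a. \<Oplus>b\<in>B. f a b) \<in> A \<rightarrow> carrier G" "(\<Oplus>b\<in>B. f x b) \<in> carrier G"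
    using f by (auto intro!: finsum_closed)
  have c2: "f x \<in> B \<rightarrow> carrier G" "(\<lambda>b. \<Oplus>a\<in>A. f a b) \<in> B \<rightarrow> carrier G"
    using f by (auto intro!: finsum_closed)
  have IH: "(\<Oplus>a\<in>A. \<Oplus>b\<in>B. f a b) = (\<Oplus>b\<in>B. \<Oplus>a\<in>A. f a b)"
    by (rule insert.hyps(3)) (use f in blast)
  have "(\<Oplus>a\<in>insert x A. \<Oplus>b\<in>B. f a b) = (\<Oplus>b\<in>B. f x b) \<oplus> (\<Oplus>b\<in>B. \<Oplus>a\<in>A. f a b)"
    unfolding finsum_insert[OF insert.hyps(1,2) c1] IH ..
  also have "\<dots> = (\<Oplus>b\<in>B. f x b \<oplus> (\<Oplus>a\<in>A. f a b))"
    by (rule finsum_addf[OF c2, symmetric])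
  also have "\<dots> = (\<Oplus>b\<in>B. \<Oplus>a\<in>insert x A. f a b)"
  proof (rule finsum_cong'[OF refl])
    show "(\<lambda>b. \<Oplus>a\<in>insert x A. f a b) \<in> B \<rightarrow> carrier G" using f by (auto intro!: finsum_closed)
    fix b assume b: "b \<in> B"
    show "f x b \<oplus> (\<Oplus>a\<in>A. f a b) = (\<Oplus>a\<in>insert x A. f a b)"
      by (rule finsum_insert[OF insert.hyps(1,2), symmetric]) (use f b in auto)
  qed
  finally show ?case .
qed

section \<open>Laurent products of finitely supported families\<close>

definition fin_supp :: "('a, 'x) ring_scheme \<Rightarrow> (int ^ 's::finite \<Rightarrow> 'a set) \<Rightarrow> (int ^ 's \<Rightarrow> 'a) set" where
  "fin_supp R F = {a. (\<forall>n. a n \<in> F n) \<and> finite {n. a n \<noteq> \<zero>\<^bsub>R\<^esub>}}"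

text \<open>The monomial r t^p.\<close>

definition delta :: "('a, 'x) ring_scheme \<Rightarrow> int ^ 's::finite \<Rightarrow> 'a \<Rightarrow> int ^ 's \<Rightarrow> 'a" where
  "delta R p r = (\<lambda>n. if n = p then r else \<zero>\<^bsub>R\<^esub>)"

lemma fin_suppD:
  assumes "a \<in> fin_supp R F"
  shows "a n \<in> F n" "finite {n. a n \<noteq> \<zero>\<^bsub>R\<^esub>}"
  using assms by (auto simp: fin_supp_def)

lemma fin_suppI:
  assumes "\<And>n. a n \<in> F n" "finite {n. a n \<noteq> \<zero>\<^bsub>R\<^esub>}"
  shows "a \<in> fin_supp R F"
  using assms by (auto simp: fin_supp_def)

context cring
begin

lemma fin_supp_add:
  assumes "a \<in> fin_supp R F" "b \<in> fin_supp R F"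
    and "\<And>n x y. x \<in> F n \<Longrightarrow> y \<in> F n \<Longrightarrow> x \<oplus> y \<in> F n" "\<And>n. F n \<subseteq> carrier R"
  shows "(\<lambda>n. a n \<oplus> b n) \<in> fin_supp R F"
proof (rule fin_suppI)
  have "{n. a n \<oplus> b n \<noteq> \<zero>} \<subseteq> {n. a n \<noteq> \<zero>} \<union> {n. b n \<noteq> \<zero>}" by auto
  then show "finite {n. a n \<oplus> b n \<noteq> \<zero>}"
    by (rule finite_subset) (use fin_suppD(2)[OF assms(1)] fin_suppD(2)[OF assms(2)] in auto)
qed (use assms fin_suppD(1) in blast)

lemma laurent_mult_eq:
  assumes "\<And>n. a n \<in> carrier R" "\<And>n. b n \<in> carrier R" "finite K" "{n. a n \<noteq> \<zero>} \<subseteq> K"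
  shows "laurent_mult R a b n = (\<Oplus>k\<in>K. a k \<otimes> b (n - k))"
  unfolding laurent_mult_def
  by (rule add.finprod_mono_neutral_cong_left[OF assms(3,4)]) (use assms in auto)

lemma laurent_mult_closed:
  assumes "\<And>n. a n \<in> carrier R" "\<And>n. b n \<in> carrier R"
  shows "laurent_mult R a b n \<in> carrier R"
  unfolding laurent_mult_def using assms by (intro finsum_closed) auto

lemma laurent_mult_support:
  assumes "\<And>n. a n \<in> carrier R" "\<And>n. b n \<in> carrier R"
    "finite {n. a n \<noteq> \<zero>}" "finite {n. b n \<noteq> \<zero>}"
  shows "finite {n. laurent_mult R a b n \<noteq> \<zero>}"
proof (rule finite_subset)
  show "finite ((\<lambda>(i, j). i + j) ` ({n. a n \<noteq> \<zero>} \<times> {n. b n \<noteq> \<zero>}))" using assms by auto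
  show "{n. laurent_mult R a b n \<noteq> \<zero>} \<subseteq> (\<lambda>(i, j). i + j) ` ({n. a n \<noteq> \<zero>} \<times> {n. b n \<noteq> \<zero>})"
  proof
    fix n assume n: "n \<in> {n. laurent_mult R a b n \<noteq> \<zero>}"
    have "\<exists>k. a k \<noteq> \<zero> \<and> b (n - k) \<noteq> \<zero>"
    proof (rule ccontr)
      assume "\<not> ?thesis"
      then have "laurent_mult R a b n = \<zero>"
        unfolding laurent_mult_def using assms(1,2) by (intro add.finprod_one_eqI[simplified]) auto
      with n show False by simp
    qed
    then obtain k where "a k \<noteq> \<zero>" "b (n - k) \<noteq> \<zero>" by blast
    then show "n \<in> (\<lambda>(i, j). i + j) ` ({n. a n \<noteq> \<zero>} \<times> {n. b n \<noteq> \<zero>})"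
      by (intro image_eqI[of _ _ "(k, n - k)"]) auto
  qed
qed

lemma laurent_mult_delta:
  assumes "r \<in> carrier R" "\<And>n. b n \<in> carrier R"
  shows "laurent_mult R (delta R p r) b n = r \<otimes> b (n - p)"
proof -
  have "laurent_mult R (delta R p r) b n = (\<Oplus>k\<in>{p}. delta R p r k \<otimes> b (n - k))"
    by (rule laurent_mult_eq) (use assms in \<open>auto simp: delta_def\<close>)
  also have "\<dots> = r \<otimes> b (n - p)"
    using assms by (simp add: delta_def)
  finally show ?thesis .
qed

lemma laurent_mult_assoc:
  assumes a: "\<And>n. a n \<in> carrier R" "finite {n. a n \<noteq> \<zero>}"
    and b: "\<And>n. b n \<in> carrier R" "finite {n. b n \<noteq> \<zero>}" and c: "\<And>n. c n \<in> carrier R"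
  shows "laurent_mult R (laurent_mult R a b) c = laurent_mult R a (laurent_mult R b c)"
proof
  fix n
  let ?A = "{n. a n \<noteq> \<zero>}" and ?B = "{n. b n \<noteq> \<zero>}"
  define K where "K = (\<lambda>(i, j). i + j) ` (?A \<times> ?B)"
  have K: "finite K" using a b by (auto simp: K_def)
  have ab: "{n. laurent_mult R a b n \<noteq> \<zero>} \<subseteq> K \<union> {n. laurent_mult R a b n \<noteq> \<zero>}" by auto
  \<comment> \<open>Contains the support of the product and all sums i + j over the two supports, so
    that the inner sums can be extended by zeros.\<close>
  let ?L = "K \<union> {n. laurent_mult R a b n \<noteq> \<zero>}"
  have L: "finite ?L" using K laurent_mult_support[OF a(1) b(1) a(2) b(2)] by auto
  have "laurent_mult R (laurent_mult R a b) c n = (\<Oplus>k\<in>?L. laurent_mult R a b k \<otimes> c (n - k))"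
    by (rule laurent_mult_eq[OF laurent_mult_closed[OF a(1) b(1)] c L ab])
  also have "\<dots> = (\<Oplus>k\<in>?L. \<Oplus>i\<in>?A. a i \<otimes> b (k - i) \<otimes> c (n - k))"
  proof (rule finsum_cong'[OF refl])
    show "(\<lambda>k. \<Oplus>i\<in>?A. a i \<otimes> b (k - i) \<otimes> c (n - k)) \<in> ?L \<rightarrow> carrier R"
      using a b c by (auto intro!: finsum_closed)
    show "laurent_mult R a b k \<otimes> c (n - k) = (\<Oplus>i\<in>?A. a i \<otimes> b (k - i) \<otimes> c (n - k))" for k
      unfolding laurent_mult_def using a b c by (intro finsum_ldistr) auto
  qed
  also have "\<dots> = (\<Oplus>i\<in>?A. \<Oplus>k\<in>?L. a i \<otimes> b (k - i) \<otimes> c (n - k))"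
    by (rule finsum_swap[OF L a(2)]) (use a b c in auto)
  also have "\<dots> = (\<Oplus>i\<in>?A. a i \<otimes> laurent_mult R b c (n - i))"
  proof (rule finsum_cong'[OF refl])
    show "(\<lambda>i. a i \<otimes> laurent_mult R b c (n - i)) \<in> ?A \<rightarrow> carrier R"
      using a by (auto intro!: laurent_mult_closed b c)
    fix i assume i: "i \<in> ?A"
    have inj: "inj_on ((+) i) ?B" by auto
    have sub: "(+) i ` ?B \<subseteq> ?L" using i by (force simp: K_def)
    have "a i \<otimes> laurent_mult R b c (n - i) = (\<Oplus>j\<in>?B. a i \<otimes> (b j \<otimes> c (n - i - j)))"
      unfolding laurent_mult_def using a b c by (intro finsum_rdistr) auto
    also have "\<dots> = (\<Oplus>j\<in>?B. a i \<otimes> b (i + j - i) \<otimes> c (n - (i + j)))"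
      using a b c by (intro finsum_cong'[OF refl]) (auto simp: m_assoc diff_diff_eq)
    also have "\<dots> = (\<Oplus>k\<in>(+) i ` ?B. a i \<otimes> b (k - i) \<otimes> c (n - k))"
      using a b c by (intro finsum_reindex[OF _ inj, symmetric]) auto
    also have "\<dots> = (\<Oplus>k\<in>?L. a i \<otimes> b (k - i) \<otimes> c (n - k))"
    proof (rule add.finprod_mono_neutral_cong_left[OF L sub])
      fix k assume k: "k \<in> ?L - (+) i ` ?B"
      have "b (k - i) = \<zero>"
      proof (rule ccontr)
        assume "b (k - i) \<noteq> \<zero>"
        then have "k \<in> (+) i ` ?B" by (intro image_eqI[of _ _ "k - i"]) auto
        with k show False by blast
      qed
      then show "a i \<otimes> b (k - i) \<otimes> c (n - k) = \<zero>" using a c by simp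
    qed (use a b c in auto)
    finally show "(\<Oplus>k\<in>?L. a i \<otimes> b (k - i) \<otimes> c (n - k)) = a i \<otimes> laurent_mult R b c (n - i)" ..
  qed
  also have "\<dots> = laurent_mult R a (laurent_mult R b c) n"
    by (simp add: laurent_mult_def[of R a])
  finally show "laurent_mult R (laurent_mult R a b) c n = laurent_mult R a (laurent_mult R b c) n" .
qed

lemma laurent_mult_comm:
  assumes a: "\<And>n. a n \<in> carrier R" "finite {n. a n \<noteq> \<zero>}"
    and b: "\<And>n. b n \<in> carrier R" "finite {n. b n \<noteq> \<zero>}"
  shows "laurent_mult R a b = laurent_mult R b a"
proof
  fix n
  let ?A = "{n. a n \<noteq> \<zero>}" and ?B = "{n. b n \<noteq> \<zero>}"
  \<comment> \<open>The substitution of n - k for k carries this set to one that contains the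
    support of b.\<close>
  let ?K = "?A \<union> (\<lambda>k. n - k) ` ?B"
  have K: "finite ?K" using a b by auto
  have inj: "inj_on (\<lambda>k. n - k) ?K" by (auto simp: inj_on_def)
  have "laurent_mult R a b n = (\<Oplus>k\<in>?K. a k \<otimes> b (n - k))"
    by (rule laurent_mult_eq[OF a(1) b(1) K]) auto
  also have "\<dots> = (\<Oplus>k\<in>?K. b (n - k) \<otimes> a (n - (n - k)))"
    using a b by (intro finsum_cong'[OF refl]) (auto simp: m_comm)
  also have "\<dots> = (\<Oplus>k\<in>(\<lambda>k. n - k) ` ?K. b k \<otimes> a (n - k))"
    using a b by (intro finsum_reindex[OF _ inj, symmetric]) auto
  also have "\<dots> = laurent_mult R b a n"
  proof (rule laurent_mult_eq[OF b(1) a(1), symmetric])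
    show "finite ((\<lambda>k. n - k) ` ?K)" using K by simp
    show "?B \<subseteq> (\<lambda>k. n - k) ` ?K"
    proof
      fix k assume "k \<in> ?B"
      then show "k \<in> (\<lambda>k. n - k) ` ?K" by (intro image_eqI[of _ _ "n - k"]) auto
    qed
  qed
  finally show "laurent_mult R a b n = laurent_mult R b a n" .
qed

lemma laurent_mult_add_left:
  assumes a: "\<And>n. a n \<in> carrier R" "finite {n. a n \<noteq> \<zero>}"
    and b: "\<And>n. b n \<in> carrier R" "finite {n. b n \<noteq> \<zero>}" and c: "\<And>n. c n \<in> carrier R"
  shows "laurent_mult R (\<lambda>n. a n \<oplus> b n) c n = laurent_mult R a c n \<oplus> laurent_mult R b c n"
proof -
  let ?K = "{n. a n \<noteq> \<zero>} \<union> {n. b n \<noteq> \<zero>}"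
  have K: "finite ?K" using a b by auto
  have "laurent_mult R (\<lambda>n. a n \<oplus> b n) c n = (\<Oplus>k\<in>?K. (a k \<oplus> b k) \<otimes> c (n - k))"
    by (rule laurent_mult_eq[OF _ c K]) (use a b in auto)
  also have "\<dots> = (\<Oplus>k\<in>?K. a k \<otimes> c (n - k) \<oplus> b k \<otimes> c (n - k))"
    using a b c by (intro finsum_cong'[OF refl]) (auto simp: l_distr)
  also have "\<dots> = (\<Oplus>k\<in>?K. a k \<otimes> c (n - k)) \<oplus> (\<Oplus>k\<in>?K. b k \<otimes> c (n - k))"
    using a b c by (intro finsum_addf) auto
  also have "\<dots> = laurent_mult R a c n \<oplus> laurent_mult R b c n"
    using laurent_mult_eq[OF a(1) c K] laurent_mult_eq[OF b(1) c K] by auto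
  finally show ?thesis .
qed

lemma laurent_mult_add_right:
  assumes a: "\<And>n. a n \<in> carrier R" and b: "\<And>n. b n \<in> carrier R" and c: "\<And>n. c n \<in> carrier R"
  shows "laurent_mult R a (\<lambda>n. b n \<oplus> c n) n = laurent_mult R a b n \<oplus> laurent_mult R a c n"
proof -
  have "laurent_mult R a (\<lambda>n. b n \<oplus> c n) n
      = (\<Oplus>k\<in>{n. a n \<noteq> \<zero>}. a k \<otimes> b (n - k) \<oplus> a k \<otimes> c (n - k))"
    unfolding laurent_mult_def using a b c by (intro finsum_cong'[OF refl]) (auto simp: r_distr)
  also have "\<dots> = laurent_mult R a b n \<oplus> laurent_mult R a c n"
    unfolding laurent_mult_def using a b c by (intro finsum_addf) auto
  finally show ?thesis .
qed

end

text \<open>For infinite K the sum has the default value zero, which lies in H as well.\<close>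

lemma finsum_mem:
  assumes "abelian_monoid G" "H \<subseteq> carrier G" "\<zero>\<^bsub>G\<^esub> \<in> H" "\<And>x y. x \<in> H \<Longrightarrow> y \<in> H \<Longrightarrow> x \<oplus>\<^bsub>G\<^esub> y \<in> H"
    and "\<And>k. k \<in> K \<Longrightarrow> f k \<in> H"
  shows "finsum G f K \<in> H"
proof -
  interpret abelian_monoid G by fact
  show ?thesis using assms(5)
  proof (induct K rule: infinite_finite_induct)
    case (insert k K)
    have "finsum G f (insert k K) = f k \<oplus>\<^bsub>G\<^esub> finsum G f K"
      using insert assms(2) by (intro finsum_insert) auto
    then show ?case using insert assms(4) by auto
  qed (use assms(3) in auto)
qed

lemma finite_vec_interval: "finite {a..b::int ^ 's::finite}"
proof (rule finite_subset)
  let ?X = "(\<lambda>f. \<chi> i. f i) ` (\<Pi>\<^sub>E i\<in>UNIV. {a $ i..b $ i})"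
  show "finite ?X" by (intro finite_imageI finite_PiE) auto
  show "{a..b} \<subseteq> ?X"
  proof
    fix k assume "k \<in> {a..b}"
    then show "k \<in> ?X"
      by (intro image_eqI[of _ _ "\<lambda>i. k $ i"]) (auto simp: less_eq_vec_def vec_eq_iff)
  qed
qed

section \<open>The associated graded group through representatives\<close>

locale ideal_family = cring +
  fixes F :: "int ^ 's::finite \<Rightarrow> 'a set"
  assumes F_ideal: "0 \<le> n \<Longrightarrow> ideal (F n) R"
    and F_dec: "0 \<le> n \<Longrightarrow> F (n + 1) \<subseteq> F n"
begin

text \<open>G(F) lives in degrees n \<ge> 0, whereas \<open>F\<close> has values everywhere.
  Truncation by zero makes representatives Laurent polynomials whose products receive nothing from
  the other degrees.\<close>

definition F0 :: "int ^ 's \<Rightarrow> 'a set" where "F0 n = (if 0 \<le> n then F n else {\<zero>})"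

abbreviation "reps \<equiv> fin_supp R F0"

definition cls :: "(int ^ 's \<Rightarrow> 'a) \<Rightarrow> int ^ 's \<Rightarrow> 'a set" where
  "cls a = (\<lambda>n\<in>{0..}. F (n + 1) +> a n)"

lemma nonneg_Suc: "0 \<le> n \<Longrightarrow> 0 \<le> n + (1 :: int ^ 's)"
  by (simp add: less_eq_vec_def)

lemma F1_ideal: "0 \<le> n \<Longrightarrow> ideal (F (n + 1)) R"
  by (rule F_ideal[OF nonneg_Suc])

lemma F0_ideal: "ideal (F0 n) R"
  using F_ideal zeroideal by (simp add: F0_def)

lemma F0_closed:
  shows "F0 n \<subseteq> carrier R" "\<zero> \<in> F0 n" "x \<in> F0 n \<Longrightarrow> y \<in> F0 n \<Longrightarrow> x \<oplus> y \<in> F0 n"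
    "x \<in> F0 n \<Longrightarrow> \<ominus> x \<in> F0 n"
proof -
  interpret I: ideal "F0 n" R by (rule F0_ideal)
  show "F0 n \<subseteq> carrier R" "\<zero> \<in> F0 n" "x \<in> F0 n \<Longrightarrow> y \<in> F0 n \<Longrightarrow> x \<oplus> y \<in> F0 n"
    "x \<in> F0 n \<Longrightarrow> \<ominus> x \<in> F0 n" using I.a_subset by auto
qed

lemma reps_carrier: "a \<in> reps \<Longrightarrow> a n \<in> carrier R"
  using fin_suppD(1)[of a R F0 n] F0_closed(1) by blast

lemma reps_add: "a \<in> reps \<Longrightarrow> b \<in> reps \<Longrightarrow> (\<lambda>n. a n \<oplus> b n) \<in> reps"
  by (rule fin_supp_add) (use F0_closed in auto)

lemma reps_zero: "(\<lambda>n. \<zero>) \<in> reps"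
  by (rule fin_suppI) (use F0_closed in auto)

lemma reps_a_inv: assumes "a \<in> reps" shows "(\<lambda>n. \<ominus> a n) \<in> reps"
proof (rule fin_suppI)
  have "{n. \<ominus> a n \<noteq> \<zero>} \<subseteq> {n. a n \<noteq> \<zero>}" by auto
  then show "finite {n. \<ominus> a n \<noteq> \<zero>}" by (rule finite_subset) (rule fin_suppD(2)[OF assms])
qed (rule F0_closed(4)[OF fin_suppD(1)[OF assms]])

lemma reps_delta: "r \<in> F0 p \<Longrightarrow> delta R p r \<in> reps"
proof (rule fin_suppI)
  have "{n. delta R p r n \<noteq> \<zero>} \<subseteq> {p}" by (auto simp: delta_def)
  then show "finite {n. delta R p r n \<noteq> \<zero>}" by (rule finite_subset) simp
qed (use F0_closed in \<open>auto simp: delta_def\<close>)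

lemma cls_carrier: assumes "a \<in> reps" shows "cls a \<in> carrier (assoc_graded R F)"
proof -
  have a: "a n \<in> F n" if "0 \<le> n" for n using fin_suppD(1)[OF assms, of n] that by (simp add: F0_def)
  have "{n \<in> {0..}. cls a n \<noteq> F (n + 1)} \<subseteq> {n. a n \<noteq> \<zero>}"
    using a_rcos_zero[OF F1_ideal] ideal.axioms(1)[OF F1_ideal, THEN additive_subgroup.zero_closed]
    by (auto simp: cls_def)
  then have "finite {n \<in> {0..}. cls a n \<noteq> F (n + 1)}"
    by (rule finite_subset) (rule fin_suppD(2)[OF assms])
  then show ?thesis using a by (auto simp: assoc_graded_def cls_def)
qed

text \<open>Every zero class is represented by zero, which makes the support finite. The third
  property records this choice, so that vanishing of components can be read off the
  representative.\<close>

lemma cls_cases: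
  assumes "f \<in> carrier (assoc_graded R F)"
  obtains a where "a \<in> reps" "f = cls a" "\<And>n. 0 \<le> n \<Longrightarrow> f n = F (n + 1) \<Longrightarrow> a n = \<zero>"
proof -
  have f: "f \<in> extensional {0..}" "\<And>n. 0 \<le> n \<Longrightarrow> \<exists>r. r \<in> F n \<and> f n = F (n + 1) +> r"
    and fin: "finite {n \<in> {0..}. f n \<noteq> F (n + 1)}"
    using assms by (auto simp: assoc_graded_def PiE_iff)
  then obtain r where r: "\<And>n. 0 \<le> n \<Longrightarrow> r n \<in> F n \<and> f n = F (n + 1) +> r n" by metis
  define a where "a n = (if 0 \<le> n \<and> f n \<noteq> F (n + 1) then r n else \<zero>)" for n
  have "{n. a n \<noteq> \<zero>} \<subseteq> {n \<in> {0..}. f n \<noteq> F (n + 1)}" by (auto simp: a_def)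
  then have "finite {n. a n \<noteq> \<zero>}" using fin by (rule finite_subset)
  moreover have "a n \<in> F0 n" for n using r[of n] F0_closed(2)[of n] by (auto simp: a_def F0_def)
  ultimately have "a \<in> reps" by (intro fin_suppI)
  moreover have "f = cls a"
  proof
    fix n show "f n = cls a n"
    proof (cases "0 \<le> n")
      case True
      then show ?thesis using r[OF True] a_rcos_zero[OF F1_ideal[OF True]]
          ideal.axioms(1)[OF F1_ideal[OF True], THEN additive_subgroup.zero_closed]
        by (auto simp: cls_def a_def)
    qed (use f(1) in \<open>simp add: cls_def extensional_def\<close>)
  qed
  ultimately show ?thesis using that by (simp add: a_def)
qed

lemma assoc_graded_zero: "\<zero>\<^bsub>assoc_graded R F\<^esub> = cls (\<lambda>n. \<zero>)"
  using a_rcos_zero[OF F1_ideal] ideal.axioms(1)[OF F1_ideal, THEN additive_subgroup.zero_closed]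
  by (auto simp: assoc_graded_def cls_def fun_eq_iff restrict_def)

lemma assoc_graded_add:
  assumes "a \<in> reps" "b \<in> reps"
  shows "cls a \<oplus>\<^bsub>assoc_graded R F\<^esub> cls b = cls (\<lambda>n. a n \<oplus> b n)"
proof
  fix n
  show "(cls a \<oplus>\<^bsub>assoc_graded R F\<^esub> cls b) n = cls (\<lambda>n. a n \<oplus> b n) n"
  proof (cases "0 \<le> n")
    case True
    interpret I: ideal "F (n + 1)" R by (rule F1_ideal[OF True])
    show ?thesis using True I.a_rcos_sum[OF reps_carrier[OF assms(1)] reps_carrier[OF assms(2)], of n n]
      by (simp add: assoc_graded_def cls_def)
  qed (simp add: assoc_graded_def cls_def)
qed

lemma assoc_graded_abelian_group: "abelian_group (assoc_graded R F)"
proof (rule abelian_groupI)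
  let ?G = "assoc_graded R F"
  show "\<zero>\<^bsub>?G\<^esub> \<in> carrier ?G" unfolding assoc_graded_zero by (rule cls_carrier[OF reps_zero])
  fix f assume "f \<in> carrier ?G"
  then obtain a where a: "a \<in> reps" "f = cls a" by (rule cls_cases)
  show "\<zero>\<^bsub>?G\<^esub> \<oplus>\<^bsub>?G\<^esub> f = f"
    unfolding a(2) assoc_graded_zero assoc_graded_add[OF reps_zero a(1)] using reps_carrier[OF a(1)] by simp
  have "cls (\<lambda>n. \<ominus> a n) \<oplus>\<^bsub>?G\<^esub> f = \<zero>\<^bsub>?G\<^esub>"
    unfolding a(2) assoc_graded_zero assoc_graded_add[OF reps_a_inv[OF a(1)] a(1)]
    using reps_carrier[OF a(1)] by (simp add: l_neg)
  then show "\<exists>g\<in>carrier ?G. g \<oplus>\<^bsub>?G\<^esub> f = \<zero>\<^bsub>?G\<^esub>" using cls_carrier[OF reps_a_inv[OF a(1)]] by blast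
next
  let ?G = "assoc_graded R F"
  fix f g assume "f \<in> carrier ?G" "g \<in> carrier ?G"
  then obtain a b where a: "a \<in> reps" "f = cls a" and b: "b \<in> reps" "g = cls b" by (metis cls_cases)
  show "f \<oplus>\<^bsub>?G\<^esub> g \<in> carrier ?G"
    unfolding a(2) b(2) assoc_graded_add[OF a(1) b(1)] by (rule cls_carrier[OF reps_add[OF a(1) b(1)]])
  show "f \<oplus>\<^bsub>?G\<^esub> g = g \<oplus>\<^bsub>?G\<^esub> f"
    unfolding a(2) b(2) assoc_graded_add[OF a(1) b(1)] assoc_graded_add[OF b(1) a(1)]
    using a_comm[OF reps_carrier[OF a(1)] reps_carrier[OF b(1)]] by simp
next
  let ?G = "assoc_graded R F"
  fix f g h assume "f \<in> carrier ?G" "g \<in> carrier ?G" "h \<in> carrier ?G"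
  then obtain a b c where a: "a \<in> reps" "f = cls a" and b: "b \<in> reps" "g = cls b" and c: "c \<in> reps" "h = cls c"
    by (metis cls_cases)
  show "f \<oplus>\<^bsub>?G\<^esub> g \<oplus>\<^bsub>?G\<^esub> h = f \<oplus>\<^bsub>?G\<^esub> (g \<oplus>\<^bsub>?G\<^esub> h)"
    unfolding a(2) b(2) c(2) assoc_graded_add[OF a(1) b(1)] assoc_graded_add[OF b(1) c(1)]
      assoc_graded_add[OF reps_add[OF a(1) b(1)] c(1)] assoc_graded_add[OF a(1) reps_add[OF b(1) c(1)]]
    using a_assoc[OF reps_carrier[OF a(1)] reps_carrier[OF b(1)] reps_carrier[OF c(1)]] by simp
qed

definition gproj :: "int ^ 's \<Rightarrow> (int ^ 's \<Rightarrow> 'a set) \<Rightarrow> int ^ 's \<Rightarrow> 'a set" where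
  "gproj n f = (\<lambda>k\<in>{0..}. if k = n then f k else F (k + 1))"

lemma gproj_cls: "gproj n (cls a) = cls (delta R n (a n))"
proof
  fix k show "gproj n (cls a) k = cls (delta R n (a n)) k"
    using a_rcos_zero[OF F1_ideal, of k \<zero>] ideal.axioms(1)[OF F1_ideal, THEN additive_subgroup.zero_closed, of k]
    by (auto simp: gproj_def cls_def delta_def)
qed

lemma delta_add: "x \<in> carrier R \<Longrightarrow> y \<in> carrier R \<Longrightarrow>
    delta R n (x \<oplus> y) = (\<lambda>k. delta R n x k \<oplus> delta R n y k)"
  by (auto simp: delta_def)

lemma gproj_add_hom: "gproj n \<in> add_hom (assoc_graded R F) (assoc_graded R F)"
proof (rule add_homI)
  let ?G = "assoc_graded R F"
  fix f assume "f \<in> carrier ?G"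
  then obtain a where a: "a \<in> reps" "f = cls a" by (rule cls_cases)
  show "gproj n f \<in> carrier ?G" unfolding a(2) gproj_cls
    by (rule cls_carrier[OF reps_delta[OF fin_suppD(1)[OF a(1)]]])
  fix g assume "g \<in> carrier ?G"
  then obtain b where b: "b \<in> reps" "g = cls b" by (rule cls_cases)
  show "gproj n (f \<oplus>\<^bsub>?G\<^esub> g) = gproj n f \<oplus>\<^bsub>?G\<^esub> gproj n g"
    unfolding a(2) b(2) assoc_graded_add[OF a(1) b(1)] gproj_cls
      assoc_graded_add[OF reps_delta[OF fin_suppD(1)[OF a(1)]] reps_delta[OF fin_suppD(1)[OF b(1)]]]
      delta_add[OF reps_carrier[OF a(1)] reps_carrier[OF b(1)]] ..
qed

lemma gproj_mem: "f \<in> carrier (assoc_graded R F) \<Longrightarrow> gproj n f \<in> assoc_graded_comp R F n"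
  using add_hom_closed[OF gproj_add_hom, of f n] by (auto simp: assoc_graded_comp_def gproj_def)

lemma gproj_id: assumes "f \<in> assoc_graded_comp R F n" shows "gproj n f = f"
proof
  fix k show "gproj n f k = f k"
    using assms by (cases "0 \<le> k") (auto simp: assoc_graded_comp_def gproj_def assoc_graded_def PiE_iff extensional_def)
qed

lemma comp_carrier: "assoc_graded_comp R F n \<subseteq> carrier (assoc_graded R F)"
  by (auto simp: assoc_graded_comp_def)

lemma comp_cases:
  assumes "f \<in> assoc_graded_comp R F n"
  obtains r where "r \<in> F0 n" "f = cls (delta R n r)"
proof -
  have "f \<in> carrier (assoc_graded R F)" using assms comp_carrier by blast
  then obtain a where a: "a \<in> reps" "f = cls a" by (rule cls_cases)
  have "f = cls (delta R n (a n))" using gproj_id[OF assms] gproj_cls[of n a] a by simp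
  then show ?thesis using that fin_suppD(1)[OF a(1)] by blast
qed

lemma cls_delta_comp: "r \<in> F0 n \<Longrightarrow> cls (delta R n r) \<in> assoc_graded_comp R F n"
  using gproj_mem[OF cls_carrier[OF reps_delta], of r n n] gproj_cls[of n "delta R n r"]
  by (simp add: delta_def)

lemma zero_comp: "\<zero>\<^bsub>assoc_graded R F\<^esub> \<in> assoc_graded_comp R F n"
proof -
  have "delta R n \<zero> = (\<lambda>n. \<zero>)" by (auto simp: delta_def)
  then show ?thesis using cls_delta_comp[OF F0_closed(2), of n] by (simp add: assoc_graded_zero)
qed

lemma comp_disjoint:
  assumes "f \<in> assoc_graded_comp R F n" "f \<in> assoc_graded_comp R F k" "n \<noteq> k"
  shows "f = \<zero>\<^bsub>assoc_graded R F\<^esub>"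
proof
  fix j
  show "f j = \<zero>\<^bsub>assoc_graded R F\<^esub> j"
    using assms by (cases "0 \<le> j"; cases "j = n")
      (auto simp: assoc_graded_comp_def assoc_graded_def PiE_iff extensional_def)
qed

text \<open>Such a degree has a negative coordinate, so the truncated family is zero there. The
  final descent along e_j ends in these degrees.\<close>

lemma comp_nonneg:
  assumes "\<not> 0 \<le> n" shows "assoc_graded_comp R F n = {\<zero>\<^bsub>assoc_graded R F\<^esub>}"
proof -
  have "f = \<zero>\<^bsub>assoc_graded R F\<^esub>" if "f \<in> assoc_graded_comp R F n" for f
  proof -
    obtain r where "r \<in> F0 n" "f = cls (delta R n r)" by (rule comp_cases[OF \<open>f \<in> _\<close>])
    moreover have "delta R n \<zero> = (\<lambda>n. \<zero>)" by (auto simp: delta_def)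
    ultimately show ?thesis using assms by (simp add: F0_def assoc_graded_zero)
  qed
  then show ?thesis using zero_comp by blast
qed

lemma cls_delta_zero_imp:
  assumes "0 \<le> n" "r \<in> F n" "cls (delta R n r) = \<zero>\<^bsub>assoc_graded R F\<^esub>"
  shows "r \<in> F (n + 1)"
proof -
  interpret I: ideal "F (n + 1)" R by (rule F1_ideal[OF assms(1)])
  interpret J: ideal "F n" R by (rule F_ideal[OF assms(1)])
  have "cls (delta R n r) n = cls (\<lambda>n. \<zero>) n" using assms(3) by (simp add: assoc_graded_zero)
  then have "F (n + 1) +> r = F (n + 1)"
    using assms(1) a_rcos_zero[OF F1_ideal[OF assms(1)] I.zero_closed] by (simp add: cls_def delta_def)
  then show ?thesis using assms(2) J.a_subset I.rcos_const_imp_mem by blast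
qed

end

section \<open>Associated graded rings and modules\<close>

lemma vec_le_of_diff:
  fixes n k c :: "int ^ 's::finite"
  assumes "0 \<le> k" "c \<le> n - k" shows "c \<le> n"
  unfolding less_eq_vec_def
proof
  fix i
  have "0 \<le> k $ i" "c $ i \<le> n $ i - k $ i" using assms by (auto simp: less_eq_vec_def)
  then show "c $ i \<le> n $ i" by linarith
qed

lemma (in ideal_family) delta_one_mult:
  assumes b: "b \<in> reps" shows "laurent_mult R (delta R 0 \<one>) b = b"
proof
  fix n show "laurent_mult R (delta R 0 \<one>) b n = b n"
    using laurent_mult_delta[of \<one> b 0 n] reps_carrier[OF b] by simp
qed

text \<open>One setting for G(I) acting on itself and on G(F): E = F yields the ring, the general
  case the module.\<close>

locale filtration_action = E: ideal_family R E + F: ideal_family R F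
  for R :: "('a, 'x) ring_scheme" (structure) and E F :: "int ^ 's::finite \<Rightarrow> 'a set" +
  assumes act: "0 \<le> n \<Longrightarrow> 0 \<le> m \<Longrightarrow> a \<in> E n \<Longrightarrow> b \<in> F m \<Longrightarrow> a \<otimes> b \<in> F (n + m)"
begin

lemma act_F0:
  assumes "a \<in> E.F0 k" "b \<in> F.F0 (n - k)" shows "a \<otimes> b \<in> F.F0 n"
proof (cases "0 \<le> k \<and> 0 \<le> n - k")
  case True
  then have n: "0 \<le> n" using vec_le_of_diff by blast
  have "a \<otimes> b \<in> F (k + (n - k))" by (rule act) (use True assms in \<open>auto simp: E.F0_def F.F0_def\<close>)
  then show ?thesis using n by (simp add: F.F0_def)
next
  case False
  have "a \<in> carrier R" "b \<in> carrier R" using assms E.F0_closed(1) F.F0_closed(1) by auto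
  then have "a \<otimes> b = \<zero>" using False assms by (auto simp: E.F0_def F.F0_def split: if_splits)
  then show ?thesis using F.F0_closed(2) by simp
qed

lemma laurent_mult_reps:
  assumes "a \<in> E.reps" "b \<in> F.reps"
  shows "laurent_mult R a b \<in> F.reps"
proof (rule fin_suppI)
  show "finite {n. laurent_mult R a b n \<noteq> \<zero>}"
    by (rule E.laurent_mult_support[OF E.reps_carrier[OF assms(1)] F.reps_carrier[OF assms(2)]
        fin_suppD(2)[OF assms(1)] fin_suppD(2)[OF assms(2)]])
  show "laurent_mult R a b n \<in> F.F0 n" for n
    unfolding laurent_mult_def
    by (rule finsum_mem[OF E.abelian_monoid_axioms F.F0_closed(1,2)], rule F.F0_closed(3), assumption+)
      (rule act_F0[OF fin_suppD(1)[OF assms(1)] fin_suppD(1)[OF assms(2)]])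
qed

text \<open>Changing the representatives by e in E(k + 1) and f in F(n - k + 1) changes the product
  by e (f + b) + a f. Both terms lie in F(n + 1), as each has one factor whose degree is raised by
  1.\<close>

lemma rcoset_mult_act:
  assumes "0 \<le> k" "0 \<le> n - k" "a \<in> E k" "b \<in> F (n - k)"
  shows "rcoset_mult R (F (n + 1)) (E (k + 1) +> a) (F (n - k + 1) +> b) = F (n + 1) +> (a \<otimes> b)"
proof -
  have n: "0 \<le> n" by (rule vec_le_of_diff[OF assms(1,2)])
  interpret I: ideal "F (n + 1)" R by (rule F.F1_ideal[OF n])
  interpret A: ideal "E (k + 1)" R by (rule E.F1_ideal[OF assms(1)])
  interpret B: ideal "F (n - k + 1)" R by (rule F.F1_ideal[OF assms(2)])
  interpret B': ideal "F (n - k)" R by (rule F.F_ideal[OF assms(2)])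
  interpret A': ideal "E k" R by (rule E.F_ideal[OF assms(1)])
  have ac: "a \<in> carrier R" "b \<in> carrier R" using assms A'.a_subset B'.a_subset by auto
  have eq: "F (n + 1) +> (a' \<otimes> b') = F (n + 1) +> (a \<otimes> b)"
    if a': "a' \<in> E (k + 1) +> a" and b': "b' \<in> F (n - k + 1) +> b" for a' b'
  proof -
    obtain e where e: "e \<in> E (k + 1)" "a' = e \<oplus> a" using a' by (auto simp: a_r_coset_def')
    obtain f where f: "f \<in> F (n - k + 1)" "b' = f \<oplus> b" using b' by (auto simp: a_r_coset_def')
    have c: "e \<in> carrier R" "f \<in> carrier R" using e f A.a_subset B.a_subset by auto
    have f': "f \<in> F (n - k)" using f(1) F.F_dec[OF assms(2)] by blast
    have "e \<otimes> (f \<oplus> b) \<in> F (k + 1 + (n - k))"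
      by (rule act[OF E.nonneg_Suc[OF assms(1)] assms(2) e(1)]) (use f' assms(4) in auto)
    moreover have "a \<otimes> f \<in> F (k + (n - k + 1))"
      by (rule act[OF assms(1) F.nonneg_Suc[OF assms(2)] assms(3) f(1)])
    ultimately have x: "e \<otimes> (f \<oplus> b) \<oplus> a \<otimes> f \<in> F (n + 1)"
      by (intro I.a_closed) (simp_all add: algebra_simps)
    have "a' \<otimes> b' = (e \<otimes> (f \<oplus> b) \<oplus> a \<otimes> f) \<oplus> a \<otimes> b"
      unfolding e(2) f(2) using c ac by (simp add: E.l_distr E.r_distr E.a_ac)
    with x have "a' \<otimes> b' \<in> F (n + 1) +> (a \<otimes> b)" by (auto simp: a_r_coset_def')
    then show ?thesis using ac by (intro I.a_repr_independence'[symmetric]) auto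
  qed
  show ?thesis unfolding rcoset_mult_def
  proof (rule UN_const_on[OF A.a_rcos_self[OF ac(1)]], rule UN_const_on[OF B.a_rcos_self[OF ac(2)]])
  qed (rule eq)
qed

text \<open>Passing to classes is multiplicative; the ring and module laws of G are transported from
  Laurent products along this identity.\<close>

lemma mult_cls:
  assumes a: "a \<in> E.reps" and b: "b \<in> F.reps"
  shows "assoc_graded_mult R F (E.cls a) (F.cls b) = F.cls (laurent_mult R a b)"
proof
  fix n
  show "assoc_graded_mult R F (E.cls a) (F.cls b) n = F.cls (laurent_mult R a b) n"
  proof (cases "0 \<le> n")
    case True
    interpret I: ideal "F (n + 1)" R by (rule F.F1_ideal[OF True])
    interpret Q: ring "R Quot F (n + 1)" by (rule I.quotient_is_ring)
    have h: "(+>) (F (n + 1)) \<in> add_hom R (R Quot F (n + 1))"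
      using I.rcos_ring_hom by (auto simp: ring_hom_def hom_def)
    have ac: "a k \<in> carrier R" "b k \<in> carrier R" for k
      using E.reps_carrier[OF a] F.reps_carrier[OF b] by auto
    have t: "rcoset_mult R (F (n + 1)) (E.cls a k) (F.cls b (n - k)) = F (n + 1) +> (a k \<otimes> b (n - k))"
      if k: "k \<in> {0..n}" for k
    proof -
      have k: "0 \<le> k" "0 \<le> n - k" using k by (auto simp: less_eq_vec_def)
      then show ?thesis
        using rcoset_mult_act[OF k] fin_suppD(1)[OF a, of k] fin_suppD(1)[OF b, of "n - k"]
        by (simp add: E.cls_def F.cls_def E.F0_def F.F0_def)
    qed
    \<comment> \<open>G sums over {0..n}, the Laurent product over the support of a. On the union
      both sums agree: outside {0..n} one factor lies in a truncated degree, and outside the support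
      a k = 0.\<close>
    let ?K = "{0..n} \<union> {k. a k \<noteq> \<zero>}"
    have K: "finite ?K" using finite_vec_interval[of 0 n] fin_suppD(2)[OF a] by auto
    have "assoc_graded_mult R F (E.cls a) (F.cls b) n
      = (\<Oplus>\<^bsub>R Quot F (n + 1)\<^esub> k\<in>{0..n}. F (n + 1) +> (a k \<otimes> b (n - k)))"
    proof -
      have "(\<Oplus>\<^bsub>R Quot F (n + 1)\<^esub> k\<in>{0..n}. rcoset_mult R (F (n + 1)) (E.cls a k) (F.cls b (n - k)))
        = (\<Oplus>\<^bsub>R Quot F (n + 1)\<^esub> k\<in>{0..n}. F (n + 1) +> (a k \<otimes> b (n - k)))"
        by (rule Q.finsum_cong'[OF refl _ t]) (use ac add_hom_closed[OF h] in auto)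
      then show ?thesis using True by (simp add: assoc_graded_mult_def)
    qed
    also have "\<dots> = F (n + 1) +> (\<Oplus>k\<in>{0..n}. a k \<otimes> b (n - k))"
      by (rule add_hom_finsum[OF E.abelian_group_axioms Q.abelian_group_axioms h, symmetric]) (use ac in auto)
    also have "(\<Oplus>k\<in>{0..n}. a k \<otimes> b (n - k)) = (\<Oplus>k\<in>?K. a k \<otimes> b (n - k))"
    proof (rule E.add.finprod_mono_neutral_cong_left[OF K])
      fix k assume k: "k \<in> ?K - {0..n}"
      have "a k = \<zero> \<or> b (n - k) = \<zero>"
      proof (rule ccontr)
        assume "\<not> ?thesis"
        then have "0 \<le> k" "0 \<le> n - k"
          using fin_suppD(1)[OF a, of k] fin_suppD(1)[OF b, of "n - k"]
          by (auto simp: E.F0_def F.F0_def split: if_splits)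
        with k show False by (auto simp: less_eq_vec_def)
      qed
      then show "a k \<otimes> b (n - k) = \<zero>" using ac by auto
    qed (use ac in auto)
    also have "\<dots> = laurent_mult R a b n"
      by (rule E.laurent_mult_eq[OF ac K, symmetric]) auto
    also have "F (n + 1) +> laurent_mult R a b n = F.cls (laurent_mult R a b) n"
      using True by (simp add: F.cls_def)
    finally show ?thesis .
  qed (simp add: assoc_graded_mult_def F.cls_def)
qed

end

section \<open>The ring G(I) and its ideal S_{++}\<close>

locale filtration_ring = filtration_action R E E
  for R :: "('a, 'x) ring_scheme" (structure) and E :: "int ^ 's::finite \<Rightarrow> 'a set" +
  assumes one_mem: "\<one> \<in> E 0"
begin

abbreviation "S \<equiv> assoc_graded R E"

lemma S_mult: "a \<in> E.reps \<Longrightarrow> b \<in> E.reps \<Longrightarrow> E.cls a \<otimes>\<^bsub>S\<^esub> E.cls b = E.cls (laurent_mult R a b)"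
  using mult_cls by (simp add: assoc_graded_def)

lemma S_one: "\<one>\<^bsub>S\<^esub> = E.cls (delta R 0 \<one>)"
proof
  fix n show "\<one>\<^bsub>S\<^esub> n = E.cls (delta R 0 \<one>) n"
    using E.a_rcos_zero[OF E.F1_ideal, of n \<zero>]
      ideal.axioms(1)[OF E.F1_ideal, THEN additive_subgroup.zero_closed, of n]
    by (auto simp: assoc_graded_def E.cls_def delta_def)
qed

lemma one_reps: "delta R 0 \<one> \<in> E.reps"
  by (rule E.reps_delta) (simp add: E.F0_def one_mem)

lemma S_cring: "cring S"
proof (rule cringI)
  show "abelian_group S" by (rule E.assoc_graded_abelian_group)
  show "Group.comm_monoid S"
  proof (rule comm_monoidI)
    show "\<one>\<^bsub>S\<^esub> \<in> carrier S" unfolding S_one by (rule E.cls_carrier[OF one_reps])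
    fix f g assume "f \<in> carrier S" "g \<in> carrier S"
    then obtain a b where a: "a \<in> E.reps" "f = E.cls a" and b: "b \<in> E.reps" "g = E.cls b"
      by (elim E.cls_cases)
    show "f \<otimes>\<^bsub>S\<^esub> g \<in> carrier S"
      unfolding a(2) b(2) S_mult[OF a(1) b(1)] by (rule E.cls_carrier[OF laurent_mult_reps[OF a(1) b(1)]])
    show "f \<otimes>\<^bsub>S\<^esub> g = g \<otimes>\<^bsub>S\<^esub> f"
      unfolding a(2) b(2) S_mult[OF a(1) b(1)] S_mult[OF b(1) a(1)]
      by (subst E.laurent_mult_comm[OF E.reps_carrier[OF a(1)] fin_suppD(2)[OF a(1)]
            E.reps_carrier[OF b(1)] fin_suppD(2)[OF b(1)]]) (rule refl)
    show "\<one>\<^bsub>S\<^esub> \<otimes>\<^bsub>S\<^esub> f = f"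
      unfolding a(2) S_one S_mult[OF one_reps a(1)] E.delta_one_mult[OF a(1)] ..
  next
    fix f g h assume "f \<in> carrier S" "g \<in> carrier S" "h \<in> carrier S"
    then obtain a b c where a: "a \<in> E.reps" "f = E.cls a" and b: "b \<in> E.reps" "g = E.cls b"
      and c: "c \<in> E.reps" "h = E.cls c" by (elim E.cls_cases)
    show "f \<otimes>\<^bsub>S\<^esub> g \<otimes>\<^bsub>S\<^esub> h = f \<otimes>\<^bsub>S\<^esub> (g \<otimes>\<^bsub>S\<^esub> h)"
      unfolding a(2) b(2) c(2) S_mult[OF a(1) b(1)] S_mult[OF b(1) c(1)]
        S_mult[OF laurent_mult_reps[OF a(1) b(1)] c(1)] S_mult[OF a(1) laurent_mult_reps[OF b(1) c(1)]]
      by (subst E.laurent_mult_assoc[OF E.reps_carrier[OF a(1)] fin_suppD(2)[OF a(1)]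
            E.reps_carrier[OF b(1)] fin_suppD(2)[OF b(1)] E.reps_carrier[OF c(1)]]) (rule refl)
  qed
  fix f g h assume "f \<in> carrier S" "g \<in> carrier S" "h \<in> carrier S"
  then obtain a b c where a: "a \<in> E.reps" "f = E.cls a" and b: "b \<in> E.reps" "g = E.cls b"
    and c: "c \<in> E.reps" "h = E.cls c" by (elim E.cls_cases)
  show "(f \<oplus>\<^bsub>S\<^esub> g) \<otimes>\<^bsub>S\<^esub> h = f \<otimes>\<^bsub>S\<^esub> h \<oplus>\<^bsub>S\<^esub> g \<otimes>\<^bsub>S\<^esub> h"
    unfolding a(2) b(2) c(2) E.assoc_graded_add[OF a(1) b(1)] S_mult[OF E.reps_add[OF a(1) b(1)] c(1)]
      S_mult[OF a(1) c(1)] S_mult[OF b(1) c(1)]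
      E.assoc_graded_add[OF laurent_mult_reps[OF a(1) c(1)] laurent_mult_reps[OF b(1) c(1)]]
    by (rule arg_cong[of _ _ E.cls], rule ext)
      (rule E.laurent_mult_add_left[OF E.reps_carrier[OF a(1)] fin_suppD(2)[OF a(1)]
            E.reps_carrier[OF b(1)] fin_suppD(2)[OF b(1)] E.reps_carrier[OF c(1)]])
qed

lemma dot_cls_delta:
  assumes "length gs = length qs" "set gs \<subseteq> E.F0 p" "set qs \<subseteq> E.F0 (n - p)"
  shows "dot S (map (\<lambda>g. E.cls (delta R p g)) gs) (map (\<lambda>q. E.cls (delta R (n - p) q)) qs)
     = E.cls (delta R n (dot R gs qs)) \<and> dot R gs qs \<in> E.F0 n"
  using assms
proof (induct gs qs rule: list_induct2)
  case Nil
  have "delta R n \<zero> = (\<lambda>n. \<zero>)" by (auto simp: delta_def)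
  then show ?case using E.F0_closed(2)[of n] by (simp add: E.assoc_graded_zero)
next
  case (Cons g gs q qs)
  have g: "g \<in> E.F0 p" "q \<in> E.F0 (n - p)" using Cons by auto
  have gc: "g \<in> carrier R" "q \<in> carrier R" using g E.F0_closed(1) by auto
  have IH: "dot S (map (\<lambda>g. E.cls (delta R p g)) gs) (map (\<lambda>q. E.cls (delta R (n - p) q)) qs)
     = E.cls (delta R n (dot R gs qs))" "dot R gs qs \<in> E.F0 n"
    using Cons by auto
  have gq: "g \<otimes> q \<in> E.F0 n" by (rule act_F0[OF g])
  have "laurent_mult R (delta R p g) (delta R (n - p) q) = delta R n (g \<otimes> q)"
  proof
    fix k
    have "laurent_mult R (delta R p g) (delta R (n - p) q) k = g \<otimes> delta R (n - p) q (k - p)"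
      by (rule E.laurent_mult_delta[OF gc(1)]) (rule E.reps_carrier[OF E.reps_delta[OF g(2)]])
    then show "laurent_mult R (delta R p g) (delta R (n - p) q) k = delta R n (g \<otimes> q) k"
      using gc by (simp add: delta_def)
  qed
  then have 1: "E.cls (delta R p g) \<otimes>\<^bsub>S\<^esub> E.cls (delta R (n - p) q) = E.cls (delta R n (g \<otimes> q))"
    using S_mult[OF E.reps_delta[OF g(1)] E.reps_delta[OF g(2)]] by simp
  have "dot R gs qs \<in> carrier R" using IH(2) E.F0_closed(1) by auto
  then have 2: "E.cls (delta R n (g \<otimes> q)) \<oplus>\<^bsub>S\<^esub> E.cls (delta R n (dot R gs qs))
      = E.cls (delta R n (g \<otimes> q \<oplus> dot R gs qs))"
    unfolding E.assoc_graded_add[OF E.reps_delta[OF gq] E.reps_delta[OF IH(2)]]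
    using gc by (subst E.delta_add) auto
  show ?case using 1 2 IH E.F0_closed(3)[OF gq IH(2)] by simp
qed

lemma comp_dot:
  assumes gs: "set gs \<subseteq> E.F0 p" and f: "f \<in> assoc_graded_comp R E n"
    and gen: "\<And>r. r \<in> E.F0 n \<Longrightarrow> \<exists>qs. length qs = length gs \<and> set qs \<subseteq> E.F0 (n - p) \<and> dot R gs qs = r"
  shows "\<exists>ys. length ys = length gs \<and> set ys \<subseteq> assoc_graded_comp R E (n - p)
     \<and> dot S (map (\<lambda>g. E.cls (delta R p g)) gs) ys = f"
proof -
  obtain r where r: "r \<in> E.F0 n" "f = E.cls (delta R n r)" by (rule E.comp_cases[OF f])
  obtain qs where qs: "length qs = length gs" "set qs \<subseteq> E.F0 (n - p)" "dot R gs qs = r" using gen[OF r(1)] by blast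
  show ?thesis
    using dot_cls_delta[OF qs(1)[symmetric] gs qs(2)] qs r(2) E.cls_delta_comp
    by (intro exI[of _ "map (\<lambda>q. E.cls (delta R (n - p) q)) qs"]) auto
qed

text \<open>S_{++} described by vanishing components, a form in which the ideal laws can be checked
  degree by degree; \<open>irrelevant_eq\<close> identifies it with the set of finite sums.\<close>

definition irrelevant :: "(int ^ 's \<Rightarrow> 'a set) set" where
  "irrelevant = {f \<in> carrier S. \<forall>k\<ge>0. \<not> 1 \<le> k \<longrightarrow> f k = E (k + 1)}"

lemma irrelevantE:
  assumes "f \<in> irrelevant"
  obtains a where "a \<in> E.reps" "f = E.cls a" "\<And>n. \<not> 1 \<le> n \<Longrightarrow> a n = \<zero>"
proof -
  have f: "f \<in> carrier S" "\<And>k. 0 \<le> k \<Longrightarrow> \<not> 1 \<le> k \<Longrightarrow> f k = E (k + 1)"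
    using assms by (auto simp: irrelevant_def)
  obtain a where a: "a \<in> E.reps" "f = E.cls a" "\<And>n. 0 \<le> n \<Longrightarrow> f n = E (n + 1) \<Longrightarrow> a n = \<zero>"
    by (rule E.cls_cases[OF f(1)]) blast
  have "a n = \<zero>" if "\<not> 1 \<le> n" for n
  proof (cases "0 \<le> n")
    case True
    then show ?thesis using a(3) f(2) that by blast
  next
    case False
    then show ?thesis using fin_suppD(1)[OF a(1), of n] by (simp add: E.F0_def)
  qed
  then show ?thesis using that a by blast
qed

lemma irrelevantI:
  assumes "a \<in> E.reps" "\<And>n. \<not> 1 \<le> n \<Longrightarrow> a n = \<zero>"
  shows "E.cls a \<in> irrelevant"
  using E.cls_carrier[OF assms(1)] assms(2) E.a_rcos_zero[OF E.F1_ideal]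
    ideal.axioms(1)[OF E.F1_ideal, THEN additive_subgroup.zero_closed]
  by (auto simp: irrelevant_def E.cls_def)

text \<open>If n \<ge> 1 fails, then so does n - k \<ge> 1 for every k \<ge> 0; hence all terms of a
  product in degree n are zero.\<close>

lemma irrelevant_ideal: "ideal irrelevant S"
proof -
  interpret S: cring S by (rule S_cring)
  have mult: "s \<otimes>\<^bsub>S\<^esub> f \<in> irrelevant" if "f \<in> irrelevant" "s \<in> carrier S" for f s
  proof -
    note fs = that
    obtain a where a: "a \<in> E.reps" "f = E.cls a" "\<And>n. \<not> 1 \<le> n \<Longrightarrow> a n = \<zero>"
      by (rule irrelevantE[OF fs(1)]) blast
    obtain b where b: "b \<in> E.reps" "s = E.cls b" by (rule E.cls_cases[OF fs(2)]) blast
    show ?thesis unfolding a(2) b(2) S_mult[OF b(1) a(1)]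
    proof (rule irrelevantI[OF laurent_mult_reps[OF b(1) a(1)]])
      fix n :: "int ^ 's" assume n: "\<not> 1 \<le> n"
      have z: "b k \<otimes> a (n - k) = \<zero>" for k
      proof (cases "0 \<le> k")
        case True
        have "\<not> 1 \<le> n - k"
        proof
          assume "1 \<le> n - k"
          with True have "1 \<le> n" by (rule vec_le_of_diff)
          with n show False by simp
        qed
        then show ?thesis using a(3) E.reps_carrier[OF b(1)] by simp
      next
        case False
        then have "b k = \<zero>" using fin_suppD(1)[OF b(1), of k] by (simp add: E.F0_def)
        then show ?thesis using E.reps_carrier[OF a(1)] by simp
      qed
      show "laurent_mult R b a n = \<zero>" unfolding laurent_mult_def z by simp
    qed
  qed
  show ?thesis
  proof (rule idealI)
    show "ring S" by (rule S.ring_axioms)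
    show "subgroup irrelevant (add_monoid S)"
    proof (rule S.add.subgroupI)
      show "irrelevant \<subseteq> carrier S" by (auto simp: irrelevant_def)
      show "irrelevant \<noteq> {}" using irrelevantI[OF E.reps_zero] by auto
      fix f assume f: "f \<in> irrelevant"
      obtain a where a: "a \<in> E.reps" "f = E.cls a" "\<And>n. \<not> 1 \<le> n \<Longrightarrow> a n = \<zero>" by (rule irrelevantE[OF f]) blast
      have fc: "f \<in> carrier S" using f by (auto simp: irrelevant_def)
      have "(\<ominus>\<^bsub>S\<^esub> \<one>\<^bsub>S\<^esub>) \<otimes>\<^bsub>S\<^esub> f \<in> irrelevant" by (rule mult[OF f]) simp
      then show "\<ominus>\<^bsub>S\<^esub> f \<in> irrelevant" using fc by (simp add: S.l_minus)
      fix g assume g: "g \<in> irrelevant"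
      obtain b where b: "b \<in> E.reps" "g = E.cls b" "\<And>n. \<not> 1 \<le> n \<Longrightarrow> b n = \<zero>" by (rule irrelevantE[OF g]) blast
      show "f \<oplus>\<^bsub>S\<^esub> g \<in> irrelevant"
        unfolding a(2) b(2) E.assoc_graded_add[OF a(1) b(1)]
        by (rule irrelevantI[OF E.reps_add[OF a(1) b(1)]]) (simp add: a(3) b(3))
    qed
    fix f s assume f: "f \<in> irrelevant" and s: "s \<in> carrier S"
    show "s \<otimes>\<^bsub>S\<^esub> f \<in> irrelevant" by (rule mult[OF f s])
    moreover have "f \<in> carrier S" using f by (auto simp: irrelevant_def)
    ultimately show "f \<otimes>\<^bsub>S\<^esub> s \<in> irrelevant" using s by (simp add: S.m_comm)
  qed
qed

lemma comp_irrelevant: "1 \<le> n \<Longrightarrow> f \<in> assoc_graded_comp R E n \<Longrightarrow> f \<in> irrelevant"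
  by (auto simp: assoc_graded_comp_def irrelevant_def)

text \<open>Covers homogeneous generators that happen to be zero, whose assigned degree may be
  anything.\<close>

lemma comp_irrelevant_cases:
  assumes "f \<in> assoc_graded_comp R E n" "f \<in> irrelevant"
  shows "f = \<zero>\<^bsub>S\<^esub> \<or> 1 \<le> n"
proof (rule disjCI)
  assume n: "\<not> 1 \<le> n"
  show "f = \<zero>\<^bsub>S\<^esub>"
  proof
    fix k show "f k = \<zero>\<^bsub>S\<^esub> k"
      using assms n by (cases "0 \<le> k"; cases "k = n")
        (auto simp: assoc_graded_comp_def irrelevant_def assoc_graded_def PiE_iff extensional_def)
  qed
qed

lemma cls_finsum_delta:
  assumes "finite K" "a \<in> E.reps"
  shows "(\<Oplus>\<^bsub>S\<^esub> n\<in>K. E.cls (delta R n (a n))) = E.cls (\<lambda>n. if n \<in> K then a n else \<zero>)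
     \<and> (\<lambda>n. if n \<in> K then a n else \<zero>) \<in> E.reps"
  using assms(1)
proof (induct K)
  case empty
  show ?case using E.assoc_graded_zero E.reps_zero S_cring
    by (simp add: abelian_monoid.finsum_empty cring.axioms(1) ring.is_abelian_group abelian_group.axioms(1))
next
  case (insert k K)
  interpret S: cring S by (rule S_cring)
  have d: "delta R n (a n) \<in> E.reps" for n by (rule E.reps_delta[OF fin_suppD(1)[OF assms(2)]])
  have IH: "(\<Oplus>\<^bsub>S\<^esub> n\<in>K. E.cls (delta R n (a n))) = E.cls (\<lambda>n. if n \<in> K then a n else \<zero>)"
    "(\<lambda>n. if n \<in> K then a n else \<zero>) \<in> E.reps" using insert.hyps(3) by auto
  have eq: "(\<lambda>n. delta R k (a k) n \<oplus> (if n \<in> K then a n else \<zero>)) = (\<lambda>n. if n \<in> insert k K then a n else \<zero>)"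
    using insert.hyps(2) E.reps_carrier[OF assms(2)] by (auto simp: delta_def)
  have "(\<Oplus>\<^bsub>S\<^esub> n\<in>insert k K. E.cls (delta R n (a n)))
     = E.cls (delta R k (a k)) \<oplus>\<^bsub>S\<^esub> (\<Oplus>\<^bsub>S\<^esub> n\<in>K. E.cls (delta R n (a n)))"
    by (rule S.finsum_insert[OF insert.hyps(1,2)]) (use E.cls_carrier[OF d] in auto)
  also have "\<dots> = E.cls (\<lambda>n. if n \<in> insert k K then a n else \<zero>)"
    unfolding IH(1) E.assoc_graded_add[OF d IH(2)] eq ..
  finally show ?case using E.reps_add[OF d[of k] IH(2)] unfolding eq by blast
qed

lemma irrelevant_eq: "irrelevant_ideal S (assoc_graded_comp R E) = irrelevant"
proof (rule subset_antisym; rule subsetI)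
  interpret S: cring S by (rule S_cring)
  interpret J: ideal irrelevant S by (rule irrelevant_ideal)
  fix f
  {
    assume "f \<in> irrelevant_ideal S (assoc_graded_comp R E)"
    then obtain A g where g: "f = (\<Oplus>\<^bsub>S\<^esub> n \<in> A. g n)" "\<And>n. n \<in> A \<Longrightarrow> 1 \<le> n \<and> g n \<in> assoc_graded_comp R E n"
      by (auto simp: irrelevant_ideal_def)
    show "f \<in> irrelevant" unfolding g(1)
      by (rule finsum_mem[OF S.abelian_monoid_axioms J.a_subset J.zero_closed J.a_closed])
        (use g(2) comp_irrelevant in auto)
  next
    assume "f \<in> irrelevant"
    then obtain a where a: "a \<in> E.reps" "f = E.cls a" "\<And>n. \<not> 1 \<le> n \<Longrightarrow> a n = \<zero>" by (rule irrelevantE) blast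
    let ?K = "{n. a n \<noteq> \<zero>}"
    have "(\<lambda>n. if n \<in> ?K then a n else \<zero>) = a" by auto
    then have "f = (\<Oplus>\<^bsub>S\<^esub> n\<in>?K. E.cls (delta R n (a n)))"
      using cls_finsum_delta[OF fin_suppD(2)[OF a(1)] a(1)] a(2) by simp
    moreover have "\<forall>n\<in>?K. 1 \<le> n \<and> E.cls (delta R n (a n)) \<in> assoc_graded_comp R E n"
      using a(3) E.cls_delta_comp[OF fin_suppD(1)[OF a(1)]] by auto
    ultimately show "f \<in> irrelevant_ideal S (assoc_graded_comp R E)"
      unfolding irrelevant_ideal_def using fin_suppD(2)[OF a(1)] by blast
  }
qed

text \<open>The choice in \<open>hom_generators\<close> is meaningful only if such a list exists.
  The classes of gs serve, since \<open>gen\<close> expresses every element of degree n \<ge> 1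
  through them.\<close>

lemma hom_generators_ex:
  assumes gs: "set gs \<subseteq> E 1"
    and gen: "\<And>n r. 1 \<le> n \<Longrightarrow> r \<in> E n \<Longrightarrow>
      \<exists>qs. length qs = length gs \<and> set qs \<subseteq> E (n - 1) \<and> dot R gs qs = r"
  shows "\<exists>xs. set xs \<subseteq> (\<Union>n. assoc_graded_comp R E n) \<and> Idl\<^bsub>S\<^esub> (set xs) = irrelevant"
proof (intro exI conjI)
  interpret S: cring S by (rule S_cring)
  interpret J: ideal irrelevant S by (rule irrelevant_ideal)
  let ?xs = "map (\<lambda>g. E.cls (delta R 1 g)) gs"
  have gs': "set gs \<subseteq> E.F0 1" using gs by (simp add: E.F0_def less_eq_vec_def)
  have xs: "set ?xs \<subseteq> assoc_graded_comp R E 1" using E.cls_delta_comp gs' by auto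
  then show "set ?xs \<subseteq> (\<Union>n. assoc_graded_comp R E n)" by blast
  have xsc: "set ?xs \<subseteq> carrier S" using xs E.comp_carrier by blast
  interpret I: ideal "Idl\<^bsub>S\<^esub> (set ?xs)" S by (rule S.genideal_ideal[OF xsc])
  show "Idl\<^bsub>S\<^esub> (set ?xs) = irrelevant"
  proof (rule subset_antisym)
    show "Idl\<^bsub>S\<^esub> (set ?xs) \<subseteq> irrelevant"
      by (rule S.genideal_minimal[OF irrelevant_ideal]) (use xs comp_irrelevant in blast)
    show "irrelevant \<subseteq> Idl\<^bsub>S\<^esub> (set ?xs)"
    proof
      fix f assume "f \<in> irrelevant"
      then obtain A g where g: "f = (\<Oplus>\<^bsub>S\<^esub> n \<in> A. g n)" "\<And>n. n \<in> A \<Longrightarrow> 1 \<le> n \<and> g n \<in> assoc_graded_comp R E n"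
        unfolding irrelevant_eq[symmetric] by (auto simp: irrelevant_ideal_def)
      have mem: "g n \<in> Idl\<^bsub>S\<^esub> (set ?xs)" if n: "n \<in> A" for n
      proof -
        have n1: "1 \<le> n" using g(2)[OF n] by simp
        then have n0: "0 \<le> n - 1" by (simp add: less_eq_vec_def int_one_le_iff_zero_less)
        have n2: "0 \<le> n" by (rule vec_le_of_diff[OF _ n0]) (simp add: less_eq_vec_def)
        obtain ys where ys: "length ys = length gs" "set ys \<subseteq> assoc_graded_comp R E (n - 1)" "dot S ?xs ys = g n"
          using comp_dot[OF gs' conjunct2[OF g(2)[OF n]]] gen[OF n1] n0 n2 by (auto simp: E.F0_def)
        have ysc: "set ys \<subseteq> carrier S" using ys(2) E.comp_carrier by blast
        have "dot S zs ws \<in> Idl\<^bsub>S\<^esub> (set ?xs)" if "set zs \<subseteq> set ?xs" "set ws \<subseteq> carrier S" for zs ws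
          using that
        proof (induct zs ws rule: list_induct2')
          case (4 z zs w ws)
          have "z \<in> Idl\<^bsub>S\<^esub> (set ?xs)" using 4(2) S.genideal_self[OF xsc] by auto
          then have "z \<otimes>\<^bsub>S\<^esub> w \<in> Idl\<^bsub>S\<^esub> (set ?xs)" using 4(3) by (intro I.I_r_closed) auto
          moreover have "dot S zs ws \<in> Idl\<^bsub>S\<^esub> (set ?xs)" using 4 by auto
          ultimately show ?case unfolding dot.simps by (rule I.a_closed)
        qed (use I.zero_closed in auto)
        from this[OF subset_refl ysc] show ?thesis unfolding ys(3) .
      qed
      show "f \<in> Idl\<^bsub>S\<^esub> (set ?xs)" unfolding g(1)
        by (rule finsum_mem[OF S.abelian_monoid_axioms I.a_subset I.zero_closed I.a_closed mem])
    qed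
  qed
qed

end

section \<open>G(F) as a graded module over G(I)\<close>

locale filtration_module = filtration_action R E F + E: filtration_ring R E
  for R :: "('a, 'x) ring_scheme" (structure) and E F :: "int ^ 's::finite \<Rightarrow> 'a set"
begin

abbreviation "M \<equiv> assoc_graded R F"

lemma M_smult: "a \<in> E.reps \<Longrightarrow> b \<in> F.reps \<Longrightarrow> E.cls a \<odot>\<^bsub>M\<^esub> F.cls b = F.cls (laurent_mult R a b)"
  using mult_cls by (simp add: assoc_graded_def)

lemma M_module: "module E.S M"
proof (rule moduleI)
  show "cring E.S" by (rule E.S_cring)
  show "abelian_group M" by (rule F.assoc_graded_abelian_group)
  fix f g assume "f \<in> carrier E.S" "g \<in> carrier M"
  then obtain a b where a: "a \<in> E.reps" "f = E.cls a" and b: "b \<in> F.reps" "g = F.cls b"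
    by (elim E.cls_cases F.cls_cases)
  show "f \<odot>\<^bsub>M\<^esub> g \<in> carrier M"
    unfolding a(2) b(2) M_smult[OF a(1) b(1)] by (rule F.cls_carrier[OF laurent_mult_reps[OF a(1) b(1)]])
next
  fix f g h assume "f \<in> carrier E.S" "g \<in> carrier E.S" "h \<in> carrier M"
  then obtain a b c where a: "a \<in> E.reps" "f = E.cls a" and b: "b \<in> E.reps" "g = E.cls b"
    and c: "c \<in> F.reps" "h = F.cls c" by (elim E.cls_cases F.cls_cases)
  show "(f \<oplus>\<^bsub>E.S\<^esub> g) \<odot>\<^bsub>M\<^esub> h = f \<odot>\<^bsub>M\<^esub> h \<oplus>\<^bsub>M\<^esub> g \<odot>\<^bsub>M\<^esub> h"
    unfolding a(2) b(2) c(2) E.assoc_graded_add[OF a(1) b(1)] M_smult[OF E.reps_add[OF a(1) b(1)] c(1)]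
      M_smult[OF a(1) c(1)] M_smult[OF b(1) c(1)]
      F.assoc_graded_add[OF laurent_mult_reps[OF a(1) c(1)] laurent_mult_reps[OF b(1) c(1)]]
    by (rule arg_cong[of _ _ F.cls], rule ext)
      (rule E.laurent_mult_add_left[OF E.reps_carrier[OF a(1)] fin_suppD(2)[OF a(1)]
            E.reps_carrier[OF b(1)] fin_suppD(2)[OF b(1)] F.reps_carrier[OF c(1)]])
  show "(f \<otimes>\<^bsub>E.S\<^esub> g) \<odot>\<^bsub>M\<^esub> h = f \<odot>\<^bsub>M\<^esub> (g \<odot>\<^bsub>M\<^esub> h)"
    unfolding a(2) b(2) c(2) E.S_mult[OF a(1) b(1)] M_smult[OF b(1) c(1)]
      M_smult[OF E.laurent_mult_reps[OF a(1) b(1)] c(1)] M_smult[OF a(1) laurent_mult_reps[OF b(1) c(1)]]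
    by (subst E.laurent_mult_assoc[OF E.reps_carrier[OF a(1)] fin_suppD(2)[OF a(1)]
          E.reps_carrier[OF b(1)] fin_suppD(2)[OF b(1)] F.reps_carrier[OF c(1)]]) (rule refl)
next
  fix f g h assume "f \<in> carrier E.S" "g \<in> carrier M" "h \<in> carrier M"
  then obtain a b c where a: "a \<in> E.reps" "f = E.cls a" and b: "b \<in> F.reps" "g = F.cls b"
    and c: "c \<in> F.reps" "h = F.cls c" by (elim E.cls_cases F.cls_cases)
  show "f \<odot>\<^bsub>M\<^esub> (g \<oplus>\<^bsub>M\<^esub> h) = f \<odot>\<^bsub>M\<^esub> g \<oplus>\<^bsub>M\<^esub> f \<odot>\<^bsub>M\<^esub> h"
    unfolding a(2) b(2) c(2) F.assoc_graded_add[OF b(1) c(1)] M_smult[OF a(1) F.reps_add[OF b(1) c(1)]]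
      M_smult[OF a(1) b(1)] M_smult[OF a(1) c(1)]
      F.assoc_graded_add[OF laurent_mult_reps[OF a(1) b(1)] laurent_mult_reps[OF a(1) c(1)]]
    by (rule arg_cong[of _ _ F.cls], rule ext)
      (rule E.laurent_mult_add_right[OF E.reps_carrier[OF a(1)] F.reps_carrier[OF b(1)] F.reps_carrier[OF c(1)]])
next
  fix g assume "g \<in> carrier M"
  then obtain b where b: "b \<in> F.reps" "g = F.cls b" by (elim F.cls_cases)
  show "\<one>\<^bsub>E.S\<^esub> \<odot>\<^bsub>M\<^esub> g = g"
    unfolding b(2) E.S_one M_smult[OF E.one_reps b(1)] F.delta_one_mult[OF b(1)] ..
qed

text \<open>A monomial r t^k translates degrees by k; on representatives both sides are r b(n) t^(n
  + k).\<close>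

lemma gproj_smult:
  assumes f: "f \<in> assoc_graded_comp R E k" and g: "g \<in> carrier M"
  shows "F.gproj (n + k) (f \<odot>\<^bsub>M\<^esub> g) = f \<odot>\<^bsub>M\<^esub> F.gproj n g"
proof -
  obtain r where r: "r \<in> E.F0 k" "f = E.cls (delta R k r)" by (rule E.comp_cases[OF f])
  obtain b where b: "b \<in> F.reps" "g = F.cls b" by (rule F.cls_cases[OF g])
  have rc: "r \<in> carrier R" using r(1) E.F0_closed(1) by auto
  note d = E.reps_delta[OF r(1)]
  have db: "delta R n (b n) \<in> F.reps" by (rule F.reps_delta[OF fin_suppD(1)[OF b(1)]])
  have "delta R (n + k) (laurent_mult R (delta R k r) b (n + k)) = laurent_mult R (delta R k r) (delta R n (b n))"
  proof
    fix j
    have "laurent_mult R (delta R k r) b i = r \<otimes> b (i - k)" for i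
      by (rule E.laurent_mult_delta[OF rc]) (rule F.reps_carrier[OF b(1)])
    moreover have "laurent_mult R (delta R k r) (delta R n (b n)) j = r \<otimes> delta R n (b n) (j - k)"
      by (rule E.laurent_mult_delta[OF rc]) (rule F.reps_carrier[OF db])
    ultimately show "delta R (n + k) (laurent_mult R (delta R k r) b (n + k)) j
        = laurent_mult R (delta R k r) (delta R n (b n)) j"
      using rc by (auto simp: delta_def)
  qed
  then show ?thesis
    unfolding r(2) b(2) M_smult[OF d b(1)] F.gproj_cls M_smult[OF d db] by simp
qed

end

sublocale filtration_module \<subseteq> graded_module "assoc_graded R E" "assoc_graded R F"
  "assoc_graded_comp R E" "assoc_graded_comp R F" F.gproj
proof -
  \<comment> \<open>The ring as a module over itself: that degrees add under its multiplication is
    the same computation \<open>gproj_smult\<close>.\<close>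
  interpret EE: filtration_module R E E by unfold_locales
  interpret m: module "assoc_graded R E" "assoc_graded R F" by (rule M_module)
  show "graded_module (assoc_graded R E) (assoc_graded R F) (assoc_graded_comp R E) (assoc_graded_comp R F) F.gproj"
  proof
    show "assoc_graded_comp R E n \<subseteq> carrier (assoc_graded R E)" for n by (rule E.comp_carrier)
    show "\<one>\<^bsub>assoc_graded R E\<^esub> \<in> assoc_graded_comp R E 0"
      unfolding E.S_one by (rule E.cls_delta_comp) (simp add: E.F0_def E.one_mem)
    show "\<zero>\<^bsub>assoc_graded R E\<^esub> \<in> assoc_graded_comp R E n" for n by (rule E.zero_comp)
    show "a \<otimes>\<^bsub>assoc_graded R E\<^esub> b \<in> assoc_graded_comp R E (n + k)"
      if a: "a \<in> assoc_graded_comp R E n" and b: "b \<in> assoc_graded_comp R E k" for a b n k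
    proof -
      have bc: "b \<in> carrier (assoc_graded R E)" and ac: "a \<in> carrier (assoc_graded R E)"
        using a b E.comp_carrier by auto
      have "E.gproj (k + n) (a \<otimes>\<^bsub>assoc_graded R E\<^esub> b) = a \<otimes>\<^bsub>assoc_graded R E\<^esub> b"
        using EE.gproj_smult[OF a bc, of k] E.gproj_id[OF b] by (simp add: assoc_graded_def)
      moreover have "a \<otimes>\<^bsub>assoc_graded R E\<^esub> b \<in> carrier (assoc_graded R E)"
        by (rule cring.cring_simprules(5)[OF E.S_cring ac bc])
      ultimately show ?thesis using E.gproj_mem[of "a \<otimes>\<^bsub>assoc_graded R E\<^esub> b" "k + n"] by (simp add: add.commute)
    qed
    show "a = \<zero>\<^bsub>assoc_graded R E\<^esub>"
      if "a \<in> assoc_graded_comp R E n" "a \<in> assoc_graded_comp R E k" "n \<noteq> k" for a n k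
      by (rule E.comp_disjoint[OF that])
    show "assoc_graded_comp R F n \<subseteq> carrier (assoc_graded R F)" for n by (rule F.comp_carrier)
    show "F.gproj n \<in> add_hom (assoc_graded R F) (assoc_graded R F)" for n by (rule F.gproj_add_hom)
    show "F.gproj n f \<in> assoc_graded_comp R F n" if "f \<in> carrier (assoc_graded R F)" for f n
      by (rule F.gproj_mem[OF that])
    show "F.gproj n f = f" if "f \<in> assoc_graded_comp R F n" for f n by (rule F.gproj_id[OF that])
    show "F.gproj (n + k) (a \<odot>\<^bsub>assoc_graded R F\<^esub> f) = a \<odot>\<^bsub>assoc_graded R F\<^esub> F.gproj n f"
      if "a \<in> assoc_graded_comp R E k" "f \<in> carrier (assoc_graded R F)" for a f n k
      by (rule gproj_smult[OF that])
  qed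
qed

section \<open>Ideal powers, Nakayama, dimension\<close>

text \<open>The coset of b is one of the classes of degree n, hence equals the group of
  coboundaries; that group contains 0, so the coset contains b.\<close>

lemma (in graded_cech) cech_coboundariesI:
  assumes "cech_cohomology_comp R gR M gM xs i n = {\<zero>\<^bsub>cech_cohomology R M xs i\<^esub>}"
    and b: "b \<in> cech_cocycles R M xs i" "b \<in> Ch i n"
  shows "b \<in> cech_coboundaries R M xs i"
proof -
  interpret G: abelian_group "C i" by (rule C_group)
  let ?B = "cech_coboundaries R M xs i"
  have "?B +>\<^bsub>C i\<^esub> b = ?B"
    using assms by (auto simp: cech_cohomology_comp_def cech_cohomology_def Let_def)
  moreover have "\<zero>\<^bsub>C i\<^esub> \<in> ?B"
  proof (cases i)
    case (Suc j)
    interpret G': abelian_group "C j" by (rule C_group)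
    have "cech_diff R M xs j \<zero>\<^bsub>C j\<^esub> = \<zero>\<^bsub>C (Suc j)\<^esub>"
      by (rule add_hom_zero[OF C_group C_group cech_diff_add_hom[OF xs]])
    then show ?thesis unfolding Suc cech_coboundaries_def nat.case using G'.zero_closed by (metis imageI)
  qed (simp add: cech_coboundaries_def)
  moreover have "b \<in> carrier (C i)" using b(2) Ch_carrier by blast
  ultimately show ?thesis by (force simp: a_r_coset_def')
qed

lemma (in semiring) dot_zeros:
  "set ws \<subseteq> carrier R \<Longrightarrow> dot R ws (replicate (length ws) \<zero>) = \<zero>"
  by (induct ws) auto

section \<open>Products and powers of ideals\<close>

context cring
begin

text \<open>The combinations W of gs with coefficients in Q are closed under addition, so the
  elements a with a Q \<subseteq> W form an ideal T. It contains gs, hence the ideal generated by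
  gs, and therefore all the products lie in W.\<close>

lemma ideal_generators_dot:
  assumes A: "set gs \<subseteq> carrier R" and Q: "ideal Q R" and r: "r \<in> (Idl (set gs)) \<cdot> Q"
  shows "\<exists>qs. length qs = length gs \<and> set qs \<subseteq> Q \<and> dot R gs qs = r"
proof -
  interpret Q: ideal Q R by (rule Q)
  define W where "W = {dot R gs qs | qs. length qs = length gs \<and> set qs \<subseteq> Q}"
  have W_add: "x \<oplus> y \<in> W" if "x \<in> W" "y \<in> W" for x y
  proof -
    obtain qs qs' where q: "x = dot R gs qs" "length qs = length gs" "set qs \<subseteq> Q"
      "y = dot R gs qs'" "length qs' = length gs" "set qs' \<subseteq> Q" using \<open>x \<in> W\<close> \<open>y \<in> W\<close> by (auto simp: W_def)
    have "length gs = length qs" "length qs = length qs'" using q by auto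
    then have "\<exists>ps. length ps = length gs \<and> set ps \<subseteq> Q \<and> dot R gs ps = dot R gs qs \<oplus> dot R gs qs'"
      using q(3,6) A
    proof (induct gs qs qs' rule: list_induct3)
      case (Cons g gs q qs p ps)
      then obtain rs where rs: "length rs = length gs" "set rs \<subseteq> Q" "dot R gs rs = dot R gs qs \<oplus> dot R gs ps"
        by auto
      have "set qs \<subseteq> carrier R" "set ps \<subseteq> carrier R" "set gs \<subseteq> carrier R"
        using Cons.prems Q.a_subset by auto
      then have c: "dot R gs qs \<in> carrier R" "dot R gs ps \<in> carrier R" by (auto intro: dot_closed)
      have c': "g \<in> carrier R" "q \<in> carrier R" "p \<in> carrier R" "q \<in> Q" "p \<in> Q"
        using Cons.prems Q.a_subset by auto
      show ?case using rs c c'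
        by (intro exI[of _ "(q \<oplus> p) # rs"]) (auto simp: r_distr a_ac)
    qed auto
    then obtain ps where ps: "length ps = length gs" "set ps \<subseteq> Q" "dot R gs ps = x \<oplus> y"
      unfolding q(1,4) by blast
    show ?thesis unfolding W_def ps(3)[symmetric] using ps(1,2) by blast
  qed
  have W_mem: "g \<otimes> q \<in> W" if "g \<in> set gs" "q \<in> Q" for g q
  proof -
    have q: "q \<in> carrier R" using \<open>q \<in> Q\<close> Q.a_subset by auto
    have "\<exists>ps. length ps = length gs \<and> set ps \<subseteq> Q \<and> dot R gs ps = g \<otimes> q" using that(1) A
    proof (induct gs)
      case (Cons h gs)
      have hg: "h \<in> carrier R" "set gs \<subseteq> carrier R" "g \<in> carrier R" using Cons.prems by auto
      show ?case
      proof (cases "h = g")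
        case True
        then show ?thesis using hg q dot_zeros[OF hg(2)] \<open>q \<in> Q\<close>
          by (intro exI[of _ "q # replicate (length gs) \<zero>"]) auto
      next
        case False
        then have "g \<in> set gs" using Cons.prems by auto
        then obtain ps where "length ps = length gs" "set ps \<subseteq> Q" "dot R gs ps = g \<otimes> q"
          using Cons.hyps hg by blast
        then show ?thesis using hg q by (intro exI[of _ "\<zero> # ps"]) auto
      qed
    qed auto
    then obtain ps where ps: "length ps = length gs" "set ps \<subseteq> Q" "dot R gs ps = g \<otimes> q" by blast
    show ?thesis unfolding W_def ps(3)[symmetric] using ps(1,2) by blast
  qed
  have W_zero: "\<zero> \<in> W"
    unfolding W_def using dot_zeros[OF A] by (auto intro!: exI[of _ "replicate (length gs) \<zero>"])
  define T where "T = {a \<in> carrier R. \<forall>q\<in>Q. a \<otimes> q \<in> W}"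
  have "ideal T R"
  proof (rule idealI)
    show "ring R" by (rule ring_axioms)
    have Qc: "q \<in> carrier R" if "q \<in> Q" for q using that Q.a_subset by auto
    have l: "x \<otimes> a \<in> T" if "a \<in> T" "x \<in> carrier R" for a x
    proof -
      \<comment> \<open>W is not yet known to absorb scalars; the factor x is absorbed by Q
        instead.\<close>
      have "x \<otimes> a \<otimes> q = a \<otimes> (x \<otimes> q)" if "q \<in> Q" for q
        using \<open>a \<in> T\<close> \<open>x \<in> carrier R\<close> Qc[OF that] by (auto simp: T_def m_ac)
      then show ?thesis using that Q.I_l_closed by (auto simp: T_def)
    qed
    then show "x \<otimes> a \<in> T" "a \<otimes> x \<in> T" if "a \<in> T" "x \<in> carrier R" for a x
      using l[OF that] that by (auto simp: m_comm T_def)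
    show "subgroup T (add_monoid R)"
    proof (rule add.subgroupI)
      show "T \<subseteq> carrier R" by (auto simp: T_def)
      have "\<zero> \<in> T" using W_zero Qc by (auto simp: T_def)
      then show "T \<noteq> {}" by blast
      fix a assume a: "a \<in> T"
      have "(\<ominus> \<one>) \<otimes> a \<in> T" by (rule l[OF a]) simp
      then show "\<ominus> a \<in> T" using a by (simp add: T_def l_minus)
      fix b assume b: "b \<in> T"
      show "a \<oplus> b \<in> T" using a b W_add Qc by (auto simp: T_def l_distr)
    qed
  qed
  moreover have "set gs \<subseteq> T" using A W_mem by (auto simp: T_def)
  ultimately have sub: "Idl (set gs) \<subseteq> T" by (rule genideal_minimal)
  have "r \<in> W" using r
  proof (induct rule: ideal_prod.induct)
    case (prod a q)
    then show ?case using sub by (auto simp: T_def)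
  qed (rule W_add)
  then show ?thesis unfolding W_def by blast
qed

lemma ideal_prod_mono:
  assumes "I \<subseteq> I'" "J \<subseteq> J'" shows "I \<cdot> J \<subseteq> I' \<cdot> J'"
proof
  fix x assume "x \<in> I \<cdot> J"
  then show "x \<in> I' \<cdot> J'"
    by (induct rule: ideal_prod.induct) (use assms in \<open>auto intro: ideal_prod.intros\<close>)
qed

lemma ideals_set_simps:
  "carrier (ideals_set R) = {J. ideal J R}" "monoid.mult (ideals_set R) = ideal_prod R" "\<one>\<^bsub>ideals_set R\<^esub> = carrier R"
  by (simp_all add: ideals_set_def)

lemma ideal_power_ideal:
  assumes "\<And>i. ideal (I i) R" shows "ideal (ideal_power R I n) R"
proof -
  interpret P: Group.comm_monoid "ideals_set R" by (rule ideals_set_is_comm_monoid)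
  have "ideal_power R I n \<in> carrier (ideals_set R)"
    unfolding ideal_power_def using assms by (intro P.finprod_closed) (auto simp: ideals_set_simps intro!: P.nat_pow_closed[unfolded ideals_set_simps mem_Collect_eq])
  then show ?thesis by (simp add: ideals_set_simps)
qed

text \<open>Exponents are truncated at 0, so additivity is confined to nonnegative degrees.\<close>

lemma ideal_power_add:
  assumes I: "\<And>i. ideal (I i) R" and n: "0 \<le> n" "0 \<le> k"
  shows "ideal_power R I (n + k) = ideal_power R I n \<cdot> ideal_power R I k"
proof -
  interpret P: Group.comm_monoid "ideals_set R" by (rule ideals_set_is_comm_monoid)
  have Ic: "I i \<in> carrier (ideals_set R)" for i using I by (simp add: ideals_set_simps)
  have pc: "I i [^]\<^bsub>ideals_set R\<^esub> k \<in> carrier (ideals_set R)" for i and k :: nat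
    by (rule P.nat_pow_closed[OF Ic])
  have "I i [^]\<^bsub>ideals_set R\<^esub> nat ((n + k) $ i)
      = I i [^]\<^bsub>ideals_set R\<^esub> nat (n $ i) \<otimes>\<^bsub>ideals_set R\<^esub> I i [^]\<^bsub>ideals_set R\<^esub> nat (k $ i)" for i
  proof -
    have "nat ((n + k) $ i) = nat (n $ i) + nat (k $ i)"
      using n by (simp add: less_eq_vec_def nat_add_distrib)
    then show ?thesis by (simp only: P.nat_pow_mult[OF Ic])
  qed
  then have "ideal_power R I (n + k) = (\<Otimes>\<^bsub>ideals_set R\<^esub> i \<in> UNIV.
      I i [^]\<^bsub>ideals_set R\<^esub> nat (n $ i) \<otimes>\<^bsub>ideals_set R\<^esub> I i [^]\<^bsub>ideals_set R\<^esub> nat (k $ i))"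
    unfolding ideal_power_def by (simp only:)
  also have "\<dots> = ideal_power R I n \<otimes>\<^bsub>ideals_set R\<^esub> ideal_power R I k"
    unfolding ideal_power_def by (rule P.finprod_multf) (use pc in auto)
  finally show ?thesis by (simp add: ideals_set_simps)
qed

lemma ideal_power_zero:
  assumes "\<And>i. ideal (I i) R" shows "ideal_power R I 0 = carrier R"
proof -
  interpret P: Group.comm_monoid "ideals_set R" by (rule ideals_set_is_comm_monoid)
  have "ideal_power R I 0 = \<one>\<^bsub>ideals_set R\<^esub>"
    unfolding ideal_power_def by (rule P.finprod_one_eqI) simp
  then show ?thesis by (simp add: ideals_set_simps)
qed

lemma ideal_power_one_subset:
  assumes I: "\<And>i. ideal (I i) R" shows "ideal_power R I 1 \<subseteq> I i"
proof -
  interpret P: Group.comm_monoid "ideals_set R" by (rule ideals_set_is_comm_monoid)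
  have Ic: "I i \<in> carrier (ideals_set R)" for i using I by (simp add: ideals_set_simps)
  have eq: "I i [^]\<^bsub>ideals_set R\<^esub> nat ((1 :: int ^ 'd) $ j) = I i" for i and j :: "'d::finite"
  proof -
    have "nat ((1 :: int ^ 'd) $ j) = Suc 0" by simp
    then show ?thesis by (simp only: P.nat_pow_Suc P.nat_pow_0 P.l_one[OF Ic])
  qed
  have "ideal_power R I 1 = (\<Otimes>\<^bsub>ideals_set R\<^esub> i \<in> insert i (UNIV - {i}). I i)"
    unfolding ideal_power_def eq by (simp add: insert_UNIV)
  also have "\<dots> = I i \<otimes>\<^bsub>ideals_set R\<^esub> (\<Otimes>\<^bsub>ideals_set R\<^esub> i \<in> UNIV - {i}. I i)"
    using Ic by (intro P.finprod_insert) auto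
  also have "\<dots> = I i \<cdot> (\<Otimes>\<^bsub>ideals_set R\<^esub> i \<in> UNIV - {i}. I i)" by (simp add: ideals_set_simps)
  also have "\<dots> \<subseteq> I i"
  proof -
    have "(\<Otimes>\<^bsub>ideals_set R\<^esub> i \<in> UNIV - {i}. I i) \<in> carrier (ideals_set R)"
      using Ic by (intro P.finprod_closed) auto
    then show ?thesis using ideal_prod_inter[OF I, of _ i] by (auto simp: ideals_set_simps)
  qed
  finally show ?thesis .
qed

text \<open>Powers of a lying in the single factors multiply to a power of a in the product.\<close>

lemma ideal_power_contains_pow:
  assumes I: "\<And>i. ideal (I i) R" and a: "a \<in> carrier R" and pow: "\<And>i. \<exists>k::nat. a [^] k \<in> I i"
  shows "\<exists>k::nat. a [^] k \<in> ideal_power R I n"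
proof -
  interpret P: Group.comm_monoid "ideals_set R" by (rule ideals_set_is_comm_monoid)
  have Ic: "I i \<in> carrier (ideals_set R)" for i using I by (simp add: ideals_set_simps)
  have 1: "\<exists>k::nat. a [^] k \<in> I i [^]\<^bsub>ideals_set R\<^esub> (e::nat)" for i e
  proof (induct e)
    case 0
    have "a [^] (0::nat) \<in> I i [^]\<^bsub>ideals_set R\<^esub> (0::nat)" by (simp add: ideals_set_simps)
    then show ?case by blast
  next
    case (Suc e)
    obtain k l :: nat where "a [^] k \<in> I i [^]\<^bsub>ideals_set R\<^esub> e" "a [^] l \<in> I i" using Suc pow by blast
    then have "a [^] k \<otimes> a [^] l \<in> (I i [^]\<^bsub>ideals_set R\<^esub> e) \<cdot> I i" by (rule ideal_prod.prod)
    then have "a [^] (k + l) \<in> I i [^]\<^bsub>ideals_set R\<^esub> Suc e" using a by (simp add: nat_pow_mult ideals_set_simps)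
    then show ?case by blast
  qed
  have "\<exists>k::nat. a [^] k \<in> (\<Otimes>\<^bsub>ideals_set R\<^esub> i \<in> A. I i [^]\<^bsub>ideals_set R\<^esub> nat (n $ i))" if "finite A" for A
    using that
  proof (induct A)
    case empty
    have "a [^] (0::nat) \<in> (\<Otimes>\<^bsub>ideals_set R\<^esub> i \<in> {}. I i [^]\<^bsub>ideals_set R\<^esub> nat (n $ i))"
      by (simp add: ideals_set_simps)
    then show ?case by blast
  next
    case (insert i A)
    obtain k l :: nat where "a [^] l \<in> (\<Otimes>\<^bsub>ideals_set R\<^esub> i \<in> A. I i [^]\<^bsub>ideals_set R\<^esub> nat (n $ i))"
      "a [^] k \<in> I i [^]\<^bsub>ideals_set R\<^esub> nat (n $ i)" using insert 1 by blast
    then have "a [^] k \<otimes> a [^] l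
      \<in> (I i [^]\<^bsub>ideals_set R\<^esub> nat (n $ i)) \<cdot> (\<Otimes>\<^bsub>ideals_set R\<^esub> i \<in> A. I i [^]\<^bsub>ideals_set R\<^esub> nat (n $ i))"
      by (intro ideal_prod.prod)
    moreover have "(\<Otimes>\<^bsub>ideals_set R\<^esub> i \<in> insert i A. I i [^]\<^bsub>ideals_set R\<^esub> nat (n $ i))
      = I i [^]\<^bsub>ideals_set R\<^esub> nat (n $ i) \<otimes>\<^bsub>ideals_set R\<^esub> (\<Otimes>\<^bsub>ideals_set R\<^esub> i \<in> A. I i [^]\<^bsub>ideals_set R\<^esub> nat (n $ i))"
      using insert.hyps Ic by (intro P.finprod_insert) (auto intro!: P.nat_pow_closed)
    ultimately have "a [^] (k + l) \<in> (\<Otimes>\<^bsub>ideals_set R\<^esub> i \<in> insert i A. I i [^]\<^bsub>ideals_set R\<^esub> nat (n $ i))"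
      using a by (simp add: nat_pow_mult ideals_set_simps)
    then show ?case by blast
  qed
  then show ?thesis unfolding ideal_power_def by simp
qed

end

section \<open>Noetherian rings and Nakayama's lemma\<close>

lemma (in noetherian_ring) maximal_ideal_in_family:
  assumes "\<A> \<noteq> {}" "\<And>K. K \<in> \<A> \<Longrightarrow> ideal K R"
  shows "\<exists>K\<in>\<A>. \<forall>K'\<in>\<A>. K \<subseteq> K' \<longrightarrow> K' = K"
proof (rule subset_Zorn)
  fix \<C> assume c: "subset.chain \<A> \<C>"
  show "\<exists>U\<in>\<A>. \<forall>X\<in>\<C>. X \<subseteq> U"
  proof (cases "\<C> = {}")
    case True
    then show ?thesis using assms(1) by auto
  next
    case False
    have "subset.chain {J. ideal J R} \<C>" using c assms(2) by (auto simp: subset.chain_def)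
    then have "\<Union>\<C> \<in> \<C>" by (rule ideal_chain_is_trivial[OF False])
    then show ?thesis using c by (auto simp: subset.chain_def)
  qed
qed

text \<open>Take K maximal among the ideals properly inside J. Then J = K + (g) for any g in J
  outside K, so m J \<subseteq> K + m g and g = k + a g with k in K and a in m. Thus 1 - a lies in
  the colon ideal (K : g), which is proper and so contained in m; then 1 lies in m.\<close>

lemma nakayama:
  fixes R (structure)
  assumes "noetherian_ring R" "local_ring R m" and J: "ideal J R" "J \<subseteq> m \<cdot> J"
  shows "J = {\<zero>}"
proof (rule ccontr)
  assume J0: "J \<noteq> {\<zero>}"
  interpret noetherian_ring R by fact
  interpret R: cring R using assms(2) by (simp add: local_ring_def)
  have m: "maximalideal m R" and uniq: "\<And>K. maximalideal K R \<Longrightarrow> K = m"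
    using assms(2) by (auto simp: local_ring_def)
  interpret m: maximalideal m R by (rule m)
  interpret J: ideal J R by (rule J(1))
  have "{\<zero>} \<subset> J" using J0 J.zero_closed by auto
  let ?A = "{K. ideal K R \<and> K \<subset> J}"
  have "{\<zero>} \<in> ?A" using \<open>{\<zero>} \<subset> J\<close> zeroideal by simp
  then have "?A \<noteq> {}" by blast
  then have "\<exists>K\<in>?A. \<forall>K'\<in>?A. K \<subseteq> K' \<longrightarrow> K' = K" by (rule maximal_ideal_in_family) simp
  then obtain K where KA: "K \<in> ?A" and Km: "\<forall>K'\<in>?A. K \<subseteq> K' \<longrightarrow> K' = K" by (rule bexE)
  have K: "ideal K R" "K \<subset> J" using KA by simp_all
  have Kmax: "K' = K" if "ideal K' R" "K' \<subset> J" "K \<subseteq> K'" for K'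
    using bspec[OF Km, of K'] that by simp
  interpret K: ideal K R by (rule K(1))
  obtain g where g: "g \<in> J" "g \<notin> K" using K(2) by blast
  have gc: "g \<in> carrier R" using g J.a_subset by auto
  have W: "y \<in> K <+>\<^bsub>R\<^esub> PIdl g" if "y \<in> J" for y
  proof -
    have Wi: "ideal (K <+>\<^bsub>R\<^esub> PIdl g) R" by (rule add_ideals[OF K(1) R.cgenideal_ideal[OF gc]])
    have "K \<subseteq> K <+>\<^bsub>R\<^esub> PIdl g"
    proof
      fix k assume k: "k \<in> K"
      have "k \<oplus> \<zero> \<in> K <+>\<^bsub>R\<^esub> PIdl g"
        using k ideal.axioms(1)[OF R.cgenideal_ideal[OF gc], THEN additive_subgroup.zero_closed]
        unfolding set_add_def' by blast
      then show "k \<in> K <+>\<^bsub>R\<^esub> PIdl g" using k K.a_subset by auto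
    qed
    moreover have "g \<in> K <+>\<^bsub>R\<^esub> PIdl g"
    proof -
      have "\<zero> \<oplus> g \<in> K <+>\<^bsub>R\<^esub> PIdl g" using K.zero_closed cgenideal_self[OF gc] unfolding set_add_def' by blast
      then show ?thesis using gc by simp
    qed
    moreover have "K <+>\<^bsub>R\<^esub> PIdl g \<subseteq> J"
    proof -
      have "PIdl g \<subseteq> J" by (rule cgenideal_minimal[OF J(1) g(1)])
      then show ?thesis using K(2) J.a_closed unfolding set_add_def' by blast
    qed
    ultimately show ?thesis using Kmax[OF Wi] g(2) that by blast
  qed
  define V where "V = {k \<oplus> a \<otimes> g | k a. k \<in> K \<and> a \<in> m}"
  have V_add: "x \<oplus> y \<in> V" if "x \<in> V" "y \<in> V" for x y
  proof -
    obtain k a k' a' where e: "x = k \<oplus> a \<otimes> g" "k \<in> K" "a \<in> m" "y = k' \<oplus> a' \<otimes> g" "k' \<in> K" "a' \<in> m"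
      using \<open>x \<in> V\<close> \<open>y \<in> V\<close> by (auto simp: V_def)
    have c: "k \<in> carrier R" "k' \<in> carrier R" "a \<in> carrier R" "a' \<in> carrier R"
      using e K.a_subset m.a_subset by auto
    have "x \<oplus> y = (k \<oplus> k') \<oplus> (a \<oplus> a') \<otimes> g" unfolding e(1,4) using c gc by (simp add: l_distr a_ac)
    then show ?thesis using K.a_closed[OF e(2,5)] m.a_closed[OF e(3,6)] by (auto simp: V_def)
  qed
  have "x \<in> V" if "x \<in> m \<cdot> J" for x
    using that
  proof (induct rule: ideal_prod.induct)
    case (prod a y)
    obtain k r where k: "k \<in> K" "r \<in> carrier R" "y = k \<oplus> r \<otimes> g"
      using W[OF prod(2)] unfolding set_add_def' cgenideal_def by auto
    have c: "a \<in> carrier R" "k \<in> carrier R" using prod k K.a_subset m.a_subset by auto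
    have "a \<otimes> y = a \<otimes> k \<oplus> (a \<otimes> r) \<otimes> g" unfolding k(3) using c k gc by (simp add: r_distr m_assoc)
    moreover have "a \<otimes> k \<in> K" by (rule K.I_l_closed[OF k(1) c(1)])
    moreover have "a \<otimes> r \<in> m" by (rule m.I_r_closed[OF prod(1) k(2)])
    ultimately show ?case by (auto simp: V_def)
  qed (rule V_add)
  then have "g \<in> V" using g(1) J(2) by blast
  then obtain k a where k: "k \<in> K" "a \<in> m" "g = k \<oplus> a \<otimes> g" by (auto simp: V_def)
  have c: "k \<in> carrier R" "a \<in> carrier R" using k K.a_subset m.a_subset by auto
  have "(\<one> \<ominus> a) \<otimes> g = g \<ominus> a \<otimes> g" using c gc by (simp add: minus_eq l_distr l_minus)
  also have "\<dots> = (k \<oplus> a \<otimes> g) \<ominus> a \<otimes> g" using k(3) by simp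
  also have "\<dots> = k" using c gc by (simp add: minus_eq a_assoc r_neg)
  finally have 1: "(\<one> \<ominus> a) \<otimes> g = k" .
  \<comment> \<open>The colon ideal (K : g), proper because g is outside K.\<close>
  define T where "T = {x \<in> carrier R. x \<otimes> g \<in> K}"
  have T: "ideal T R"
  proof (rule idealI)
    show "ring R" by (rule ring_axioms)
    show "x \<otimes> b \<in> T" if "b \<in> T" "x \<in> carrier R" for b x
      using that K.I_l_closed gc by (auto simp: T_def m_assoc)
    then show "b \<otimes> x \<in> T" if "b \<in> T" "x \<in> carrier R" for b x
      using that by (auto simp: R.m_comm T_def)
    show "subgroup T (add_monoid R)"
      by (rule add.subgroupI) (use gc K.zero_closed in \<open>auto simp: T_def l_distr l_minus intro!: exI[of _ "\<zero>"]\<close>)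
  qed
  have "\<one> \<notin> T" using g(2) gc by (simp add: T_def)
  \<comment> \<open>A maximal ideal above T, obtained from the chain condition; by locality it is
    m.\<close>
  let ?B = "{K. ideal K R \<and> T \<subseteq> K \<and> \<one> \<notin> K}"
  have "T \<in> ?B" using T \<open>\<one> \<notin> T\<close> by simp
  then have "?B \<noteq> {}" by blast
  then have "\<exists>K\<in>?B. \<forall>K'\<in>?B. K \<subseteq> K' \<longrightarrow> K' = K" by (rule maximal_ideal_in_family) simp
  then obtain P where PB: "P \<in> ?B" and Pm: "\<forall>K'\<in>?B. P \<subseteq> K' \<longrightarrow> K' = P" by (rule bexE)
  have P: "ideal P R" "T \<subseteq> P" "\<one> \<notin> P" using PB by simp_all
  have Pmax: "K' = P" if "ideal K' R" "T \<subseteq> K'" "\<one> \<notin> K'" "P \<subseteq> K'" for K'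
    using bspec[OF Pm, of K'] that by simp
  have "maximalideal P R"
  proof (rule maximalidealI[OF P(1)])
    show "carrier R \<noteq> P" using P(3) by auto
    show "K' = P \<or> K' = carrier R" if K': "ideal K' R" "P \<subseteq> K'" "K' \<subseteq> carrier R" for K'
      using Pmax[OF K'(1) _ _ K'(2)] P(2) K'(2) ideal.one_imp_carrier[OF K'(1)] by blast
  qed
  then have "P = m" by (rule uniq)
  moreover have "\<one> \<ominus> a \<in> T" using 1 k(1) c by (simp add: T_def)
  ultimately have "\<one> \<ominus> a \<in> m" using P(2) by auto
  then have "(\<one> \<ominus> a) \<oplus> a \<in> m" using k(2) by (rule m.a_closed)
  moreover have "(\<one> \<ominus> a) \<oplus> a = \<one>" using c by (simp add: minus_eq a_assoc l_neg)
  ultimately show False using \<open>P = m\<close> P(3) by simp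
qed

section \<open>Prime ideals, dimension zero, and the additive structure of the Rees module\<close>

lemma prime_pow_mem:
  fixes R (structure)
  assumes "primeideal P R" "a \<in> carrier R" "a [^] (k::nat) \<in> P"
  shows "a \<in> P"
proof -
  interpret primeideal P R by fact
  show ?thesis using assms(3)
  proof (induct k)
    case 0
    then have "P = carrier R" using one_imp_carrier by simp
    then show ?case using I_notcarr by simp
  next
    case (Suc k)
    then show ?case using I_prime[of "a [^] k" a] assms(2) by auto
  qed
qed

text \<open>A strictly increasing chain with two members would contain m twice.\<close>

lemma krull_dim_zero:
  assumes "\<And>P. primeideal P R \<Longrightarrow> P = m"
  shows "krull_dim R = 0"
proof -
  have "enat (length Ps - 1) \<le> 0"
    if "\<forall>P\<in>set Ps. primeideal P R" "sorted_wrt (\<subset>) Ps" for Ps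
  proof (rule ccontr)
    assume "\<not> ?thesis"
    then have "1 < length Ps" by (auto simp: zero_enat_def)
    then have "Ps ! 0 \<subset> Ps ! 1" using that(2) by (simp add: sorted_wrt_iff_nth_less)
    moreover have "Ps ! i = m" if "i < 2" for i
      by (rule assms, rule bspec[OF \<open>\<forall>P\<in>set Ps. primeideal P R\<close>], rule nth_mem)
        (use that \<open>1 < length Ps\<close> in linarith)
    ultimately show False by simp
  qed
  then have "krull_dim R \<le> 0" unfolding krull_dim_def by (intro SUP_least) auto
  then show ?thesis by simp
qed

text \<open>Allows calculation with the \<open>finsum\<close> in which \<open>finite_module\<close>
  states finite generation.\<close>

lemma (in cring) rees_abelian_monoid:
  assumes F: "\<And>n. ideal (F n) R"
  shows "abelian_monoid (rees R F)"
proof (rule abelian_monoidI)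
  have cl: "F n \<subseteq> carrier R" "\<zero> \<in> F n" "x \<in> F n \<Longrightarrow> y \<in> F n \<Longrightarrow> x \<oplus> y \<in> F n" for n x y
  proof -
    interpret ideal "F n" R by (rule F)
    show "F n \<subseteq> carrier R" "\<zero> \<in> F n" "x \<in> F n \<Longrightarrow> y \<in> F n \<Longrightarrow> x \<oplus> y \<in> F n" using a_subset by auto
  qed
  have car: "carrier (rees R F) = fin_supp R F" by (simp add: rees_def fin_supp_def)
  show "\<zero>\<^bsub>rees R F\<^esub> \<in> carrier (rees R F)" using cl by (simp add: rees_def)
  fix a b c assume abc: "a \<in> carrier (rees R F)" "b \<in> carrier (rees R F)" "c \<in> carrier (rees R F)"
  have e: "a n \<in> carrier R" "b n \<in> carrier R" "c n \<in> carrier R" for n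
    using abc fin_suppD(1) cl(1) unfolding car by blast+
  show "a \<oplus>\<^bsub>rees R F\<^esub> b \<in> carrier (rees R F)"
    using fin_supp_add[OF abc(1,2)[unfolded car]] cl by (simp add: car) (simp add: rees_def)
  show "a \<oplus>\<^bsub>rees R F\<^esub> b \<oplus>\<^bsub>rees R F\<^esub> c = a \<oplus>\<^bsub>rees R F\<^esub> (b \<oplus>\<^bsub>rees R F\<^esub> c)"
    using e by (simp add: rees_def a_assoc)
  show "\<zero>\<^bsub>rees R F\<^esub> \<oplus>\<^bsub>rees R F\<^esub> a = a" using e by (simp add: rees_def)
  show "a \<oplus>\<^bsub>rees R F\<^esub> b = b \<oplus>\<^bsub>rees R F\<^esub> a" using e by (simp add: rees_def a_comm)
qed

section \<open>Regularity of the associated graded module\<close>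

context cring
begin

lemma ideal_power_dec:
  fixes n k :: "int ^ 's::finite"
  assumes I: "\<And>i. ideal (I i) R" and n: "0 \<le> n" "n \<le> k"
  shows "ideal_power R I k \<subseteq> ideal_power R I n"
proof -
  have "0 \<le> k - n" using n by (simp add: less_eq_vec_def)
  then have "ideal_power R I (n + (k - n)) = ideal_power R I n \<cdot> ideal_power R I (k - n)"
    by (rule ideal_power_add[where I = I, OF I n(1)])
  then show ?thesis using ideal_prod_inter[OF ideal_power_ideal[where I = I, OF I] ideal_power_ideal[where I = I, OF I]] by auto
qed

text \<open>The inclusions I^n \<subseteq> F(n) and F(n) F(k) \<subseteq> F(n + k) together make I^n
  carry F(k) into F(n + k).\<close>

lemma filtration_module_ideal_power:
  fixes F :: "int ^ 's::finite \<Rightarrow> 'a set"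
  assumes I: "\<And>i. ideal (I i) R" and F: "filtration R I F"
  shows "filtration_module R (ideal_power R I) F"
proof -
  have up: "n \<le> n + 1" for n :: "int ^ 's" by (simp add: less_eq_vec_def)
  have EE: "a \<otimes> b \<in> ideal_power R I (n + k)"
    if "0 \<le> n" "0 \<le> k" "a \<in> ideal_power R I n" "b \<in> ideal_power R I k" for n k :: "int ^ 's" and a b
    unfolding ideal_power_add[where I = I, OF I that(1,2)] using that by (intro ideal_prod.prod)
  have EF: "a \<otimes> b \<in> F (n + k)" if "a \<in> ideal_power R I n" "b \<in> F k" for n k a b
  proof -
    have "a \<in> F n" using F that(1) by (auto simp: filtration_def)
    then have "a \<otimes> b \<in> F n \<cdot> F k" using that(2) by (rule ideal_prod.prod)
    moreover have "F n \<cdot> F k \<subseteq> F (n + k)" using F by (simp add: filtration_def)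
    ultimately show ?thesis by blast
  qed
  have E_fam: "ideal_family R (ideal_power R I)"
  proof (rule ideal_family.intro[OF cring_axioms], rule ideal_family_axioms.intro)
    show "ideal (ideal_power R I n) R" for n by (rule ideal_power_ideal[where I = I, OF I])
    show "ideal_power R I (n + 1) \<subseteq> ideal_power R I n" if "0 \<le> n" for n :: "int ^ 's"
      by (rule ideal_power_dec[where I = I, OF I that up])
  qed
  have F_fam: "ideal_family R F"
  proof (rule ideal_family.intro[OF cring_axioms], rule ideal_family_axioms.intro)
    show "ideal (F n) R" for n using F by (simp add: filtration_def)
    show "F (n + 1) \<subseteq> F n" for n using F up by (auto simp: filtration_def)
  qed
  have "filtration_action R (ideal_power R I) F"
    by (rule filtration_action.intro[OF E_fam F_fam], rule filtration_action_axioms.intro) (rule EF)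
  moreover have "filtration_action R (ideal_power R I) (ideal_power R I)"
    by (rule filtration_action.intro[OF E_fam E_fam], rule filtration_action_axioms.intro) (rule EE)
  moreover have "\<one> \<in> ideal_power R I 0" unfolding ideal_power_zero[where I = I, OF I] by simp
  ultimately show ?thesis
    by (intro filtration_module.intro filtration_ring.intro filtration_ring_axioms.intro)
qed

text \<open>Finitely many generators of the Rees module have exponents bounded by t in every
  coordinate. In degree c + (t, ..., t) a nonzero component of a generator is thus multiplied by a
  coefficient from I^j with j \<ge> c, and I^j \<subseteq> I^c.\<close>

lemma filtration_shift_subset:
  fixes F :: "int ^ 's::finite \<Rightarrow> 'a set" and c :: "int ^ 's"
  assumes I: "\<And>i. ideal (I i) R" and F: "filtration R I F"
    and fin: "finite_module (rees R (ideal_power R I)) (rees R F)" and c: "0 \<le> c"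
  shows "\<exists>t::nat. F (c + int t *s 1) \<subseteq> ideal_power R I c"
proof -
  let ?E = "ideal_power R I"
  have Fi: "ideal (F n) R" and EF: "?E n \<subseteq> F n" and FF: "F n \<cdot> F k \<subseteq> F (n + k)" for n k
    using F by (auto simp: filtration_def)
  have Fc: "F n \<subseteq> carrier R" for n
    using Fi[of n] by (simp add: additive_subgroup.a_subset ideal.axioms(1))
  interpret M: abelian_monoid "rees R F" by (rule rees_abelian_monoid[OF Fi])
  interpret K: ideal "?E c" R by (rule ideal_power_ideal[where I = I, OF I])
  obtain A where A: "finite A" "A \<subseteq> carrier (rees R F)"
    and gen: "\<And>x. x \<in> carrier (rees R F) \<Longrightarrow> \<exists>f. (\<forall>a\<in>A. f a \<in> carrier (rees R ?E))
       \<and> x = (\<Oplus>\<^bsub>rees R F\<^esub> a \<in> A. f a \<odot>\<^bsub>rees R F\<^esub> a)"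
    using fin unfolding finite_module_def by blast
  have car: "carrier (rees R G) = fin_supp R G" for G :: "int ^ 's \<Rightarrow> 'a set"
    by (simp add: rees_def fin_supp_def)
  have As: "a n \<in> carrier R" "finite {n. a n \<noteq> \<zero>}" if "a \<in> A" for a n
    using A(2) that fin_suppD[of a R F] Fc unfolding car by blast+
  let ?U = "\<Union>a\<in>A. (\<lambda>(k, i). k $ i) ` ({n. a n \<noteq> \<zero>} \<times> UNIV)"
  have finU: "finite ?U" using A(1) As(2) by auto
  obtain N :: int where N: "\<forall>u\<in>?U. u \<le> N"
    using bdd_above_finite[OF finU] unfolding bdd_above_def by (rule exE)
  \<comment> \<open>A negative bound N becomes 0, which still bounds every coordinate from
    above.\<close>
  define t where "t = nat N"
  let ?n = "c + int t *s 1"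
  have supp: "0 \<le> ?n - k - c" if "a \<in> A" "a k \<noteq> \<zero>" for a k
  proof -
    have "k $ i \<le> int t" for i
    proof -
      have "k $ i \<in> ?U"
        by (rule UN_I[OF that(1)], rule image_eqI[of _ _ "(k, i)"]) (use that in auto)
      with N have "k $ i \<le> N" by (rule bspec)
      then show ?thesis by (simp add: t_def)
    qed
    then show ?thesis by (simp add: less_eq_vec_def)
  qed
  have "r \<in> ?E c" if r: "r \<in> F ?n" for r
  proof -
    let ?x = "delta R ?n r"
    have F0: "\<zero> \<in> F k" for k
      using Fi[of k] by (simp add: additive_subgroup.zero_closed ideal.axioms(1))
    have "{k. ?x k \<noteq> \<zero>} \<subseteq> {?n}" by (auto simp: delta_def)
    then have "finite {k. ?x k \<noteq> \<zero>}" by (rule finite_subset) simp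
    then have "?x \<in> carrier (rees R F)"
      unfolding car by (intro fin_suppI) (use r F0 in \<open>auto simp: delta_def\<close>)
    then obtain f where f: "\<And>a. a \<in> A \<Longrightarrow> f a \<in> fin_supp R ?E"
      and x: "?x = (\<Oplus>\<^bsub>rees R F\<^esub> a \<in> A. f a \<odot>\<^bsub>rees R F\<^esub> a)" using gen unfolding car by blast
    \<comment> \<open>Instead of evaluating the sum in degree \<open>?n\<close>, each summand is
      placed in this additively closed set.\<close>
    let ?H = "{g \<in> carrier (rees R F). g ?n \<in> ?E c}"
    have "(\<Oplus>\<^bsub>rees R F\<^esub> a \<in> A. f a \<odot>\<^bsub>rees R F\<^esub> a) \<in> ?H"
    proof (rule finsum_mem[OF M.abelian_monoid_axioms])
      show "\<zero>\<^bsub>rees R F\<^esub> \<in> ?H" using M.zero_closed K.zero_closed by (simp add: rees_def)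
      fix g h assume gh: "g \<in> ?H" "h \<in> ?H"
      then have "(g \<oplus>\<^bsub>rees R F\<^esub> h) ?n \<in> ?E c" using K.a_closed by (simp add: rees_def)
      then show "g \<oplus>\<^bsub>rees R F\<^esub> h \<in> ?H" using gh by simp
    next
      fix a assume a: "a \<in> A"
      have fa: "f a k \<in> ?E k" "finite {k. f a k \<noteq> \<zero>}" for k using fin_suppD[OF f[OF a]] by auto
      have fc: "f a k \<in> carrier R" for k using fa(1) EF Fc by blast
      have am: "a k \<in> F k" for k using A(2) a fin_suppD(1)[of a R F] unfolding car by blast
      have sm: "f a \<odot>\<^bsub>rees R F\<^esub> a = laurent_mult R (f a) a" by (simp add: rees_def)
      have "laurent_mult R (f a) a \<in> fin_supp R F"
      proof (rule fin_suppI)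
        show "finite {k. laurent_mult R (f a) a k \<noteq> \<zero>}"
          by (rule laurent_mult_support[OF fc As(1)[OF a] fa(2) As(2)[OF a]])
        fix k
        interpret Fk: ideal "F k" R by (rule Fi)
        show "laurent_mult R (f a) a k \<in> F k" unfolding laurent_mult_def
        proof (rule finsum_mem[OF abelian_monoid_axioms Fk.a_subset Fk.zero_closed Fk.a_closed])
          fix j
          have "f a j \<otimes> a (k - j) \<in> F j \<cdot> F (k - j)" using fa(1) EF am by (intro ideal_prod.prod) auto
          then show "f a j \<otimes> a (k - j) \<in> F k" using FF[of j "k - j"] by auto
        qed
      qed
      moreover have "laurent_mult R (f a) a ?n \<in> ?E c" unfolding laurent_mult_def
      proof (rule finsum_mem[OF abelian_monoid_axioms K.a_subset K.zero_closed K.a_closed])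
        fix j
        show "f a j \<otimes> a (?n - j) \<in> ?E c"
        proof (cases "a (?n - j) = \<zero>")
          case False
          have "?n - (?n - j) - c = j - c" by simp
          then have "0 \<le> j - c" using supp[OF a False] by simp
          then have "c \<le> j" by (simp add: less_eq_vec_def)
          then have "f a j \<in> ?E c" using fa(1) ideal_power_dec[where I = I, OF I c] by blast
          then show ?thesis by (rule K.I_r_closed[OF _ As(1)[OF a]])
        qed (use fc in simp)
      qed
      ultimately show "f a \<odot>\<^bsub>rees R F\<^esub> a \<in> ?H" unfolding sm car by simp
    qed (simp add: subset_iff)
    then have "?x ?n \<in> ?E c" unfolding x[symmetric] by simp
    then show ?thesis by (simp add: delta_def)
  qed
  then show ?thesis by blast
qed

end

text \<open>An application of \<open>graded_vanishing\<close> with \<delta> = e_j and ws the classes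
  of generators of I_j. The Cech generators are those picked by \<open>hom_generators\<close>, so
  all that can be used of them is that they are homogeneous and generate S_{++}.\<close>

lemma regular_comp_vanishes:
  fixes R (structure) and F :: "int ^ 's::finite \<Rightarrow> 'a set"
  assumes noeth: "noetherian_ring R" and cr: "cring R" and I: "\<And>i. ideal (I i) R" and F: "filtration R I F"
    and reg: "regular (assoc_graded R (ideal_power R I)) (assoc_graded_comp R (ideal_power R I))
       (assoc_graded R F) (assoc_graded_comp R F) m"
    and c: "m + axis j 1 \<le> c" and start: "assoc_graded_comp R F (c - axis j 1) = {\<zero>\<^bsub>assoc_graded R F\<^esub>}"
  shows "assoc_graded_comp R F c = {\<zero>\<^bsub>assoc_graded R F\<^esub>}"
proof -
  let ?E = "ideal_power R I" and ?\<delta> = "axis j 1 :: int ^ 's"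
  let ?S = "assoc_graded R ?E" and ?M = "assoc_graded R F"
  let ?gS = "assoc_graded_comp R ?E" and ?gM = "assoc_graded_comp R F"
  interpret noetherian_ring R by (rule noeth)
  interpret cring R by (rule cr)
  \<comment> \<open>Used for p = 1, where it shows that S_{++} has homogeneous generators, and for p
    = e_j, where it expresses elements of higher degree through the Koszul operators.\<close>
  have gens: "\<exists>gs. set gs \<subseteq> ?E p \<and> (\<forall>n r. p \<le> n \<longrightarrow> r \<in> ?E n \<longrightarrow>
      (\<exists>qs. length qs = length gs \<and> set qs \<subseteq> ?E (n - p) \<and> dot R gs qs = r))" if p: "0 \<le> p" for p
  proof -
    obtain A where A: "A \<subseteq> carrier R" "finite A" "?E p = Idl A" using finetely_gen[OF ideal_power_ideal[where I = I, OF I]] by blast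
    obtain gs where gs: "set gs = A" using finite_list[OF A(2)] by blast
    have "\<exists>qs. length qs = length gs \<and> set qs \<subseteq> ?E (n - p) \<and> dot R gs qs = r" if "p \<le> n" "r \<in> ?E n" for n r
    proof (rule ideal_generators_dot)
      show "set gs \<subseteq> carrier R" using A gs by simp
      show "ideal (?E (n - p)) R" by (rule ideal_power_ideal[where I = I, OF I])
      have "0 \<le> n - p" using that(1) by (simp add: less_eq_vec_def)
      then have "?E (p + (n - p)) = ?E p \<cdot> ?E (n - p)" by (rule ideal_power_add[where I = I, OF I p])
      then show "r \<in> (Idl (set gs)) \<cdot> ?E (n - p)" using that(2) A(3) gs by simp
    qed
    moreover have "set gs \<subseteq> ?E p" using genideal_self[OF A(1)] A(3) gs by simp
    ultimately show ?thesis by blast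
  qed
  interpret filtration_module R ?E F by (rule filtration_module_ideal_power[OF I F])
  have one_nonneg: "(0 :: int ^ 's) \<le> 1" and \<delta>: "0 \<le> ?\<delta>" by (auto simp: less_eq_vec_def axis_def)
  define xs where "xs = hom_generators ?S ?gS (irrelevant_ideal ?S ?gS)"
  have xs_gen: "set xs \<subseteq> (\<Union>n. ?gS n)" "Idl\<^bsub>?S\<^esub> (set xs) = irrelevant_ideal ?S ?gS"
  proof -
    obtain gs where "set gs \<subseteq> ?E 1" "\<And>n r. 1 \<le> n \<Longrightarrow> r \<in> ?E n \<Longrightarrow>
      \<exists>qs. length qs = length gs \<and> set qs \<subseteq> ?E (n - 1) \<and> dot R gs qs = r" using gens[OF one_nonneg] by blast
    then have "\<exists>xs. set xs \<subseteq> (\<Union>n. ?gS n) \<and> Idl\<^bsub>?S\<^esub> (set xs) = irrelevant_ideal ?S ?gS"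
      unfolding E.irrelevant_eq by (rule E.hom_generators_ex)
    then have "set xs \<subseteq> (\<Union>n. ?gS n) \<and> Idl\<^bsub>?S\<^esub> (set xs) = irrelevant_ideal ?S ?gS"
      unfolding xs_def hom_generators_def by (rule someI_ex)
    then show "set xs \<subseteq> (\<Union>n. ?gS n)" "Idl\<^bsub>?S\<^esub> (set xs) = irrelevant_ideal ?S ?gS" by auto
  qed
  have "\<forall>i. \<exists>n. i < length xs \<longrightarrow> xs ! i \<in> ?gS n" using xs_gen(1) nth_mem by blast
  then obtain dg where dg: "\<And>i. i < length xs \<Longrightarrow> xs ! i \<in> ?gS (dg i)" by metis
  interpret graded_cech ?S ?M ?gS ?gM F.gproj xs dg by unfold_locales (rule dg)
  obtain gs where gs: "set gs \<subseteq> ?E ?\<delta>" and gs_gen: "\<And>n r. ?\<delta> \<le> n \<Longrightarrow> r \<in> ?E n \<Longrightarrow>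
      \<exists>qs. length qs = length gs \<and> set qs \<subseteq> ?E (n - ?\<delta>) \<and> dot R gs qs = r" using gens[OF \<delta>] by blast
  have gs0: "set gs \<subseteq> E.F0 ?\<delta>" using gs \<delta> by (simp add: E.F0_def)
  let ?ws = "map (\<lambda>g. E.cls (delta R ?\<delta> g)) gs"
  show ?thesis
  proof (rule graded_vanishing)
    show ws: "set ?ws \<subseteq> ?gS ?\<delta>" using gs0 E.cls_delta_comp by auto
    show "?gM (c - ?\<delta>) = {\<zero>\<^bsub>?M\<^esub>}" by (rule start)
    show "\<exists>ys. length ys = length ?ws \<and> set ys \<subseteq> ?gS (dg i - ?\<delta>) \<and> dot ?S ?ws ys = xs ! i"
      if i: "i < length xs" for i
    proof -
      have xi: "xs ! i \<in> ?gS (dg i)" by (rule dg[OF i])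
      have "set xs \<subseteq> carrier ?S" using xs_gen(1) E.comp_carrier by blast
      then have "xs ! i \<in> E.irrelevant"
        using R.genideal_self[of "set xs"] nth_mem[OF i] xs_gen(2) unfolding E.irrelevant_eq by auto
      \<comment> \<open>If the generator is zero, \<open>dg i\<close> carries no information, and
        zero coefficients are used.\<close>
      then consider "xs ! i = \<zero>\<^bsub>?S\<^esub>" | "1 \<le> dg i" using E.comp_irrelevant_cases[OF xi] by blast
      then show ?thesis
      proof cases
        case 1
        have "set ?ws \<subseteq> carrier ?S" using ws E.comp_carrier by blast
        then have "dot ?S ?ws (replicate (length ?ws) \<zero>\<^bsub>?S\<^esub>) = xs ! i" unfolding 1 by (rule R.dot_zeros)
        moreover have "set (replicate (length ?ws) \<zero>\<^bsub>?S\<^esub>) \<subseteq> ?gS (dg i - ?\<delta>)" using E.zero_comp by auto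
        ultimately show ?thesis by (intro exI[of _ "replicate (length ?ws) \<zero>\<^bsub>?S\<^esub>"]) simp
      next
        case 2
        then have d: "1 \<le> dg i $ k" for k by (simp add: less_eq_vec_def)
        have "?\<delta> $ k \<le> dg i $ k" for k using d[of k] by (auto simp: axis_def)
        then have \<delta>d: "?\<delta> \<le> dg i" by (simp add: less_eq_vec_def)
        have nn: "0 \<le> dg i - ?\<delta>" using \<delta>d by (simp add: less_eq_vec_def)
        have n: "0 \<le> dg i" by (rule vec_le_of_diff[OF \<delta> nn])
        have "\<exists>ys. length ys = length gs \<and> set ys \<subseteq> ?gS (dg i - ?\<delta>) \<and> dot ?S ?ws ys = xs ! i"
        proof (rule E.comp_dot[OF gs0 xi])
          fix r assume "r \<in> E.F0 (dg i)"
          then have "r \<in> ?E (dg i)" using n by (simp add: E.F0_def)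
          then show "\<exists>qs. length qs = length gs \<and> set qs \<subseteq> E.F0 (dg i - ?\<delta>) \<and> dot R gs qs = r"
            using gs_gen[OF \<delta>d] nn by (simp add: E.F0_def)
        qed
        then show ?thesis by simp
      qed
    qed
    show "b \<in> cech_coboundaries ?S ?M xs i"
      if b: "b \<in> cech_cocycles ?S ?M xs i" "b \<in> Ch i (c - int i *s ?\<delta>)" for i b
    proof (rule cech_coboundariesI[OF _ b])
      have all: "\<forall>n\<ge>0. (\<forall>k. cech_cohomology_comp ?S ?gS ?M ?gM xs 0 (n + m + axis k 1)
            = {\<zero>\<^bsub>cech_cohomology ?S ?M xs 0\<^esub>})
          \<and> (\<forall>i\<ge>1. \<forall>p\<ge>0. (\<Sum>k\<in>UNIV. p $ k) = int i - 1 \<longrightarrow>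
            cech_cohomology_comp ?S ?gS ?M ?gM xs i (n + m - p) = {\<zero>\<^bsub>cech_cohomology ?S ?M xs i\<^esub>})"
        using reg unfolding regular_def Let_def local_cohomology_def local_cohomology_comp_def xs_def[symmetric] .
      have reg0: "cech_cohomology_comp ?S ?gS ?M ?gM xs 0 (n + m + axis k 1) = {\<zero>\<^bsub>cech_cohomology ?S ?M xs 0\<^esub>}"
        if "0 \<le> n" for n k
        using all that by simp
      have reg1: "cech_cohomology_comp ?S ?gS ?M ?gM xs i (n + m - p) = {\<zero>\<^bsub>cech_cohomology ?S ?M xs i\<^esub>}"
        if "0 \<le> n" "1 \<le> i" "0 \<le> p" "(\<Sum>k\<in>UNIV. p $ k) = int i - 1" for n i p
        using all that by simp
      \<comment> \<open>The shift in the regularity conditions; it is nonnegative because c exceeds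
        m by at least e_j.\<close>
      have n: "0 \<le> c - ?\<delta> - m" using c by (simp add: less_eq_vec_def algebra_simps)
      show "cech_cohomology_comp ?S ?gS ?M ?gM xs i (c - int i *s ?\<delta>) = {\<zero>\<^bsub>cech_cohomology ?S ?M xs i\<^esub>}"
      proof (cases i)
        case 0
        \<comment> \<open>The e_j in the condition on the zeroth cohomology restores the one
          subtracted in the shift.\<close>
        have "c - int 0 *s ?\<delta> = (c - ?\<delta> - m) + m + ?\<delta>" by (simp add: vec_eq_iff)
        then show ?thesis using reg0[OF n, of j] unfolding 0 by simp
      next
        case (Suc l)
        \<comment> \<open>With i = l + 1 and p = l e_j, of total degree i - 1, the degree prescribed
          by regularity is c - i e_j.\<close>
        have eq: "c - int i *s ?\<delta> = (c - ?\<delta> - m) + m - int l *s ?\<delta>"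
          unfolding Suc by (simp add: vec_eq_iff algebra_simps)
        have p: "0 \<le> int l *s ?\<delta>" by (simp add: less_eq_vec_def axis_def)
        have "(\<Sum>k\<in>UNIV. (int l *s ?\<delta>) $ k) = (\<Sum>k\<in>UNIV. if k = j then int l else 0)"
          by (intro sum.cong) (auto simp: axis_def)
        then have sum: "(\<Sum>k\<in>UNIV. (int l *s ?\<delta>) $ k) = int i - 1" by (simp add: Suc)
        show ?thesis unfolding eq by (rule reg1[OF n _ p sum]) (simp add: Suc)
      qed
    qed
  qed
qed

theorem theorem3p2:
  fixes R :: "('a, 'x) ring_scheme" (structure)
    and m :: "'a set"
    and d :: nat
    and I :: "'s::finite \<Rightarrow> 'a set"
    and F :: "int ^ 's \<Rightarrow> 'a set"
  assumes "noetherian_ring R"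
    and "local_ring R m"
    and "krull_dim R = enat d"
    and "d \<ge> 1"
    and "infinite (carrier (R Quot m))"
    and "\<And>i. primary_to R m (I i)"
    and "admissible_filtration R I F"
  shows "reg (assoc_graded R (ideal_power R I)) (assoc_graded_comp R (ideal_power R I))
             (assoc_graded R F) (assoc_graded_comp R F)
           \<subseteq> {n. 0 \<le> n}"
proof
  fix u assume "u \<in> reg (assoc_graded R (ideal_power R I)) (assoc_graded_comp R (ideal_power R I))
             (assoc_graded R F) (assoc_graded_comp R F)"
  then have reg: "regular (assoc_graded R (ideal_power R I)) (assoc_graded_comp R (ideal_power R I))
       (assoc_graded R F) (assoc_graded_comp R F) u" by (simp add: reg_def)
  let ?E = "ideal_power R I" and ?gM = "assoc_graded_comp R F"
  have cr: "cring R" and max: "maximalideal m R" using assms(2) by (auto simp: local_ring_def)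
  interpret cring R by (rule cr)
  interpret m: maximalideal m R by (rule max)
  have I: "ideal (I i) R" and rad: "ideal_radical R (I i) = m" for i
    using assms(6)[of i] by (auto simp: primary_to_def primary_ideal_def)
  have F: "filtration R I F" and fin: "finite_module (rees R ?E) (rees R F)"
    using assms(7) by (auto simp: admissible_filtration_def)
  interpret fm: filtration_module R ?E F by (rule filtration_module_ideal_power[OF I F])
  show "u \<in> {n. 0 \<le> n}"
  proof (rule ccontr)
    assume "u \<notin> {n. 0 \<le> n}"
    then obtain j where j: "u $ j < 0" by (auto simp: less_eq_vec_def not_le)
    have axj: "axis j 1 $ k = (if k = j then 1 else 0 :: int)" for k by (simp add: axis_def)
    \<comment> \<open>Induction on the j-th coordinate; the other coordinates of c stay
      fixed.\<close>
    have zero: "?gM c = {\<zero>\<^bsub>assoc_graded R F\<^esub>}" if "0 \<le> c" "u + axis j 1 \<le> c" for c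
      using that
    proof (induct "nat (c $ j)" arbitrary: c)
      case 0
      then have "c $ j \<le> 0" by simp
      then have "(c - axis j 1) $ j < 0" by (simp add: axj)
      then have "\<not> 0 \<le> c - axis j 1" by (metis less_eq_vec_def not_le zero_index)
      then show ?case
        using regular_comp_vanishes[OF assms(1) cr I F reg 0(3)] fm.F.comp_nonneg by blast
    next
      case (Suc k)
      have "c $ j = int k + 1" using Suc(2) by linarith
      then have 1: "nat ((c - axis j 1) $ j) = k" by (simp add: axj)
      have 2: "0 \<le> c - axis j 1"
        unfolding less_eq_vec_def
      proof
        fix i have "0 \<le> c $ i" using Suc(3) by (simp add: less_eq_vec_def)
        then show "0 $ i \<le> (c - axis j 1) $ i" using \<open>c $ j = int k + 1\<close> by (simp add: axj)
      qed
      \<comment> \<open>Only the j-th coordinate is at issue, where u_j + 1 \<le> 0 \<le> c_j - 1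
        because u_j < 0.\<close>
      have 3: "u + axis j 1 \<le> c - axis j 1"
        unfolding less_eq_vec_def
      proof
        fix i have "(u + axis j 1) $ i \<le> c $ i" using Suc(4) by (simp add: less_eq_vec_def)
        then show "(u + axis j 1) $ i \<le> (c - axis j 1) $ i"
          using \<open>c $ j = int k + 1\<close> j by (cases "i = j") (simp_all add: axj)
      qed
      show ?case
        by (rule regular_comp_vanishes[OF assms(1) cr I F reg Suc(4) Suc(1)[OF 1[symmetric] 2 3]])
    qed
    have F_eq: "F c \<subseteq> F (c + 1)" if "0 \<le> c" "u + axis j 1 \<le> c" for c
    proof
      fix r assume r: "r \<in> F c"
      then have "fm.F.cls (delta R c r) \<in> ?gM c" using that(1) by (intro fm.F.cls_delta_comp) (simp add: fm.F.F0_def)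
      then show "r \<in> F (c + 1)" using zero[OF that] fm.F.cls_delta_zero_imp[OF that(1) r] by blast
    qed
    \<comment> \<open>The least degree that is \<ge> 0 and \<ge> u + e_j; adding multiples of (1,
      ..., 1) stays in the range of \<open>F_eq\<close>.\<close>
    define c where "c = pos_part (u + axis j 1)"
    have c: "0 \<le> c" "u + axis j 1 \<le> c" by (auto simp: c_def pos_part_def less_eq_vec_def)
    have F_shift: "F c \<subseteq> F (c + int t *s 1)" for t
    proof (induct t)
      case 0
      have "c + int 0 *s 1 = c" by (simp add: vec_eq_iff)
      then show ?case by simp
    next
      case (Suc t)
      have "c \<le> c + int t *s 1" by (simp add: less_eq_vec_def)
      then have "F (c + int t *s 1) \<subseteq> F (c + int t *s 1 + 1)" using c by (intro F_eq) auto
      moreover have "c + int t *s 1 + 1 = c + int (Suc t) *s 1" by (simp add: vec_eq_iff)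
      ultimately show ?case using Suc by simp
    qed
    have c1: "0 \<le> c + 1" by (rule fm.F.nonneg_Suc[OF c(1)])
    \<comment> \<open>The exponent c + 1 instead of c gains the factor I^(1, ..., 1) \<subseteq> m
      for Nakayama's lemma.\<close>
    obtain t where t: "F (c + 1 + int t *s 1) \<subseteq> ?E (c + 1)"
      using filtration_shift_subset[OF I F fin c1] by blast
    have eq: "c + 1 + int t *s 1 = c + int (Suc t) *s 1" by (simp add: vec_eq_iff)
    have "?E c \<subseteq> F c" using F by (simp add: filtration_def)
    also have "F c \<subseteq> F (c + int (Suc t) *s 1)" by (rule F_shift)
    also have "\<dots> \<subseteq> ?E (c + 1)" using t unfolding eq .
    also have "\<dots> = ?E 1 \<cdot> ?E c"
      using ideal_power_add[where I = I, OF I c(1), of 1] ideal_prod_commute[OF ideal_power_ideal[where I = I, OF I] ideal_power_ideal[where I = I, OF I]]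
      by (simp add: less_eq_vec_def)
    also have "\<dots> \<subseteq> m \<cdot> ?E c"
    proof (rule ideal_prod_mono[OF _ subset_refl])
      have "I j \<subseteq> m"
      proof
        fix a assume a: "a \<in> I j"
        then have "a \<in> carrier R" by (rule ideal.Icarr[OF I])
        then have "a [^] (1::nat) \<in> I j" using a by simp
        then show "a \<in> m" using \<open>a \<in> carrier R\<close> unfolding rad[of j, symmetric] ideal_radical_def by blast
      qed
      then show "?E 1 \<subseteq> m" using ideal_power_one_subset[where I = I, OF I] by blast
    qed
    finally have "?E c \<subseteq> m \<cdot> ?E c" .
    then have E0: "?E c = {\<zero>}" by (rule nakayama[OF assms(1,2) ideal_power_ideal[where I = I, OF I]])
    \<comment> \<open>Every element of m has a power in I^c = 0, so m is contained in each
      prime.\<close>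
    have "P = m" if P: "primeideal P R" for P
    proof -
      interpret P: primeideal P R by (rule P)
      have "m \<subseteq> P"
      proof
        fix a assume a: "a \<in> m"
        then have ac: "a \<in> carrier R" using m.a_subset by auto
        have "\<exists>k::nat. a [^] k \<in> I i" for i using a rad[of i] by (auto simp: ideal_radical_def)
        then obtain k :: nat where "a [^] k \<in> ?E c" using ideal_power_contains_pow[where I = I, OF I ac] by blast
        then have "a [^] k \<in> P" using E0 P.zero_closed by simp
        then show "a \<in> P" by (rule prime_pow_mem[OF P ac])
      qed
      then show ?thesis using m.I_maximal[OF P.is_ideal _ P.a_subset] P.I_notcarr by auto
    qed
    then have "krull_dim R = 0" by (rule krull_dim_zero)
    then show False using assms(3,4) by (simp add: zero_enat_def)
  qed
qed

end
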